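(* (i) Let $\mathcal M$ be a computationally adequate $\lambda_l$-model and let $\cdot\vdash p:I$ be a closed $\lambda_l$-term of type $I$. Then $[\![p]\!]\neq\perp_{I,I}$ if and only if $p\Downarrow$. (ii) Let $\mathcal M$ be a computationally adequate $\lambda_a$-model and let $\cdot\vdash p:I$ be a closed $\lambda_a$-term of type $I$. Then $[\![p]\!]\neq\perp_{I,I}$ if and only if $p\Downarrow$. Here $p\Downarrow$ means there is a value $v$ with $p\Downarrow v$.
   Context: SYNTAX. Types: $A,B,C ::= I \mid A+B \mid A\otimes B \mid A\multimap B \mid\ !A$; non-linear types $P,R ::= I\mid P+R\mid P\otimes R\mid\ !A$. Contexts $\Gamma,\Sigma$ are finite lists of distinct typed variables; non-linear contexts $\Phi$ contain only non-linear types; $\Gamma,\Sigma$ is a union of disjoint contexts. Terms: $m,n,p ::= x \mid * \mid m;n \mid \mathtt{left}_{A,B}m \mid \mathtt{right}_{A,B}m \mid \mathtt{case}\ m\ \mathtt{of}\ \{\mathtt{left}\ x\to n\mid\mathtt{right}\ y\to p\} \mid \langle m,n\rangle \mid \mathtt{let}\ \langle x,y\rangle=m\ \mathtt{in}\ n \mid \lambda x^A.m \mid mn \mid \mathtt{lift}\ m \mid \mathtt{force}\ m \mid \mathtt{rec}\ z^{!A}.m$. Values: $v,w::=x\mid *\mid\mathtt{left}_{A,B}v\mid\mathtt{right}_{A,B}v\mid\langle v,w\rangle\mid\lambda x^A.m\mid\mathtt{lift}\ m$. Typing rules of $\lambda_l$ ($\Gamma,\Sigma$ disjoint): $\Phi,x:A\vdash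 x:A$; $\Phi\vdash *:I$; $\Phi\vdash m:A \Rightarrow \Phi\vdash\mathtt{lift}\ m:\ !A$; $\Phi,\Gamma\vdash m:I$ and $\Phi,\Sigma\vdash n:A\Rightarrow\Phi,\Gamma,\Sigma\vdash m;n:A$; $\Gamma\vdash m:\ !A\Rightarrow\Gamma\vdash\mathtt{force}\ m:A$; $\Gamma\vdash m:A\Rightarrow\Gamma\vdash\mathtt{left}_{A,B}m:A+B$; $\Gamma\vdash m:B\Rightarrow\Gamma\vdash\mathtt{right}_{A,B}m:A+B$; $\Phi,\Gamma\vdash m:A+B$, $\Phi,\Sigma,x:A\vdash n:C$, $\Phi,\Sigma,y:B\vdash p:C\Rightarrow\Phi,\Gamma,\Sigma\vdash\mathtt{case}\ m\ \mathtt{of}\ \{\mathtt{left}\ x\to n\mid\mathtt{right}\ y\to p\}:C$; $\Phi,\Gamma\vdash m:A$, $\Phi,\Sigma\vdash n:B\Rightarrow\Phi,\Gamma,\Sigma\vdash\langle m,n\rangle:A\otimes B$; $\Phi,\Gamma\vdash m:A\otimes B$, $\Phi,\Sigma,x:A,y:B\vdash n:C\Rightarrow\Phi,\Gamma,\Sigma\vdash\mathtt{let}\ \langle x,y\rangle=m\ \mathtt{in}\ n:C$; $\Gamma,x:A\vdash m:B\Rightarrow\Gamma\vdash\lambda x^A.m:A\multimap B$; $\Phi,\Gamma\vdash m:A\multimap B$, $\Phi,\Sigma\vdash n:A\Rightarrow\Phi,\Gamma,\Sigma\vdash mn:B$; $\Phi,z:\ !A\vdash m:A\Rightarrow\Phi\vdash\mathtt{rec}\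 z^{!A}.m:A$. The calculus $\lambda_a$ has the same rules except the first three are replaced by $\Gamma,x:A\vdash x:A$; $\Gamma\vdash *:I$; $\Phi\vdash m:A\Rightarrow\Phi,\Gamma\vdash\mathtt{lift}\ m:\ !A$. OPERATIONAL SEMANTICS ($m\Downarrow v$, call-by-value big-step): $x\Downarrow x$; $*\Downarrow *$; $m\Downarrow *,\ n\Downarrow v\Rightarrow m;n\Downarrow v$; $m\Downarrow v\Rightarrow\mathtt{left}\ m\Downarrow\mathtt{left}\ v$ and $\mathtt{right}\ m\Downarrow\mathtt{right}\ v$; $m\Downarrow\mathtt{left}\ v,\ n[v/x]\Downarrow w\Rightarrow\mathtt{case}\ m\ \mathtt{of}\ \{\mathtt{left}\ x\to n\mid\mathtt{right}\ y\to p\}\Downarrow w$; $m\Downarrow\mathtt{right}\ v,\ p[v/y]\Downarrow w\Rightarrow$ (same case term) $\Downarrow w$; $m\Downarrow v,\ n\Downarrow w\Rightarrow\langle m,n\rangle\Downarrow\langle v,w\rangle$; $m\Downarrow\langle v,v'\rangle,\ n[v/x,v'/y]\Downarrow w\Rightarrow\mathtt{let}\ \langle x,y\rangle=m\ \mathtt{in}\ n\Downarrow w$; $\lambda x.m\Downarrow\lambda x.m$; $m\Downarrow\lambda x.m',\ n\Downarrow v,\ m'[v/x]\Downarrow w\Rightarrow mn\Downarrow w$; $\mathtt{lift}\ m\Downarrow\mathtt{lift}\ m$; $m\Downarrow\mathtt{lift}\ m',\ m'\Downarrow v\Rightarrow\mathtt{force}\ m\Downarrow v$; $m[\mathtt{lift}\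 \mathtt{rec}\ z^{!A}.m/z]\Downarrow v\Rightarrow\mathtt{rec}\ z^{!A}.m\Downarrow v$. MODELS. A $\lambda_l$-model consists of: (1) a cartesian category $(\mathbf B,\times,1)$ with finite coproducts $(\amalg,\varnothing)$; (2) a symmetric monoidal category $(\mathbf V,\otimes_{\mathbf V},I_{\mathbf V})$ with finite coproducts $(+_{\mathbf V},0_{\mathbf V})$; (3) a symmetric monoidal category $(\mathbf C,\otimes,I)$ with finite coproducts $(+,0)$; (4) symmetric monoidal adjunctions $J\dashv K$ ($J:\mathbf B\to\mathbf V$) and $L\dashv R$ ($L:\mathbf V\to\mathbf C$); put $F=LJ$, $G=KR$, $!=FG:\mathbf C\to\mathbf C$, with unit $\eta:\mathrm{Id}\Rightarrow GF$ and counit $\epsilon:\ !\Rightarrow\mathrm{Id}$ of $F\dashv G$; (5) for each object $A$ of $\mathbf V$ a functor $A\multimap -:\mathbf C\to\mathbf V$ right adjoint to $L(-\otimes_{\mathbf V}A)$, with transpose $\mathrm{curry}:\mathbf C(L(X\otimes_{\mathbf V}A),B)\to\mathbf V(X,A\multimap B)$ and counit $\mathrm{eval}:L((A\multimap B)\otimes_{\mathbf V}A)\to B$; (6) for each object $B$ of $\mathbf B$ the functor $FB\otimes\ !(-):\mathbf C\to\mathbf C$ has an initial algebra $\omega:FB\otimes\ !\Omega\to\Omega$ such that $\omega^{-1}$ is a final coalgebra. A $\lambda_a$-model is a $\lambda_l$-model in which $I_{\mathbf V}$ is terminal in $\mathbf V$. A ($\lambda_l$- or $\lambda_a$-)model is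 order-enriched if $\mathbf B$ and $\mathbf V$ are enriched over the category of cpos (posets with suprema of increasing $\omega$-chains) and Scott-continuous maps, $\mathbf C$ is enriched over the category of pointed cpos and strict Scott-continuous maps, the coproduct and monoidal structures are enriched over cpos (locally Scott-continuous), and the functors $L,R,J,K$ and $\multimap$ are enriched over cpos (locally Scott-continuous). It is computationally adequate if it is order-enriched and $\mathrm{id}_I\neq\perp_{I,I}$, where $\perp_{A,B}$ denotes the least element of the hom-cpo $\mathbf C(A,B)$. TYPE INTERPRETATION. Objects $[\![A]\!]\in\mathbf C$, $[\![A]\!]_{\mathbf V}\in\mathbf V$ and, for non-linear $P$, $[\![P]\!]_{\mathbf B}\in\mathbf B$: $[\![I]\!]=I$, $[\![I]\!]_{\mathbf V}=I_{\mathbf V}$, $[\![I]\!]_{\mathbf B}=1$; $[\![!A]\!]=\ ![\![A]\!]$, $[\![!A]\!]_{\mathbf V}=JG[\![A]\!]$, $[\![!A]\!]_{\mathbf B}=G[\![A]\!]$; $[\![A+B]\!]=[\![A]\!]+[\![B]\!]$, $[\![A+B]\!]_{\mathbf V}=[\![A]\!]_{\mathbf V}+_{\mathbf V}[\![B]\!]_{\mathbf V}$, $[\![P+R]\!]_{\mathbf B}=[\![P]\!]_{\mathbf B}\amalg[\![R]\!]_{\mathbf B}$; $[\![A\otimes B]\!]=[\![A]\!]\otimes[\![B]\!]$, $[\![A\otimes B]\!]_{\mathbf V}=[\![A]\!]_{\mathbf V}\otimes_{\mathbf V}[\![B]\!]_{\mathbf V}$, $[\![P\otimes R]\!]_{\mathbf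 B}=[\![P]\!]_{\mathbf B}\times[\![R]\!]_{\mathbf B}$; $[\![A\multimap B]\!]=L([\![A]\!]_{\mathbf V}\multimap[\![B]\!])$, $[\![A\multimap B]\!]_{\mathbf V}=[\![A]\!]_{\mathbf V}\multimap[\![B]\!]$. Contexts are interpreted as tensor products ($I$, resp. $I_{\mathbf V}$, if empty) and non-linear contexts in $\mathbf B$ as products ($1$ if empty). Convention: coherence isomorphisms of monoidal structures, of the strong monoidal functors $J,L,F$ and of preservation of coproducts by $J,L,F$ are suppressed; thus $[\![A]\!]=L[\![A]\!]_{\mathbf V}$, $[\![\Gamma]\!]=L[\![\Gamma]\!]_{\mathbf V}$, and $[\![P]\!]=F[\![P]\!]_{\mathbf B}$, $[\![\Phi]\!]=F[\![\Phi]\!]_{\mathbf B}$ for non-linear $P,\Phi$. STRUCTURAL MAPS. For non-linear $X$: $\diamond_X=F(t):[\![X]\!]\to I$ with $t:[\![X]\!]_{\mathbf B}\to1$ unique; $\triangle_X=F\langle\mathrm{id},\mathrm{id}\rangle$; $\Box_X=F(\eta_{[\![X]\!]_{\mathbf B}}):[\![X]\!]\to\ ![\![X]\!]$. In a $\lambda_a$-model, for arbitrary $A$: $\diamond_A=L(u)$ with $u:[\![A]\!]_{\mathbf V}\to I_{\mathbf V}$ unique. TERM INTERPRETATION ($[\![m]\!]:[\![\Gamma]\!]\to[\![A]\!]$ in $\mathbf C$ by induction on derivations of $\Gamma\vdash m:A$; $s,s',s''$ are the evident symmetry isomorphisms). $\lambda_l$ clauses: $[\![\Phi,x:A\vdash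 x]\!]=\diamond_\Phi\otimes\mathrm{id}$; $[\![\Phi\vdash *]\!]=\diamond_\Phi$; $[\![m;n]\!]=([\![m]\!]\otimes[\![n]\!])\circ s\circ(\triangle_\Phi\otimes\mathrm{id})$, $s:[\![\Phi]\!]\otimes[\![\Phi]\!]\otimes[\![\Gamma]\!]\otimes[\![\Sigma]\!]\to[\![\Phi]\!]\otimes[\![\Gamma]\!]\otimes[\![\Phi]\!]\otimes[\![\Sigma]\!]$; $[\![\mathtt{left}\,m]\!]=\mathrm{inl}\circ[\![m]\!]$, $[\![\mathtt{right}\,m]\!]=\mathrm{inr}\circ[\![m]\!]$; $[\![\mathtt{case}\cdots]\!]=[[\![n]\!],[\![p]\!]]\circ\delta\circ(\mathrm{id}\otimes[\![m]\!])\circ s'\circ(\triangle_\Phi\otimes\mathrm{id})$ with $s'$ onto $[\![\Phi]\!]\otimes[\![\Sigma]\!]\otimes[\![\Phi]\!]\otimes[\![\Gamma]\!]$ and $\delta$ the canonical distributivity isomorphism $Y\otimes([\![A]\!]+[\![B]\!])\cong(Y\otimes[\![A]\!])+(Y\otimes[\![B]\!])$; $[\![\langle m,n\rangle]\!]=([\![m]\!]\otimes[\![n]\!])\circ s\circ(\triangle_\Phi\otimes\mathrm{id})$; $[\![\mathtt{let}\ \langle x,y\rangle=m\ \mathtt{in}\ n]\!]=[\![n]\!]\circ s''\circ([\![m]\!]\otimes\mathrm{id})\circ s\circ(\triangle_\Phi\otimes\mathrm{id})$, $s''$ onto $[\![\Phi]\!]\otimes[\![\Sigma]\!]\otimes[\![A]\!]\otimes[\![B]\!]$;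 $[\![\Gamma\vdash\lambda x^A.m]\!]=L(\mathrm{curry}([\![m]\!]))$; $[\![mn]\!]=\mathrm{eval}\circ([\![m]\!]\otimes[\![n]\!])\circ s\circ(\triangle_\Phi\otimes\mathrm{id})$; $[\![\Phi\vdash\mathtt{lift}\ m]\!]=\ ![\![m]\!]\circ\Box_\Phi$; $[\![\mathtt{force}\ m]\!]=\epsilon\circ[\![m]\!]$; for $\Phi\vdash\mathtt{rec}\ z^{!A}.m:A$ with initial algebra $\omega:F[\![\Phi]\!]_{\mathbf B}\otimes\ !\Omega\to\Omega$, let $\sigma_m:\Omega\to[\![A]\!]$ be unique with $\sigma_m\circ\omega=[\![m]\!]\circ(\mathrm{id}\otimes\ !\sigma_m)$ and $\gamma:[\![\Phi]\!]\to\Omega$ unique with $\omega^{-1}\circ\gamma=(\mathrm{id}\otimes\ !\gamma)\circ(\mathrm{id}\otimes\Box_\Phi)\circ\triangle_\Phi$; $[\![\mathtt{rec}\ z^{!A}.m]\!]=\sigma_m\circ\gamma$. For $\lambda_a$-terms in a $\lambda_a$-model, same clauses except $[\![\Gamma,x:A\vdash x]\!]=\diamond_\Gamma\otimes\mathrm{id}$, $[\![\Gamma\vdash *]\!]=\diamond_\Gamma$, $[\![\Phi,\Gamma\vdash\mathtt{lift}\ m]\!]=\ ![\![m]\!]\circ\Box_\Phi\circ(\mathrm{id}\otimes\diamond_\Gamma)$. The empty context is interpreted as $I$, so $[\![\cdot\vdash p:I]\!]\in\mathbf C(I,I)$. *)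

theory Defs
  imports Main
begin

section \<open>Categories with finite products, coproducts and symmetric monoidal structure\<close>

record ('o, 'a) cat =
  obj :: "'o set"
  arr :: "'a set"
  src :: "'a \<Rightarrow> 'o"
  tgt :: "'a \<Rightarrow> 'o"
  ide :: "'o \<Rightarrow> 'a"
  cmp :: "'a \<Rightarrow> 'a \<Rightarrow> 'a"  (infixr "\<cdot>\<index>" 65)

definition hom :: "('o, 'a, 'm) cat_scheme \<Rightarrow> 'o \<Rightarrow> 'o \<Rightarrow> 'a set" where
  "hom C X Y = {f \<in> arr C. src C f = X \<and> tgt C f = Y}"

locale category =
  fixes C :: "('o, 'a, 'm) cat_scheme" (structure)
  assumes src_obj: "f \<in> arr C \<Longrightarrow> src C f \<in> obj C"
    and tgt_obj: "f \<in> arr C \<Longrightarrow> tgt C f \<in> obj C"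
    and ide_hom: "X \<in> obj C \<Longrightarrow> ide C X \<in> hom C X X"
    and cmp_hom: "f \<in> hom C X Y \<Longrightarrow> g \<in> hom C Y Z \<Longrightarrow> g \<cdot> f \<in> hom C X Z"
    and cmp_assoc: "f \<in> hom C X Y \<Longrightarrow> g \<in> hom C Y Z \<Longrightarrow> h \<in> hom C Z W \<Longrightarrow>
      h \<cdot> (g \<cdot> f) = (h \<cdot> g) \<cdot> f"
    and cmp_ide_left: "f \<in> hom C X Y \<Longrightarrow> ide C Y \<cdot> f = f"
    and cmp_ide_right: "f \<in> hom C X Y \<Longrightarrow> f \<cdot> ide C X = f"

definition is_inverse :: "('o, 'a, 'm) cat_scheme \<Rightarrow> 'a \<Rightarrow> 'a \<Rightarrow> bool" where
  "is_inverse C f g \<longleftrightarrow> f \<in> arr C \<and> g \<in> hom C (tgt C f) (src C f) \<and>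
     g \<cdot>\<^bsub>C\<^esub> f = ide C (src C f) \<and> f \<cdot>\<^bsub>C\<^esub> g = ide C (tgt C f)"

definition iso :: "('o, 'a, 'm) cat_scheme \<Rightarrow> 'a \<Rightarrow> bool" where
  "iso C f \<longleftrightarrow> (\<exists>g. is_inverse C f g)"

definition inv_arr :: "('o, 'a, 'm) cat_scheme \<Rightarrow> 'a \<Rightarrow> 'a" where
  "inv_arr C f = (THE g. is_inverse C f g)"

definition terminal :: "('o, 'a, 'm) cat_scheme \<Rightarrow> 'o \<Rightarrow> bool" where
  "terminal C T \<longleftrightarrow> T \<in> obj C \<and> (\<forall>X\<in>obj C. \<exists>!f. f \<in> hom C X T)"

definition the_arr :: "('o, 'a, 'm) cat_scheme \<Rightarrow> 'o \<Rightarrow> 'o \<Rightarrow> 'a" where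
  "the_arr C X T = (THE f. f \<in> hom C X T)"

record ('o, 'a) coprod_cat = "('o, 'a) cat" +
  init_ob :: 'o
  sum_ob :: "'o \<Rightarrow> 'o \<Rightarrow> 'o"
  inj1 :: "'o \<Rightarrow> 'o \<Rightarrow> 'a"
  inj2 :: "'o \<Rightarrow> 'o \<Rightarrow> 'a"

locale coproduct_category = category C
  for C :: "('o, 'a, 'm) coprod_cat_scheme" (structure) +
  assumes zero_obj: "init_ob C \<in> obj C"
    and zero_initial: "X \<in> obj C \<Longrightarrow> \<exists>!f. f \<in> hom C (init_ob C) X"
    and sum_obj: "X \<in> obj C \<Longrightarrow> Y \<in> obj C \<Longrightarrow> sum_ob C X Y \<in> obj C"
    and inj1_hom: "X \<in> obj C \<Longrightarrow> Y \<in> obj C \<Longrightarrow> inj1 C X Y \<in> hom C X (sum_ob C X Y)"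
    and inj2_hom: "X \<in> obj C \<Longrightarrow> Y \<in> obj C \<Longrightarrow> inj2 C X Y \<in> hom C Y (sum_ob C X Y)"
    and sum_universal: "f \<in> hom C X Z \<Longrightarrow> g \<in> hom C Y Z \<Longrightarrow>
      \<exists>!h. h \<in> hom C (sum_ob C X Y) Z \<and> h \<cdot> inj1 C X Y = f \<and> h \<cdot> inj2 C X Y = g"

definition copair :: "('o, 'a, 'm) coprod_cat_scheme \<Rightarrow> 'a \<Rightarrow> 'a \<Rightarrow> 'a" where
  "copair C f g = (THE h. h \<in> hom C (sum_ob C (src C f) (src C g)) (tgt C f) \<and>
     h \<cdot>\<^bsub>C\<^esub> inj1 C (src C f) (src C g) = f \<and> h \<cdot>\<^bsub>C\<^esub> inj2 C (src C f) (src C g) = g)"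

definition sum_arr :: "('o, 'a, 'm) coprod_cat_scheme \<Rightarrow> 'a \<Rightarrow> 'a \<Rightarrow> 'a" where
  "sum_arr C f g = copair C (inj1 C (tgt C f) (tgt C g) \<cdot>\<^bsub>C\<^esub> f) (inj2 C (tgt C f) (tgt C g) \<cdot>\<^bsub>C\<^esub> g)"

record ('o, 'a) cart_cat = "('o, 'a) coprod_cat" +
  term_ob :: 'o
  prd :: "'o \<Rightarrow> 'o \<Rightarrow> 'o"
  pr1 :: "'o \<Rightarrow> 'o \<Rightarrow> 'a"
  pr2 :: "'o \<Rightarrow> 'o \<Rightarrow> 'a"

locale cartesian_coproduct_category = coproduct_category C
  for C :: "('o, 'a, 'm) cart_cat_scheme" (structure) +
  assumes one_terminal: "terminal C (term_ob C)"
    and prd_obj: "X \<in> obj C \<Longrightarrow> Y \<in> obj C \<Longrightarrow> prd C X Y \<in> obj C"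
    and pr1_hom: "X \<in> obj C \<Longrightarrow> Y \<in> obj C \<Longrightarrow> pr1 C X Y \<in> hom C (prd C X Y) X"
    and pr2_hom: "X \<in> obj C \<Longrightarrow> Y \<in> obj C \<Longrightarrow> pr2 C X Y \<in> hom C (prd C X Y) Y"
    and prd_universal: "f \<in> hom C Z X \<Longrightarrow> g \<in> hom C Z Y \<Longrightarrow>
      \<exists>!h. h \<in> hom C Z (prd C X Y) \<and> pr1 C X Y \<cdot> h = f \<and> pr2 C X Y \<cdot> h = g"

definition pair :: "('o, 'a, 'm) cart_cat_scheme \<Rightarrow> 'a \<Rightarrow> 'a \<Rightarrow> 'a" where
  "pair C f g = (THE h. h \<in> hom C (src C f) (prd C (tgt C f) (tgt C g)) \<and>
     pr1 C (tgt C f) (tgt C g) \<cdot>\<^bsub>C\<^esub> h = f \<and> pr2 C (tgt C f) (tgt C g) \<cdot>\<^bsub>C\<^esub> h = g)"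

record ('o, 'a) sm_cat = "('o, 'a) coprod_cat" +
  unit :: 'o
  tob :: "'o \<Rightarrow> 'o \<Rightarrow> 'o"  (infixr "\<boxtimes>\<index>" 70)
  tar :: "'a \<Rightarrow> 'a \<Rightarrow> 'a"  (infixr "\<otimes>\<index>" 70)
  asc :: "'o \<Rightarrow> 'o \<Rightarrow> 'o \<Rightarrow> 'a"
  lun :: "'o \<Rightarrow> 'a"
  run :: "'o \<Rightarrow> 'a"
  symm :: "'o \<Rightarrow> 'o \<Rightarrow> 'a"

locale symmetric_monoidal_category = category C
  for C :: "('o, 'a, 'm) sm_cat_scheme" (structure) +
  assumes unit_obj: "unit C \<in> obj C"
    and tob_obj: "X \<in> obj C \<Longrightarrow> Y \<in> obj C \<Longrightarrow> X \<boxtimes> Y \<in> obj C"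
    and tar_hom: "f \<in> hom C X Y \<Longrightarrow> g \<in> hom C X' Y' \<Longrightarrow> f \<otimes> g \<in> hom C (X \<boxtimes> X') (Y \<boxtimes> Y')"
    and tar_ide: "X \<in> obj C \<Longrightarrow> Y \<in> obj C \<Longrightarrow> ide C X \<otimes> ide C Y = ide C (X \<boxtimes> Y)"
    and tar_cmp: "f \<in> hom C X Y \<Longrightarrow> g \<in> hom C Y Z \<Longrightarrow> f' \<in> hom C X' Y' \<Longrightarrow> g' \<in> hom C Y' Z' \<Longrightarrow>
      (g \<cdot> f) \<otimes> (g' \<cdot> f') = (g \<otimes> g') \<cdot> (f \<otimes> f')"
    and asc_hom: "X \<in> obj C \<Longrightarrow> Y \<in> obj C \<Longrightarrow> Z \<in> obj C \<Longrightarrow>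
      asc C X Y Z \<in> hom C ((X \<boxtimes> Y) \<boxtimes> Z) (X \<boxtimes> (Y \<boxtimes> Z))"
    and asc_iso: "X \<in> obj C \<Longrightarrow> Y \<in> obj C \<Longrightarrow> Z \<in> obj C \<Longrightarrow> iso C (asc C X Y Z)"
    and asc_natural: "f \<in> hom C X X' \<Longrightarrow> g \<in> hom C Y Y' \<Longrightarrow> h \<in> hom C Z Z' \<Longrightarrow>
      asc C X' Y' Z' \<cdot> ((f \<otimes> g) \<otimes> h) = (f \<otimes> (g \<otimes> h)) \<cdot> asc C X Y Z"
    and lun_hom: "X \<in> obj C \<Longrightarrow> lun C X \<in> hom C (unit C \<boxtimes> X) X"
    and lun_iso: "X \<in> obj C \<Longrightarrow> iso C (lun C X)"
    and lun_natural: "f \<in> hom C X Y \<Longrightarrow> lun C Y \<cdot> (ide C (unit C) \<otimes> f) = f \<cdot> lun C X"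
    and run_hom: "X \<in> obj C \<Longrightarrow> run C X \<in> hom C (X \<boxtimes> unit C) X"
    and run_iso: "X \<in> obj C \<Longrightarrow> iso C (run C X)"
    and run_natural: "f \<in> hom C X Y \<Longrightarrow> run C Y \<cdot> (f \<otimes> ide C (unit C)) = f \<cdot> run C X"
    and sym_hom: "X \<in> obj C \<Longrightarrow> Y \<in> obj C \<Longrightarrow> symm C X Y \<in> hom C (X \<boxtimes> Y) (Y \<boxtimes> X)"
    and sym_natural: "f \<in> hom C X X' \<Longrightarrow> g \<in> hom C Y Y' \<Longrightarrow>
      symm C X' Y' \<cdot> (f \<otimes> g) = (g \<otimes> f) \<cdot> symm C X Y"
    and sym_sym: "X \<in> obj C \<Longrightarrow> Y \<in> obj C \<Longrightarrow> symm C Y X \<cdot> symm C X Y = ide C (X \<boxtimes> Y)"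
    and pentagon: "X \<in> obj C \<Longrightarrow> Y \<in> obj C \<Longrightarrow> Z \<in> obj C \<Longrightarrow> W \<in> obj C \<Longrightarrow>
      asc C X Y (Z \<boxtimes> W) \<cdot> asc C (X \<boxtimes> Y) Z W =
      (ide C X \<otimes> asc C Y Z W) \<cdot> asc C X (Y \<boxtimes> Z) W \<cdot> (asc C X Y Z \<otimes> ide C W)"
    and triangle: "X \<in> obj C \<Longrightarrow> Y \<in> obj C \<Longrightarrow>
      (ide C X \<otimes> lun C Y) \<cdot> asc C X (unit C) Y = run C X \<otimes> ide C Y"
    and hexagon: "X \<in> obj C \<Longrightarrow> Y \<in> obj C \<Longrightarrow> Z \<in> obj C \<Longrightarrow>
      asc C Y Z X \<cdot> symm C X (Y \<boxtimes> Z) \<cdot> asc C X Y Z =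
      (ide C Y \<otimes> symm C X Z) \<cdot> asc C Y X Z \<cdot> (symm C X Y \<otimes> ide C Z)"

definition cart_monoidal :: "('o, 'a, 'm) cart_cat_scheme \<Rightarrow> ('o, 'a) sm_cat" where
  "cart_monoidal B = \<lparr>
     obj = obj B, arr = arr B, src = src B, tgt = tgt B, ide = ide B, cmp = cmp B,
     init_ob = init_ob B, sum_ob = sum_ob B, inj1 = inj1 B, inj2 = inj2 B,
     unit = term_ob B,
     tob = prd B,
     tar = (\<lambda>f g. pair B (f \<cdot>\<^bsub>B\<^esub> pr1 B (src B f) (src B g)) (g \<cdot>\<^bsub>B\<^esub> pr2 B (src B f) (src B g))),
     asc = (\<lambda>X Y Z. pair B (pr1 B X Y \<cdot>\<^bsub>B\<^esub> pr1 B (prd B X Y) Z)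
                        (pair B (pr2 B X Y \<cdot>\<^bsub>B\<^esub> pr1 B (prd B X Y) Z) (pr2 B (prd B X Y) Z))),
     lun = (\<lambda>X. pr2 B (term_ob B) X),
     run = (\<lambda>X. pr1 B X (term_ob B)),
     symm = (\<lambda>X Y. pair B (pr2 B X Y) (pr1 B X Y)) \<rparr>"

section \<open>Functors and adjunctions\<close>

record ('o1, 'a1, 'o2, 'a2) fctr =
  fob :: "'o1 \<Rightarrow> 'o2"
  far :: "'a1 \<Rightarrow> 'a2"

record ('o1, 'a1, 'o2, 'a2) mfctr = "('o1, 'a1, 'o2, 'a2) fctr" +
  mlt :: "'o1 \<Rightarrow> 'o1 \<Rightarrow> 'a2"
  mun :: "'a2"

locale cat_functor =
  C: category C + D: category D
  for C :: "('o1, 'a1, 'm1) cat_scheme" and D :: "('o2, 'a2, 'm2) cat_scheme"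
    and F :: "('o1, 'a1, 'o2, 'a2, 'f) fctr_scheme" +
  assumes fob_obj: "X \<in> obj C \<Longrightarrow> fob F X \<in> obj D"
    and far_hom: "f \<in> hom C X Y \<Longrightarrow> far F f \<in> hom D (fob F X) (fob F Y)"
    and far_ide: "X \<in> obj C \<Longrightarrow> far F (ide C X) = ide D (fob F X)"
    and far_cmp: "f \<in> hom C X Y \<Longrightarrow> g \<in> hom C Y Z \<Longrightarrow>
      far F (g \<cdot>\<^bsub>C\<^esub> f) = far F g \<cdot>\<^bsub>D\<^esub> far F f"

locale adjunction =
  F: cat_functor C D F + G: cat_functor D C G
  for C :: "('o1, 'a1, 'm1) cat_scheme" and D :: "('o2, 'a2, 'm2) cat_scheme"
    and F :: "('o1, 'a1, 'o2, 'a2, 'f) fctr_scheme"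
    and G :: "('o2, 'a2, 'o1, 'a1, 'g) fctr_scheme" +
  fixes eta :: "'o1 \<Rightarrow> 'a1" and eps :: "'o2 \<Rightarrow> 'a2"
  assumes eta_hom: "X \<in> obj C \<Longrightarrow> eta X \<in> hom C X (fob G (fob F X))"
    and eps_hom: "A \<in> obj D \<Longrightarrow> eps A \<in> hom D (fob F (fob G A)) A"
    and eta_natural: "f \<in> hom C X Y \<Longrightarrow> far G (far F f) \<cdot>\<^bsub>C\<^esub> eta X = eta Y \<cdot>\<^bsub>C\<^esub> f"
    and eps_natural: "g \<in> hom D A B \<Longrightarrow> eps B \<cdot>\<^bsub>D\<^esub> far F (far G g) = g \<cdot>\<^bsub>D\<^esub> eps A"
    and triangle_left: "X \<in> obj C \<Longrightarrow> eps (fob F X) \<cdot>\<^bsub>D\<^esub> far F (eta X) = ide D (fob F X)"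
    and triangle_right: "A \<in> obj D \<Longrightarrow> far G (eps A) \<cdot>\<^bsub>C\<^esub> eta (fob G A) = ide C (fob G A)"

locale symmetric_monoidal_functor =
  cat_functor C D F + C: symmetric_monoidal_category C + D: symmetric_monoidal_category D
  for C :: "('o1, 'a1, 'm1) sm_cat_scheme" and D :: "('o2, 'a2, 'm2) sm_cat_scheme"
    and F :: "('o1, 'a1, 'o2, 'a2, 'f) mfctr_scheme" +
  assumes mlt_hom: "X \<in> obj C \<Longrightarrow> Y \<in> obj C \<Longrightarrow>
      mlt F X Y \<in> hom D (fob F X \<boxtimes>\<^bsub>D\<^esub> fob F Y) (fob F (X \<boxtimes>\<^bsub>C\<^esub> Y))"
    and mun_hom: "mun F \<in> hom D (unit D) (fob F (unit C))"
    and mlt_natural: "f \<in> hom C X X' \<Longrightarrow> g \<in> hom C Y Y' \<Longrightarrow>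
      mlt F X' Y' \<cdot>\<^bsub>D\<^esub> (far F f \<otimes>\<^bsub>D\<^esub> far F g) = far F (f \<otimes>\<^bsub>C\<^esub> g) \<cdot>\<^bsub>D\<^esub> mlt F X Y"
    and mlt_assoc: "X \<in> obj C \<Longrightarrow> Y \<in> obj C \<Longrightarrow> Z \<in> obj C \<Longrightarrow>
      far F (asc C X Y Z) \<cdot>\<^bsub>D\<^esub> mlt F (X \<boxtimes>\<^bsub>C\<^esub> Y) Z \<cdot>\<^bsub>D\<^esub> (mlt F X Y \<otimes>\<^bsub>D\<^esub> ide D (fob F Z)) =
      mlt F X (Y \<boxtimes>\<^bsub>C\<^esub> Z) \<cdot>\<^bsub>D\<^esub> (ide D (fob F X) \<otimes>\<^bsub>D\<^esub> mlt F Y Z) \<cdot>\<^bsub>D\<^esub>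
        asc D (fob F X) (fob F Y) (fob F Z)"
    and mlt_lun: "X \<in> obj C \<Longrightarrow>
      far F (lun C X) \<cdot>\<^bsub>D\<^esub> mlt F (unit C) X \<cdot>\<^bsub>D\<^esub> (mun F \<otimes>\<^bsub>D\<^esub> ide D (fob F X)) = lun D (fob F X)"
    and mlt_run: "X \<in> obj C \<Longrightarrow>
      far F (run C X) \<cdot>\<^bsub>D\<^esub> mlt F X (unit C) \<cdot>\<^bsub>D\<^esub> (ide D (fob F X) \<otimes>\<^bsub>D\<^esub> mun F) = run D (fob F X)"
    and mlt_sym: "X \<in> obj C \<Longrightarrow> Y \<in> obj C \<Longrightarrow>
      far F (symm C X Y) \<cdot>\<^bsub>D\<^esub> mlt F X Y = mlt F Y X \<cdot>\<^bsub>D\<^esub> symm D (fob F X) (fob F Y)"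

text \<open>The left adjoint is strong monoidal, which is automatic once both functors are lax monoidal and
  unit and counit are monoidal transformations.\<close>

locale symmetric_monoidal_adjunction =
  adjunction C D F G eta eps +
  F: symmetric_monoidal_functor C D F + G: symmetric_monoidal_functor D C G
  for C :: "('o1, 'a1, 'm1) sm_cat_scheme" and D :: "('o2, 'a2, 'm2) sm_cat_scheme"
    and F :: "('o1, 'a1, 'o2, 'a2, 'f) mfctr_scheme"
    and G :: "('o2, 'a2, 'o1, 'a1, 'g) mfctr_scheme"
    and eta eps +
  assumes mlt_iso: "X \<in> obj C \<Longrightarrow> Y \<in> obj C \<Longrightarrow> iso D (mlt F X Y)"
    and mun_iso: "iso D (mun F)"
    and eta_mlt: "X \<in> obj C \<Longrightarrow> Y \<in> obj C \<Longrightarrow>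
      eta (X \<boxtimes>\<^bsub>C\<^esub> Y) =
      far G (mlt F X Y) \<cdot>\<^bsub>C\<^esub> mlt G (fob F X) (fob F Y) \<cdot>\<^bsub>C\<^esub> (eta X \<otimes>\<^bsub>C\<^esub> eta Y)"
    and eta_mun: "eta (unit C) = far G (mun F) \<cdot>\<^bsub>C\<^esub> mun G"
    and eps_mlt: "A \<in> obj D \<Longrightarrow> B \<in> obj D \<Longrightarrow>
      eps (A \<boxtimes>\<^bsub>D\<^esub> B) \<cdot>\<^bsub>D\<^esub> far F (mlt G A B) \<cdot>\<^bsub>D\<^esub> mlt F (fob G A) (fob G B) =
      eps A \<otimes>\<^bsub>D\<^esub> eps B"
    and eps_mun: "eps (unit D) \<cdot>\<^bsub>D\<^esub> far F (mun G) \<cdot>\<^bsub>D\<^esub> mun F = ide D (unit D)"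

definition mcomp :: "('o3, 'a3, 'm) cat_scheme \<Rightarrow> ('o2, 'a2, 'o3, 'a3) mfctr \<Rightarrow>
    ('o1, 'a1, 'o2, 'a2) mfctr \<Rightarrow> ('o1, 'a1, 'o3, 'a3) mfctr" where
  "mcomp E G F = \<lparr> fob = (\<lambda>X. fob G (fob F X)), far = (\<lambda>f. far G (far F f)),
     mlt = (\<lambda>X Y. far G (mlt F X Y) \<cdot>\<^bsub>E\<^esub> mlt G (fob F X) (fob F Y)),
     mun = far G (mun F) \<cdot>\<^bsub>E\<^esub> mun G \<rparr>"

text \<open>The canonical comparison \<open>F X + F Y \<rightarrow> F (X + Y)\<close>.\<close>

definition sum_cmp :: "('o1, 'a1, 'm1) coprod_cat_scheme \<Rightarrow> ('o2, 'a2, 'm2) coprod_cat_scheme \<Rightarrow>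
    ('o1, 'a1, 'o2, 'a2, 'f) fctr_scheme \<Rightarrow> 'o1 \<Rightarrow> 'o1 \<Rightarrow> 'a2" where
  "sum_cmp C D F X Y = copair D (far F (inj1 C X Y)) (far F (inj2 C X Y))"

section \<open>Order enrichment\<close>

definition chain_in :: "'a set \<Rightarrow> ('a \<Rightarrow> 'a \<Rightarrow> bool) \<Rightarrow> (nat \<Rightarrow> 'a) \<Rightarrow> bool" where
  "chain_in D le s \<longleftrightarrow> (\<forall>n. s n \<in> D) \<and> (\<forall>n. le (s n) (s (Suc n)))"

definition sup_in :: "'a set \<Rightarrow> ('a \<Rightarrow> 'a \<Rightarrow> bool) \<Rightarrow> (nat \<Rightarrow> 'a) \<Rightarrow> 'a \<Rightarrow> bool" where
  "sup_in D le s x \<longleftrightarrow> x \<in> D \<and> (\<forall>n. le (s n) x) \<and> (\<forall>y\<in>D. (\<forall>n. le (s n) y) \<longrightarrow> le x y)"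

definition cpo :: "'a set \<Rightarrow> ('a \<Rightarrow> 'a \<Rightarrow> bool) \<Rightarrow> bool" where
  "cpo D le \<longleftrightarrow>
     (\<forall>x\<in>D. le x x) \<and>
     (\<forall>x\<in>D. \<forall>y\<in>D. le x y \<longrightarrow> le y x \<longrightarrow> x = y) \<and>
     (\<forall>x\<in>D. \<forall>y\<in>D. \<forall>z\<in>D. le x y \<longrightarrow> le y z \<longrightarrow> le x z) \<and>
     (\<forall>s. chain_in D le s \<longrightarrow> (\<exists>x. sup_in D le s x))"

definition least_in :: "'a set \<Rightarrow> ('a \<Rightarrow> 'a \<Rightarrow> bool) \<Rightarrow> 'a \<Rightarrow> bool" where
  "least_in D le x \<longleftrightarrow> x \<in> D \<and> (\<forall>y\<in>D. le x y)"

definition scott_continuous ::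
    "'a set \<Rightarrow> ('a \<Rightarrow> 'a \<Rightarrow> bool) \<Rightarrow> 'b set \<Rightarrow> ('b \<Rightarrow> 'b \<Rightarrow> bool) \<Rightarrow> ('a \<Rightarrow> 'b) \<Rightarrow> bool" where
  "scott_continuous D leD E leE f \<longleftrightarrow>
     (\<forall>x\<in>D. f x \<in> E) \<and>
     (\<forall>x\<in>D. \<forall>y\<in>D. leD x y \<longrightarrow> leE (f x) (f y)) \<and>
     (\<forall>s x. chain_in D leD s \<longrightarrow> sup_in D leD s x \<longrightarrow> sup_in E leE (\<lambda>n. f (s n)) (f x))"

definition pair_le :: "('a \<Rightarrow> 'a \<Rightarrow> bool) \<Rightarrow> ('b \<Rightarrow> 'b \<Rightarrow> bool) \<Rightarrow> 'a \<times> 'b \<Rightarrow> 'a \<times> 'b \<Rightarrow> bool" where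
  "pair_le le le' p q \<longleftrightarrow> le (fst p) (fst q) \<and> le' (snd p) (snd q)"

definition cpo_enriched :: "('o, 'a, 'm) cat_scheme \<Rightarrow> ('a \<Rightarrow> 'a \<Rightarrow> bool) \<Rightarrow> bool" where
  "cpo_enriched C le \<longleftrightarrow>
     (\<forall>X\<in>obj C. \<forall>Y\<in>obj C. cpo (hom C X Y) le) \<and>
     (\<forall>X\<in>obj C. \<forall>Y\<in>obj C. \<forall>Z\<in>obj C.
        scott_continuous (hom C Y Z \<times> hom C X Y) (pair_le le le) (hom C X Z) le
          (\<lambda>(g, f). g \<cdot>\<^bsub>C\<^esub> f))"

definition bot_arr :: "('o, 'a, 'm) cat_scheme \<Rightarrow> ('a \<Rightarrow> 'a \<Rightarrow> bool) \<Rightarrow> 'o \<Rightarrow> 'o \<Rightarrow> 'a" where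
  "bot_arr C le X Y = (THE b. least_in (hom C X Y) le b)"

text \<open>Enrichment over pointed cpos and strict maps is with respect to the smash product: composition
  is strict in each argument separately.\<close>

definition pointed_cpo_enriched :: "('o, 'a, 'm) cat_scheme \<Rightarrow> ('a \<Rightarrow> 'a \<Rightarrow> bool) \<Rightarrow> bool" where
  "pointed_cpo_enriched C le \<longleftrightarrow>
     cpo_enriched C le \<and>
     (\<forall>X\<in>obj C. \<forall>Y\<in>obj C. \<exists>b. least_in (hom C X Y) le b) \<and>
     (\<forall>X\<in>obj C. \<forall>Y\<in>obj C. \<forall>Z\<in>obj C. \<forall>f\<in>hom C X Y. bot_arr C le Y Z \<cdot>\<^bsub>C\<^esub> f = bot_arr C le X Z) \<and>
     (\<forall>X\<in>obj C. \<forall>Y\<in>obj C. \<forall>Z\<in>obj C. \<forall>g\<in>hom C Y Z. g \<cdot>\<^bsub>C\<^esub> bot_arr C le X Y = bot_arr C le X Z)"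

definition locally_continuous ::
    "('o1, 'a1, 'm1) cat_scheme \<Rightarrow> ('a1 \<Rightarrow> 'a1 \<Rightarrow> bool) \<Rightarrow>
     ('o2, 'a2, 'm2) cat_scheme \<Rightarrow> ('a2 \<Rightarrow> 'a2 \<Rightarrow> bool) \<Rightarrow>
     ('o1, 'a1, 'o2, 'a2, 'f) fctr_scheme \<Rightarrow> bool" where
  "locally_continuous C leC D leD F \<longleftrightarrow>
     (\<forall>X\<in>obj C. \<forall>Y\<in>obj C.
        scott_continuous (hom C X Y) leC (hom D (fob F X) (fob F Y)) leD (far F))"

definition sum_continuous :: "('o, 'a, 'm) coprod_cat_scheme \<Rightarrow> ('a \<Rightarrow> 'a \<Rightarrow> bool) \<Rightarrow> bool" where
  "sum_continuous C le \<longleftrightarrow>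
     (\<forall>X\<in>obj C. \<forall>Y\<in>obj C. \<forall>X'\<in>obj C. \<forall>Y'\<in>obj C.
        scott_continuous (hom C X Y \<times> hom C X' Y') (pair_le le le)
          (hom C (sum_ob C X X') (sum_ob C Y Y')) le (\<lambda>(f, g). sum_arr C f g))"

definition tensor_continuous :: "('o, 'a, 'm) sm_cat_scheme \<Rightarrow> ('a \<Rightarrow> 'a \<Rightarrow> bool) \<Rightarrow> bool" where
  "tensor_continuous C le \<longleftrightarrow>
     (\<forall>X\<in>obj C. \<forall>Y\<in>obj C. \<forall>X'\<in>obj C. \<forall>Y'\<in>obj C.
        scott_continuous (hom C X Y \<times> hom C X' Y') (pair_le le le)
          (hom C (X \<boxtimes>\<^bsub>C\<^esub> X') (Y \<boxtimes>\<^bsub>C\<^esub> Y')) le (\<lambda>(f, g). f \<otimes>\<^bsub>C\<^esub> g))"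

section \<open>Syntax and typing\<close>

datatype ty = TI | TSum ty ty | TTen ty ty | TLolli ty ty | TBang ty

fun nonlinear :: "ty \<Rightarrow> bool" where
  "nonlinear TI = True"
| "nonlinear (TSum A B) = (nonlinear A \<and> nonlinear B)"
| "nonlinear (TTen A B) = (nonlinear A \<and> nonlinear B)"
| "nonlinear (TLolli A B) = False"
| "nonlinear (TBang A) = True"

text \<open>Terms up to renaming of bound variables, as de Bruijn terms. \<open>Case\<close>, \<open>Lam\<close> and \<open>Rec\<close> bind index 0;
  \<open>Let m n\<close> is \<open>let \<langle>x, y\<rangle> = m in n\<close> with \<open>x\<close> at index 1 and \<open>y\<close> at index 0.
  \<open>Lft A B m\<close> and \<open>Rgt A B m\<close> have type \<open>A + B\<close>; the variable bound by \<open>Rec A m\<close> has type \<open>!A\<close>.\<close>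

datatype trm =
    Var nat
  | Star
  | Seq trm trm
  | Lft ty ty trm
  | Rgt ty ty trm
  | Case trm trm trm
  | Pair trm trm
  | Let trm trm
  | Lam ty trm
  | App trm trm
  | Lift trm
  | Force trm
  | Rec ty trm

inductive is_value :: "trm \<Rightarrow> bool" where
  "is_value (Var x)"
| "is_value Star"
| "is_value v \<Longrightarrow> is_value (Lft A B v)"
| "is_value v \<Longrightarrow> is_value (Rgt A B v)"
| "is_value v \<Longrightarrow> is_value w \<Longrightarrow> is_value (Pair v w)"
| "is_value (Lam A m)"
| "is_value (Lift m)"

definition up_ren :: "(nat \<Rightarrow> nat) \<Rightarrow> nat \<Rightarrow> nat" where
  "up_ren r = case_nat 0 (\<lambda>k. Suc (r k))"

primrec ren :: "(nat \<Rightarrow> nat) \<Rightarrow> trm \<Rightarrow> trm" where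
  "ren r (Var x) = Var (r x)"
| "ren r Star = Star"
| "ren r (Seq m n) = Seq (ren r m) (ren r n)"
| "ren r (Lft A B m) = Lft A B (ren r m)"
| "ren r (Rgt A B m) = Rgt A B (ren r m)"
| "ren r (Case m n p) = Case (ren r m) (ren (up_ren r) n) (ren (up_ren r) p)"
| "ren r (Pair m n) = Pair (ren r m) (ren r n)"
| "ren r (Let m n) = Let (ren r m) (ren (up_ren (up_ren r)) n)"
| "ren r (Lam A m) = Lam A (ren (up_ren r) m)"
| "ren r (App m n) = App (ren r m) (ren r n)"
| "ren r (Lift m) = Lift (ren r m)"
| "ren r (Force m) = Force (ren r m)"
| "ren r (Rec A m) = Rec A (ren (up_ren r) m)"

definition up_sub :: "(nat \<Rightarrow> trm) \<Rightarrow> nat \<Rightarrow> trm" where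
  "up_sub s = case_nat (Var 0) (\<lambda>k. ren Suc (s k))"

primrec sub :: "(nat \<Rightarrow> trm) \<Rightarrow> trm \<Rightarrow> trm" where
  "sub s (Var x) = s x"
| "sub s Star = Star"
| "sub s (Seq m n) = Seq (sub s m) (sub s n)"
| "sub s (Lft A B m) = Lft A B (sub s m)"
| "sub s (Rgt A B m) = Rgt A B (sub s m)"
| "sub s (Case m n p) = Case (sub s m) (sub (up_sub s) n) (sub (up_sub s) p)"
| "sub s (Pair m n) = Pair (sub s m) (sub s n)"
| "sub s (Let m n) = Let (sub s m) (sub (up_sub (up_sub s)) n)"
| "sub s (Lam A m) = Lam A (sub (up_sub s) m)"
| "sub s (App m n) = App (sub s m) (sub s n)"
| "sub s (Lift m) = Lift (sub s m)"
| "sub s (Force m) = Force (sub s m)"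
| "sub s (Rec A m) = Rec A (sub (up_sub s) m)"

definition sub1 :: "trm \<Rightarrow> trm \<Rightarrow> trm" where
  "sub1 m v = sub (case_nat v Var) m"

definition sub2 :: "trm \<Rightarrow> trm \<Rightarrow> trm \<Rightarrow> trm" where
  "sub2 n v v' = sub (case_nat v' (case_nat v Var)) n"

inductive evals :: "trm \<Rightarrow> trm \<Rightarrow> bool"  (infix "\<Down>" 50) where
  "Var x \<Down> Var x"
| "Star \<Down> Star"
| "m \<Down> Star \<Longrightarrow> n \<Down> v \<Longrightarrow> Seq m n \<Down> v"
| "m \<Down> v \<Longrightarrow> Lft A B m \<Down> Lft A B v"
| "m \<Down> v \<Longrightarrow> Rgt A B m \<Down> Rgt A B v"
| "m \<Down> Lft A B v \<Longrightarrow> sub1 n v \<Down> w \<Longrightarrow> Case m n p \<Down> w"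
| "m \<Down> Rgt A B v \<Longrightarrow> sub1 p v \<Down> w \<Longrightarrow> Case m n p \<Down> w"
| "m \<Down> v \<Longrightarrow> n \<Down> w \<Longrightarrow> Pair m n \<Down> Pair v w"
| "m \<Down> Pair v v' \<Longrightarrow> sub2 n v v' \<Down> w \<Longrightarrow> Let m n \<Down> w"
| "Lam A m \<Down> Lam A m"
| "m \<Down> Lam A m' \<Longrightarrow> n \<Down> v \<Longrightarrow> sub1 m' v \<Down> w \<Longrightarrow> App m n \<Down> w"
| "Lift m \<Down> Lift m"
| "m \<Down> Lift m' \<Longrightarrow> m' \<Down> v \<Longrightarrow> Force m \<Down> v"
| "sub1 m (Lift (Rec A m)) \<Down> v \<Longrightarrow> Rec A m \<Down> v"

definition terminates :: "trm \<Rightarrow> bool" where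
  "terminates p \<longleftrightarrow> (\<exists>v. is_value v \<and> p \<Down> v)"

text \<open>A context is a list of typed variables (de Bruijn indices), the most recent one last. Below a
  binder the variables already present are renamed by \<open>shift\<close>.\<close>

type_synonym ctx = "(nat \<times> ty) list"

definition vars :: "ctx \<Rightarrow> nat list" where
  "vars \<Gamma> = map fst \<Gamma>"

definition nonlinear_ctx :: "ctx \<Rightarrow> bool" where
  "nonlinear_ctx \<Phi> \<longleftrightarrow> (\<forall>A \<in> snd ` set \<Phi>. nonlinear A)"

definition shift :: "ctx \<Rightarrow> ctx" where
  "shift \<Gamma> = map (\<lambda>(x, A). (Suc x, A)) \<Gamma>"

text \<open>Since contexts may contain variables of non-linear type also outside the duplicable part \<open>\<Phi>\<close>,
  typing derivations are not unique, and the interpretation is defined on derivations. A context is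
  an unordered union, so the rules are closed under exchange.\<close>

datatype deriv =
    DVarL ctx nat ty
  | DStarL ctx
  | DLiftL ctx deriv
  | DVarA ctx nat ty
  | DStarA ctx
  | DLiftA ctx ctx deriv
  | DSeq ctx ctx ctx ty deriv deriv
  | DForce ty deriv
  | DLft ty ty deriv
  | DRgt ty ty deriv
  | DCase ctx ctx ctx ty ty deriv deriv deriv
  | DPair ctx ctx ctx deriv deriv
  | DLet ctx ctx ctx ty ty deriv deriv
  | DLam ctx ty ty deriv
  | DApp ctx ctx ctx ty ty deriv deriv
  | DRec ctx ty deriv
  | DExch ctx ty ty ctx deriv

datatype calculus = Linear | Affine

text \<open>\<open>derives c d \<Gamma> m A\<close>: \<open>d\<close> is a derivation of \<open>\<Gamma> \<turnstile> m : A\<close> in the calculus \<open>c\<close>.\<close>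

inductive derives :: "calculus \<Rightarrow> deriv \<Rightarrow> ctx \<Rightarrow> trm \<Rightarrow> ty \<Rightarrow> bool" for c :: calculus where
  var_l: "c = Linear \<Longrightarrow> nonlinear_ctx \<Phi> \<Longrightarrow> distinct (vars (\<Phi> @ [(x, A)])) \<Longrightarrow>
    derives c (DVarL \<Phi> x A) (\<Phi> @ [(x, A)]) (Var x) A"
| star_l: "c = Linear \<Longrightarrow> nonlinear_ctx \<Phi> \<Longrightarrow> distinct (vars \<Phi>) \<Longrightarrow>
    derives c (DStarL \<Phi>) \<Phi> Star TI"
| lift_l: "c = Linear \<Longrightarrow> nonlinear_ctx \<Phi> \<Longrightarrow> derives c d \<Phi> m A \<Longrightarrow>
    derives c (DLiftL \<Phi> d) \<Phi> (Lift m) (TBang A)"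
| var_a: "c = Affine \<Longrightarrow> distinct (vars (\<Gamma> @ [(x, A)])) \<Longrightarrow>
    derives c (DVarA \<Gamma> x A) (\<Gamma> @ [(x, A)]) (Var x) A"
| star_a: "c = Affine \<Longrightarrow> distinct (vars \<Gamma>) \<Longrightarrow>
    derives c (DStarA \<Gamma>) \<Gamma> Star TI"
| lift_a: "c = Affine \<Longrightarrow> nonlinear_ctx \<Phi> \<Longrightarrow> distinct (vars (\<Phi> @ \<Gamma>)) \<Longrightarrow> derives c d \<Phi> m A \<Longrightarrow>
    derives c (DLiftA \<Phi> \<Gamma> d) (\<Phi> @ \<Gamma>) (Lift m) (TBang A)"
| seq: "nonlinear_ctx \<Phi> \<Longrightarrow> distinct (vars (\<Phi> @ \<Gamma> @ \<Sigma>)) \<Longrightarrow>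
    derives c d (\<Phi> @ \<Gamma>) m TI \<Longrightarrow> derives c e (\<Phi> @ \<Sigma>) n A \<Longrightarrow>
    derives c (DSeq \<Phi> \<Gamma> \<Sigma> A d e) (\<Phi> @ \<Gamma> @ \<Sigma>) (Seq m n) A"
| force: "derives c d \<Gamma> m (TBang A) \<Longrightarrow>
    derives c (DForce A d) \<Gamma> (Force m) A"
| lft: "derives c d \<Gamma> m A \<Longrightarrow>
    derives c (DLft A B d) \<Gamma> (Lft A B m) (TSum A B)"
| rgt: "derives c d \<Gamma> m B \<Longrightarrow>
    derives c (DRgt A B d) \<Gamma> (Rgt A B m) (TSum A B)"
| case_of: "nonlinear_ctx \<Phi> \<Longrightarrow> distinct (vars (\<Phi> @ \<Gamma> @ \<Sigma>)) \<Longrightarrow>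
    derives c d (\<Phi> @ \<Gamma>) m (TSum A B) \<Longrightarrow>
    derives c e\<^sub>1 (shift (\<Phi> @ \<Sigma>) @ [(0, A)]) n C \<Longrightarrow>
    derives c e\<^sub>2 (shift (\<Phi> @ \<Sigma>) @ [(0, B)]) p C \<Longrightarrow>
    derives c (DCase \<Phi> \<Gamma> \<Sigma> A B d e\<^sub>1 e\<^sub>2) (\<Phi> @ \<Gamma> @ \<Sigma>) (Case m n p) C"
| pair: "nonlinear_ctx \<Phi> \<Longrightarrow> distinct (vars (\<Phi> @ \<Gamma> @ \<Sigma>)) \<Longrightarrow>
    derives c d (\<Phi> @ \<Gamma>) m A \<Longrightarrow> derives c e (\<Phi> @ \<Sigma>) n B \<Longrightarrow>
    derives c (DPair \<Phi> \<Gamma> \<Sigma> d e) (\<Phi> @ \<Gamma> @ \<Sigma>) (Pair m n) (TTen A B)"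
| let_in: "nonlinear_ctx \<Phi> \<Longrightarrow> distinct (vars (\<Phi> @ \<Gamma> @ \<Sigma>)) \<Longrightarrow>
    derives c d (\<Phi> @ \<Gamma>) m (TTen A B) \<Longrightarrow>
    derives c e (shift (shift (\<Phi> @ \<Sigma>)) @ [(1, A), (0, B)]) n C \<Longrightarrow>
    derives c (DLet \<Phi> \<Gamma> \<Sigma> A B d e) (\<Phi> @ \<Gamma> @ \<Sigma>) (Let m n) C"
| lam: "derives c d (shift \<Gamma> @ [(0, A)]) m B \<Longrightarrow>
    derives c (DLam \<Gamma> A B d) \<Gamma> (Lam A m) (TLolli A B)"
| app: "nonlinear_ctx \<Phi> \<Longrightarrow> distinct (vars (\<Phi> @ \<Gamma> @ \<Sigma>)) \<Longrightarrow>
    derives c d (\<Phi> @ \<Gamma>) m (TLolli A B) \<Longrightarrow> derives c e (\<Phi> @ \<Sigma>) n A \<Longrightarrow>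
    derives c (DApp \<Phi> \<Gamma> \<Sigma> A B d e) (\<Phi> @ \<Gamma> @ \<Sigma>) (App m n) B"
| fixpoint: "nonlinear_ctx \<Phi> \<Longrightarrow> derives c d (shift \<Phi> @ [(0, TBang A)]) m A \<Longrightarrow>
    derives c (DRec \<Phi> A d) \<Phi> (Rec A m) A"
| exch: "derives c d (\<Gamma> @ [(x, A), (y, B)] @ \<Sigma>) m C \<Longrightarrow>
    derives c (DExch \<Gamma> A B \<Sigma> d) (\<Gamma> @ [(y, B), (x, A)] @ \<Sigma>) m C"

section \<open>Models\<close>

text \<open>\<open>lolli A\<close> is the functor \<open>A \<multimap> -\<close>, with \<open>coev A\<close> and \<open>evl A\<close> the unit and counit of its
  adjunction with \<open>L (- \<otimes> A)\<close>; \<open>omg X : F X \<otimes> ! (Omg X) \<rightarrow> Omg X\<close> is the initial algebra.\<close>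

record ('ob, 'ab, 'ov, 'av, 'oc, 'ac) lnl_model =
  catB :: "('ob, 'ab) cart_cat"
  catV :: "('ov, 'av) sm_cat"
  catC :: "('oc, 'ac) sm_cat"
  funJ :: "('ob, 'ab, 'ov, 'av) mfctr"
  funK :: "('ov, 'av, 'ob, 'ab) mfctr"
  funL :: "('ov, 'av, 'oc, 'ac) mfctr"
  funR :: "('oc, 'ac, 'ov, 'av) mfctr"
  etaJK :: "'ob \<Rightarrow> 'ab"
  epsJK :: "'ov \<Rightarrow> 'av"
  etaLR :: "'ov \<Rightarrow> 'av"
  epsLR :: "'oc \<Rightarrow> 'ac"
  lolli :: "'ov \<Rightarrow> ('oc, 'ac, 'ov, 'av) fctr"
  coev :: "'ov \<Rightarrow> 'ov \<Rightarrow> 'av"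
  evl :: "'ov \<Rightarrow> 'oc \<Rightarrow> 'ac"
  Omg :: "'ob \<Rightarrow> 'oc"
  omg :: "'ob \<Rightarrow> 'ac"

record ('ob, 'ab, 'ov, 'av, 'oc, 'ac) ordered_lnl_model =
    "('ob, 'ab, 'ov, 'av, 'oc, 'ac) lnl_model" +
  leB :: "'ab \<Rightarrow> 'ab \<Rightarrow> bool"
  leV :: "'av \<Rightarrow> 'av \<Rightarrow> bool"
  leC :: "'ac \<Rightarrow> 'ac \<Rightarrow> bool"

locale lnl_data =
  fixes M :: "('ob, 'ab, 'ov, 'av, 'oc, 'ac, 'm) lnl_model_scheme"
begin

abbreviation "\<B> \<equiv> catB M"
abbreviation "\<V> \<equiv> catV M"
abbreviation "\<C> \<equiv> catC M"
abbreviation "J \<equiv> funJ M"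
abbreviation "K \<equiv> funK M"
abbreviation "L \<equiv> funL M"
abbreviation "R \<equiv> funR M"

definition F :: "('ob, 'ab, 'oc, 'ac) mfctr" where "F = mcomp \<C> L J"
definition G :: "('oc, 'ac, 'ob, 'ab) mfctr" where "G = mcomp \<B> K R"

definition etaFG :: "'ob \<Rightarrow> 'ab" where
  "etaFG X = far K (etaLR M (fob J X)) \<cdot>\<^bsub>\<B>\<^esub> etaJK M X"

definition epsFG :: "'oc \<Rightarrow> 'ac" where
  "epsFG A = epsLR M A \<cdot>\<^bsub>\<C>\<^esub> far L (epsJK M (fob R A))"

definition bang_ob :: "'oc \<Rightarrow> 'oc" where "bang_ob A = fob F (fob G A)"
definition bang :: "'ac \<Rightarrow> 'ac" where "bang f = far F (far G f)"

definition L_tensor :: "'ov \<Rightarrow> ('ov, 'av, 'oc, 'ac) fctr" where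
  "L_tensor A = \<lparr> fob = (\<lambda>X. fob L (X \<boxtimes>\<^bsub>\<V>\<^esub> A)), far = (\<lambda>f. far L (f \<otimes>\<^bsub>\<V>\<^esub> ide \<V> A)) \<rparr>"

definition curry :: "'ov \<Rightarrow> 'ov \<Rightarrow> 'ac \<Rightarrow> 'av" where
  "curry A X f = far (lolli M A) f \<cdot>\<^bsub>\<V>\<^esub> coev M A X"

definition initial_algebra :: "'ob \<Rightarrow> bool" where
  "initial_algebra X \<longleftrightarrow>
     Omg M X \<in> obj \<C> \<and> omg M X \<in> hom \<C> (fob F X \<boxtimes>\<^bsub>\<C>\<^esub> bang_ob (Omg M X)) (Omg M X) \<and>
     (\<forall>A\<in>obj \<C>. \<forall>a\<in>hom \<C> (fob F X \<boxtimes>\<^bsub>\<C>\<^esub> bang_ob A) A.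
        \<exists>!h. h \<in> hom \<C> (Omg M X) A \<and>
          h \<cdot>\<^bsub>\<C>\<^esub> omg M X = a \<cdot>\<^bsub>\<C>\<^esub> (ide \<C> (fob F X) \<otimes>\<^bsub>\<C>\<^esub> bang h))"

definition inverse_final_coalgebra :: "'ob \<Rightarrow> bool" where
  "inverse_final_coalgebra X \<longleftrightarrow>
     iso \<C> (omg M X) \<and>
     (\<forall>A\<in>obj \<C>. \<forall>a\<in>hom \<C> A (fob F X \<boxtimes>\<^bsub>\<C>\<^esub> bang_ob A).
        \<exists>!h. h \<in> hom \<C> A (Omg M X) \<and>
          inv_arr \<C> (omg M X) \<cdot>\<^bsub>\<C>\<^esub> h = (ide \<C> (fob F X) \<otimes>\<^bsub>\<C>\<^esub> bang h) \<cdot>\<^bsub>\<C>\<^esub> a)"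

end

locale lambda_l_model = lnl_data M
  for M :: "('ob, 'ab, 'ov, 'av, 'oc, 'ac, 'm) lnl_model_scheme" +
  assumes B_cartesian: "cartesian_coproduct_category (catB M)"
    and V_coproduct: "coproduct_category (catV M)"
    and V_monoidal: "symmetric_monoidal_category (catV M)"
    and C_coproduct: "coproduct_category (catC M)"
    and C_monoidal: "symmetric_monoidal_category (catC M)"
    and adjunction_JK: "symmetric_monoidal_adjunction (cart_monoidal (catB M)) (catV M)
      (funJ M) (funK M) (etaJK M) (epsJK M)"
    and adjunction_LR: "symmetric_monoidal_adjunction (catV M) (catC M)
      (funL M) (funR M) (etaLR M) (epsLR M)"
    and adjunction_lolli: "A \<in> obj (catV M) \<Longrightarrow>
      adjunction (catV M) (catC M) (L_tensor A) (lolli M A) (coev M A) (evl M A)"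
    and omg_initial: "X \<in> obj (catB M) \<Longrightarrow> initial_algebra X"
    and omg_final: "X \<in> obj (catB M) \<Longrightarrow> inverse_final_coalgebra X"

locale lambda_a_model = lambda_l_model M
  for M :: "('ob, 'ab, 'ov, 'av, 'oc, 'ac, 'm) lnl_model_scheme" +
  assumes unit_terminal: "terminal (catV M) (unit (catV M))"

definition order_enriched :: "('ob, 'ab, 'ov, 'av, 'oc, 'ac, 'm) ordered_lnl_model_scheme \<Rightarrow> bool" where
  "order_enriched M \<longleftrightarrow>
     cpo_enriched (catB M) (leB M) \<and>
     cpo_enriched (catV M) (leV M) \<and>
     pointed_cpo_enriched (catC M) (leC M) \<and>
     sum_continuous (catB M) (leB M) \<and>
     sum_continuous (catV M) (leV M) \<and>
     sum_continuous (catC M) (leC M) \<and>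
     tensor_continuous (cart_monoidal (catB M)) (leB M) \<and>
     tensor_continuous (catV M) (leV M) \<and>
     tensor_continuous (catC M) (leC M) \<and>
     locally_continuous (catB M) (leB M) (catV M) (leV M) (funJ M) \<and>
     locally_continuous (catV M) (leV M) (catB M) (leB M) (funK M) \<and>
     locally_continuous (catV M) (leV M) (catC M) (leC M) (funL M) \<and>
     locally_continuous (catC M) (leC M) (catV M) (leV M) (funR M) \<and>
     (\<forall>A\<in>obj (catV M). locally_continuous (catC M) (leC M) (catV M) (leV M) (lolli M A))"

definition bot_unit :: "('ob, 'ab, 'ov, 'av, 'oc, 'ac, 'm) ordered_lnl_model_scheme \<Rightarrow> 'ac" where
  "bot_unit M = bot_arr (catC M) (leC M) (unit (catC M)) (unit (catC M))"

definition computationally_adequate ::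
    "('ob, 'ab, 'ov, 'av, 'oc, 'ac, 'm) ordered_lnl_model_scheme \<Rightarrow> bool" where
  "computationally_adequate M \<longleftrightarrow>
     order_enriched M \<and> ide (catC M) (unit (catC M)) \<noteq> bot_unit M"

section \<open>Interpretation\<close>

context lnl_data
begin

abbreviation cmpC (infixr "\<bullet>" 65) where "g \<bullet> f \<equiv> g \<cdot>\<^bsub>\<C>\<^esub> f"
abbreviation tarC (infixr "\<otimes>" 70) where "f \<otimes> g \<equiv> f \<otimes>\<^bsub>\<C>\<^esub> g"
abbreviation tobC (infixr "\<boxtimes>" 70) where "X \<boxtimes> Y \<equiv> X \<boxtimes>\<^bsub>\<C>\<^esub> Y"
abbreviation "idC \<equiv> ide \<C>"
abbreviation "invC \<equiv> inv_arr \<C>"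

fun tyC :: "ty \<Rightarrow> 'oc" and tyV :: "ty \<Rightarrow> 'ov" where
  "tyC TI = unit \<C>"
| "tyC (TBang A) = bang_ob (tyC A)"
| "tyC (TSum A B) = sum_ob \<C> (tyC A) (tyC B)"
| "tyC (TTen A B) = tyC A \<boxtimes> tyC B"
| "tyC (TLolli A B) = fob L (fob (lolli M (tyV A)) (tyC B))"
| "tyV TI = unit \<V>"
| "tyV (TBang A) = fob J (fob G (tyC A))"
| "tyV (TSum A B) = sum_ob \<V> (tyV A) (tyV B)"
| "tyV (TTen A B) = tyV A \<boxtimes>\<^bsub>\<V>\<^esub> tyV B"
| "tyV (TLolli A B) = fob (lolli M (tyV A)) (tyC B)"

text \<open>Only meaningful on non-linear types.\<close>

primrec tyB :: "ty \<Rightarrow> 'ob" where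
  "tyB TI = term_ob \<B>"
| "tyB (TBang A) = fob G (tyC A)"
| "tyB (TSum P Q) = sum_ob \<B> (tyB P) (tyB Q)"
| "tyB (TTen P Q) = prd \<B> (tyB P) (tyB Q)"
| "tyB (TLolli A B) = undefined"

primrec ctxC :: "ctx \<Rightarrow> 'oc" where
  "ctxC [] = unit \<C>"
| "ctxC (xA # \<Gamma>) = tyC (snd xA) \<boxtimes> ctxC \<Gamma>"

primrec ctxV :: "ctx \<Rightarrow> 'ov" where
  "ctxV [] = unit \<V>"
| "ctxV (xA # \<Gamma>) = tyV (snd xA) \<boxtimes>\<^bsub>\<V>\<^esub> ctxV \<Gamma>"

primrec ctxB :: "ctx \<Rightarrow> 'ob" where
  "ctxB [] = term_ob \<B>"
| "ctxB (xA # \<Phi>) = prd \<B> (tyB (snd xA)) (ctxB \<Phi>)"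

text \<open>The coherence isomorphisms \<open>L (tyV A) \<rightarrow> tyC A\<close> and, for non-linear \<open>P\<close>, \<open>F (tyB P) \<rightarrow> tyC P\<close>,
  and likewise for contexts.\<close>

primrec isoL :: "ty \<Rightarrow> 'ac" where
  "isoL TI = invC (mun L)"
| "isoL (TBang A) = idC (bang_ob (tyC A))"
| "isoL (TSum A B) = sum_arr \<C> (isoL A) (isoL B) \<bullet> invC (sum_cmp \<V> \<C> L (tyV A) (tyV B))"
| "isoL (TTen A B) = (isoL A \<otimes> isoL B) \<bullet> invC (mlt L (tyV A) (tyV B))"
| "isoL (TLolli A B) = idC (tyC (TLolli A B))"

primrec isoF :: "ty \<Rightarrow> 'ac" where
  "isoF TI = invC (mun F)"
| "isoF (TBang A) = idC (bang_ob (tyC A))"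
| "isoF (TSum P Q) = sum_arr \<C> (isoF P) (isoF Q) \<bullet> invC (sum_cmp \<B> \<C> F (tyB P) (tyB Q))"
| "isoF (TTen P Q) = (isoF P \<otimes> isoF Q) \<bullet> invC (mlt F (tyB P) (tyB Q))"
| "isoF (TLolli A B) = undefined"

primrec ctx_isoL :: "ctx \<Rightarrow> 'ac" where
  "ctx_isoL [] = invC (mun L)"
| "ctx_isoL (xA # \<Gamma>) = (isoL (snd xA) \<otimes> ctx_isoL \<Gamma>) \<bullet> invC (mlt L (tyV (snd xA)) (ctxV \<Gamma>))"

primrec ctx_isoF :: "ctx \<Rightarrow> 'ac" where
  "ctx_isoF [] = invC (mun F)"
| "ctx_isoF (xA # \<Phi>) = (isoF (snd xA) \<otimes> ctx_isoF \<Phi>) \<bullet> invC (mlt F (tyB (snd xA)) (ctxB \<Phi>))"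

text \<open>\<open>join \<Gamma> \<Sigma> : \<lbrakk>\<Gamma>, \<Sigma>\<rbrakk> \<rightarrow> \<lbrakk>\<Gamma>\<rbrakk> \<otimes> \<lbrakk>\<Sigma>\<rbrakk>\<close> and \<open>ext \<Gamma> A : \<lbrakk>\<Gamma>, x : A\<rbrakk> \<rightarrow> \<lbrakk>\<Gamma>\<rbrakk> \<otimes> \<lbrakk>A\<rbrakk>\<close> are coherence isomorphisms;
  they do not depend on the names of the variables.\<close>

primrec join :: "ctx \<Rightarrow> ctx \<Rightarrow> 'ac" where
  "join [] \<Sigma> = invC (lun \<C> (ctxC \<Sigma>))"
| "join (xA # \<Gamma>) \<Sigma> =
     invC (asc \<C> (tyC (snd xA)) (ctxC \<Gamma>) (ctxC \<Sigma>)) \<bullet> (idC (tyC (snd xA)) \<otimes> join \<Gamma> \<Sigma>)"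

definition ext :: "ctx \<Rightarrow> ty \<Rightarrow> 'ac" where
  "ext \<Gamma> A = (idC (ctxC \<Gamma>) \<otimes> run \<C> (tyC A)) \<bullet> join \<Gamma> [(0, A)]"

text \<open>\<open>\<lbrakk>\<Gamma>, y : B, x : A, \<Sigma>\<rbrakk> \<rightarrow> \<lbrakk>\<Gamma>, x : A, y : B, \<Sigma>\<rbrakk>\<close>\<close>

primrec exchange :: "ctx \<Rightarrow> ty \<Rightarrow> ty \<Rightarrow> ctx \<Rightarrow> 'ac" where
  "exchange [] A B \<Sigma> =
     asc \<C> (tyC A) (tyC B) (ctxC \<Sigma>) \<bullet> (symm \<C> (tyC B) (tyC A) \<otimes> idC (ctxC \<Sigma>)) \<bullet>
       invC (asc \<C> (tyC B) (tyC A) (ctxC \<Sigma>))"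
| "exchange (xA # \<Gamma>) A B \<Sigma> = idC (tyC (snd xA)) \<otimes> exchange \<Gamma> A B \<Sigma>"

definition discard :: "ctx \<Rightarrow> 'ac" where
  "discard \<Phi> = invC (mun F) \<bullet> far F (the_arr \<B> (ctxB \<Phi>) (term_ob \<B>)) \<bullet> invC (ctx_isoF \<Phi>)"

definition duplicate :: "ctx \<Rightarrow> 'ac" where
  "duplicate \<Phi> =
     (ctx_isoF \<Phi> \<otimes> ctx_isoF \<Phi>) \<bullet> invC (mlt F (ctxB \<Phi>) (ctxB \<Phi>)) \<bullet>
       far F (pair \<B> (ide \<B> (ctxB \<Phi>)) (ide \<B> (ctxB \<Phi>))) \<bullet> invC (ctx_isoF \<Phi>)"

definition box :: "ctx \<Rightarrow> 'ac" where
  "box \<Phi> = bang (ctx_isoF \<Phi>) \<bullet> far F (etaFG (ctxB \<Phi>)) \<bullet> invC (ctx_isoF \<Phi>)"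

definition affine_discard :: "ctx \<Rightarrow> 'ac" where
  "affine_discard \<Gamma> = invC (mun L) \<bullet> far L (the_arr \<V> (ctxV \<Gamma>) (unit \<V>)) \<bullet> invC (ctx_isoL \<Gamma>)"

text \<open>\<open>(X \<otimes> Y) \<otimes> (Z \<otimes> W) \<rightarrow> (X \<otimes> Z) \<otimes> (Y \<otimes> W)\<close>\<close>

definition middle_swap :: "'oc \<Rightarrow> 'oc \<Rightarrow> 'oc \<Rightarrow> 'oc \<Rightarrow> 'ac" where
  "middle_swap X Y Z W =
     invC (asc \<C> X Z (Y \<boxtimes> W)) \<bullet>
       (idC X \<otimes> (asc \<C> Z Y W \<bullet> (symm \<C> Y Z \<otimes> idC W) \<bullet> invC (asc \<C> Y Z W))) \<bullet>
       asc \<C> X Y (Z \<boxtimes> W)"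

text \<open>\<open>s \<circ> (\<triangle> \<otimes> id) : \<lbrakk>\<Phi>, \<Gamma>, \<Sigma>\<rbrakk> \<rightarrow> \<lbrakk>\<Phi>, \<Gamma>\<rbrakk> \<otimes> \<lbrakk>\<Phi>, \<Sigma>\<rbrakk>\<close>\<close>

definition ctx_split :: "ctx \<Rightarrow> ctx \<Rightarrow> ctx \<Rightarrow> 'ac" where
  "ctx_split \<Phi> \<Gamma> \<Sigma> =
     (invC (join \<Phi> \<Gamma>) \<otimes> invC (join \<Phi> \<Sigma>)) \<bullet>
       middle_swap (ctxC \<Phi>) (ctxC \<Phi>) (ctxC \<Gamma>) (ctxC \<Sigma>) \<bullet>
       (duplicate \<Phi> \<otimes> join \<Gamma> \<Sigma>) \<bullet> join \<Phi> (\<Gamma> @ \<Sigma>)"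

text \<open>\<open>Y \<otimes> (A + B) \<rightarrow> (Y \<otimes> A) + (Y \<otimes> B)\<close>\<close>

definition distr :: "'oc \<Rightarrow> 'oc \<Rightarrow> 'oc \<Rightarrow> 'ac" where
  "distr Y A B = invC (copair \<C> (idC Y \<otimes> inj1 \<C> A B) (idC Y \<otimes> inj2 \<C> A B))"

definition rec_fold :: "ctx \<Rightarrow> ty \<Rightarrow> 'ac \<Rightarrow> 'ac" where
  "rec_fold \<Phi> A f = (THE s. s \<in> hom \<C> (Omg M (ctxB \<Phi>)) (tyC A) \<and>
     s \<bullet> omg M (ctxB \<Phi>) = f \<bullet> invC (ext \<Phi> (TBang A)) \<bullet> (ctx_isoF \<Phi> \<otimes> bang s))"

definition rec_unfold :: "ctx \<Rightarrow> 'ac" where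
  "rec_unfold \<Phi> = (THE g. g \<in> hom \<C> (ctxC \<Phi>) (Omg M (ctxB \<Phi>)) \<and>
     invC (omg M (ctxB \<Phi>)) \<bullet> g =
       (idC (fob F (ctxB \<Phi>)) \<otimes> bang g) \<bullet> (invC (ctx_isoF \<Phi>) \<otimes> box \<Phi>) \<bullet> duplicate \<Phi>)"

text \<open>The denotation \<open>\<lbrakk>\<Gamma> \<turnstile> m : A\<rbrakk>\<close>, by recursion on a derivation \<open>d\<close>. Compared with the usual presentation, only the
  coherence isomorphisms are made explicit. If \<open>derives c d \<Gamma> m A\<close> then \<open>den d : \<lbrakk>\<Gamma>\<rbrakk> \<rightarrow> \<lbrakk>A\<rbrakk>\<close>.\<close>

primrec den :: "deriv \<Rightarrow> 'ac" where
  "den (DVarL \<Phi> x A) = lun \<C> (tyC A) \<bullet> (discard \<Phi> \<otimes> idC (tyC A)) \<bullet> ext \<Phi> A"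
| "den (DStarL \<Phi>) = discard \<Phi>"
| "den (DLiftL \<Phi> d) = bang (den d) \<bullet> box \<Phi>"
| "den (DVarA \<Gamma> x A) = lun \<C> (tyC A) \<bullet> (affine_discard \<Gamma> \<otimes> idC (tyC A)) \<bullet> ext \<Gamma> A"
| "den (DStarA \<Gamma>) = affine_discard \<Gamma>"
| "den (DLiftA \<Phi> \<Gamma> d) =
     bang (den d) \<bullet> box \<Phi> \<bullet> run \<C> (ctxC \<Phi>) \<bullet> (idC (ctxC \<Phi>) \<otimes> affine_discard \<Gamma>) \<bullet> join \<Phi> \<Gamma>"
| "den (DSeq \<Phi> \<Gamma> \<Sigma> A d e) = lun \<C> (tyC A) \<bullet> (den d \<otimes> den e) \<bullet> ctx_split \<Phi> \<Gamma> \<Sigma>"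
| "den (DForce A d) = epsFG (tyC A) \<bullet> den d"
| "den (DLft A B d) = inj1 \<C> (tyC A) (tyC B) \<bullet> den d"
| "den (DRgt A B d) = inj2 \<C> (tyC A) (tyC B) \<bullet> den d"
| "den (DCase \<Phi> \<Gamma> \<Sigma> A B d e\<^sub>1 e\<^sub>2) =
     copair \<C> (den e\<^sub>1 \<bullet> invC (ext (\<Phi> @ \<Sigma>) A)) (den e\<^sub>2 \<bullet> invC (ext (\<Phi> @ \<Sigma>) B)) \<bullet>
       distr (ctxC (\<Phi> @ \<Sigma>)) (tyC A) (tyC B) \<bullet>
       (idC (ctxC (\<Phi> @ \<Sigma>)) \<otimes> den d) \<bullet>
       symm \<C> (ctxC (\<Phi> @ \<Gamma>)) (ctxC (\<Phi> @ \<Sigma>)) \<bullet> ctx_split \<Phi> \<Gamma> \<Sigma>"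
| "den (DPair \<Phi> \<Gamma> \<Sigma> d e) = (den d \<otimes> den e) \<bullet> ctx_split \<Phi> \<Gamma> \<Sigma>"
| "den (DLet \<Phi> \<Gamma> \<Sigma> A B d e) =
     den e \<bullet> invC (ext (\<Phi> @ \<Sigma> @ [(1, A)]) B) \<bullet> (invC (ext (\<Phi> @ \<Sigma>) A) \<otimes> idC (tyC B)) \<bullet>
       invC (asc \<C> (ctxC (\<Phi> @ \<Sigma>)) (tyC A) (tyC B)) \<bullet>
       symm \<C> (tyC A \<boxtimes> tyC B) (ctxC (\<Phi> @ \<Sigma>)) \<bullet>
       (den d \<otimes> idC (ctxC (\<Phi> @ \<Sigma>))) \<bullet> ctx_split \<Phi> \<Gamma> \<Sigma>"
| "den (DLam \<Gamma> A B d) =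
     far L (curry (tyV A) (ctxV \<Gamma>)
       (den d \<bullet> invC (ext \<Gamma> A) \<bullet> (ctx_isoL \<Gamma> \<otimes> isoL A) \<bullet> invC (mlt L (ctxV \<Gamma>) (tyV A)))) \<bullet>
       invC (ctx_isoL \<Gamma>)"
| "den (DApp \<Phi> \<Gamma> \<Sigma> A B d e) =
     evl M (tyV A) (tyC B) \<bullet> mlt L (tyV (TLolli A B)) (tyV A) \<bullet>
       (den d \<otimes> (invC (isoL A) \<bullet> den e)) \<bullet> ctx_split \<Phi> \<Gamma> \<Sigma>"
| "den (DRec \<Phi> A d) = rec_fold \<Phi> A (den d) \<bullet> rec_unfold \<Phi>"
| "den (DExch \<Gamma> A B \<Sigma> d) = den d \<bullet> exchange \<Gamma> A B \<Sigma>"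

end

end

theory Submission
  imports Defs
begin

text \<open>
  Denotations are only ever evaluated at \<^emph>\<open>points\<close>, that is, maps out of the monoidal unit. At points every coherence
  isomorphism acts in the obvious way, and interpreting the free variables by points \<open>\<rho>\<close> turns \<open>den d\<close> into an
  environment semantics for which neither a substitution lemma nor coherence of derivations is needed.

  Soundness and adequacy are two instances of one logical relation between points and closed terms. For
  soundness it is step-indexed by the number of unfoldings of \<open>Rec\<close>, so the equation for \<open>Rec\<close> suffices. For
  adequacy a computation \<open>f\<close> of a term \<open>m\<close> is observed through all maps \<open>\<kappa> : \<lbrakk>A\<rbrakk> \<rightarrow> I\<close>: if \<open>\<kappa> \<circ> f \<noteq> \<bottom>\<close>, then \<open>m\<close> has a
  value related to some \<open>g\<close> with \<open>\<kappa> \<circ> g \<noteq> \<bottom>\<close>. This condition is closed under suprema of chains although values, being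
  images of maps of \<open>\<V>\<close> and \<open>\<B>\<close>, need not be: the functors \<open>L\<close> and \<open>F\<close> are not assumed to reflect the order. The
  denotation of \<open>Rec\<close> is such a supremum, because the identity of an initial algebra that is also a final
  coalgebra is the supremum of its finite approximants.
\<close>

section \<open>Isomorphisms and coproducts\<close>

text \<open>The relation is shaped by the fact that maps of \<open>\<C>\<close> cannot be discarded,
  copied or promoted freely: \<open>discard\<close>, \<open>duplicate\<close> and \<open>box\<close>
  are guaranteed to act well only on points coming from \<open>\<B>\<close>, and
  \<open>affine_discard\<close> only on points coming from \<open>\<V>\<close>. Hence environments
  hold values only, and a computation reaches a variable only after a \<open>bind\<close> has
  replaced it by a value. For soundness a value must be related to the very point \<open>f\<close>
  of the computation, so at type \<open>TI\<close> evaluation forces \<open>f\<close> to be the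
  identity. For adequacy \<open>f\<close> may be replaced by another point with a similar
  observation. Letting \<kappa> range over all maps makes this stable under sequencing, since
  \<kappa> after a continuation is again an observation, and strictness makes \<bottom> satisfy it
  vacuously. There are no recursive types, so the step index serves \<open>Rec\<close> alone. The
  flag \<open>b\<close> selects the variant; the proofs split on it just in \<open>crel_bind\<close>
  and \<open>crel_Rec\<close>, so one induction over derivations yields both directions.\<close>

lemma in_hom_iff [simp]: "f \<in> hom C X Y \<longleftrightarrow> f \<in> arr C \<and> src C f = X \<and> tgt C f = Y"
  by (auto simp: hom_def)

context category
begin

declare src_obj [simp] tgt_obj [simp]

lemma ide_simps [simp]:
  "X \<in> obj C \<Longrightarrow> ide C X \<in> arr C"
  "X \<in> obj C \<Longrightarrow> src C (ide C X) = X"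
  "X \<in> obj C \<Longrightarrow> tgt C (ide C X) = X"
  using ide_hom by auto

lemma cmp_simps [simp]:
  assumes "f \<in> arr C" "g \<in> arr C" "src C g = tgt C f"
  shows "g \<cdot> f \<in> arr C" "src C (g \<cdot> f) = src C f" "tgt C (g \<cdot> f) = tgt C g"
  using cmp_hom[of f "src C f" "tgt C f" g "tgt C g"] assms by auto

lemma cmp_assoc' [simp]:
  assumes "f \<in> arr C" "g \<in> arr C" "h \<in> arr C" "src C g = tgt C f" "src C h = tgt C g"
  shows "(h \<cdot> g) \<cdot> f = h \<cdot> g \<cdot> f"
  using cmp_assoc[of f "src C f" "tgt C f" g "tgt C g" h "tgt C h"] assms by auto

text \<open>Composites are normalised to right-nested form, where an equation for
  \<open>h \<cdot> g\<close> no longer matches a subterm; this applies such an equation in front of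
  a tail \<open>f\<close>.\<close>

lemma cmp_reassoc:
  assumes "h \<cdot> g = k" "f \<in> arr C" "g \<in> arr C" "h \<in> arr C" "src C g = tgt C f" "src C h = tgt C g"
  shows "h \<cdot> g \<cdot> f = k \<cdot> f"
  using cmp_assoc'[OF assms(2-6)] assms(1) by simp

lemma cmp_ide [simp]:
  "f \<in> arr C \<Longrightarrow> tgt C f = X \<Longrightarrow> ide C X \<cdot> f = f"
  "f \<in> arr C \<Longrightarrow> src C f = X \<Longrightarrow> f \<cdot> ide C X = f"
  using cmp_ide_left[of f "src C f" X] cmp_ide_right[of f X "tgt C f"] by auto

lemma is_inverse_unique:
  assumes "is_inverse C f g" "is_inverse C f h"
  shows "g = h"
proof -
  have "g = (h \<cdot> f) \<cdot> g"
    using assms by (simp add: is_inverse_def del: cmp_assoc')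
  also have "\<dots> = h \<cdot> f \<cdot> g"
    using assms by (intro cmp_assoc') (simp_all add: is_inverse_def)
  also have "\<dots> = h"
    using assms by (simp add: is_inverse_def)
  finally show ?thesis .
qed

lemma inv_arr_eq: "is_inverse C f g \<Longrightarrow> inv_arr C f = g"
  unfolding inv_arr_def using is_inverse_unique by blast

lemma is_inverse_inv_arr:
  assumes "iso C f"
  shows "is_inverse C f (inv_arr C f)"
proof -
  obtain g where g: "is_inverse C f g"
    using assms unfolding iso_def by blast
  then show ?thesis
    by (simp only: inv_arr_eq[OF g])
qed

lemma iso_arr: "iso C f \<Longrightarrow> f \<in> arr C"
  by (auto simp: iso_def is_inverse_def)

lemma inv_simps [simp]:
  assumes "iso C f"
  shows "inv_arr C f \<in> arr C" "src C (inv_arr C f) = tgt C f" "tgt C (inv_arr C f) = src C f"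
    and "inv_arr C f \<cdot> f = ide C (src C f)" "f \<cdot> inv_arr C f = ide C (tgt C f)"
  using is_inverse_inv_arr[OF assms] by (simp_all add: is_inverse_def)

lemma inv_cancel [simp]:
  assumes "iso C f" "x \<in> arr C"
  shows "tgt C x = src C f \<Longrightarrow> inv_arr C f \<cdot> f \<cdot> x = x"
    and "tgt C x = tgt C f \<Longrightarrow> f \<cdot> inv_arr C f \<cdot> x = x"
proof -
  note f = iso_arr[OF assms(1)]
  show "inv_arr C f \<cdot> f \<cdot> x = x" if "tgt C x = src C f"
    using cmp_assoc'[of x f "inv_arr C f", symmetric] assms f that by (simp del: cmp_assoc')
  show "f \<cdot> inv_arr C f \<cdot> x = x" if "tgt C x = tgt C f"
    using cmp_assoc'[of x "inv_arr C f" f, symmetric] assms f that by (simp del: cmp_assoc')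
qed

lemma inv_arr_is_inverse: "iso C f \<Longrightarrow> is_inverse C (inv_arr C f) f"
  using iso_arr by (auto simp: is_inverse_def)

lemma iso_inv [simp]: "iso C f \<Longrightarrow> iso C (inv_arr C f)"
  unfolding iso_def[of _ "inv_arr C f"] using inv_arr_is_inverse by blast

lemma inv_inv [simp]: "iso C f \<Longrightarrow> inv_arr C (inv_arr C f) = f"
  by (rule inv_arr_eq) (rule inv_arr_is_inverse)

lemma is_inverse_ide: "X \<in> obj C \<Longrightarrow> is_inverse C (ide C X) (ide C X)"
  by (simp add: is_inverse_def)

lemma iso_ide [simp]: "X \<in> obj C \<Longrightarrow> iso C (ide C X)"
  unfolding iso_def using is_inverse_ide by blast

lemma iso_cmp [simp]:
  assumes "iso C f" "iso C g" "src C g = tgt C f"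
  shows "iso C (g \<cdot> f)"
proof -
  have "is_inverse C (g \<cdot> f) (inv_arr C f \<cdot> inv_arr C g)"
    using assms iso_arr[OF assms(1)] iso_arr[OF assms(2)] by (simp add: is_inverse_def)
  then show ?thesis
    unfolding iso_def by blast
qed

lemma iso_mono:
  assumes "iso C f" "f \<cdot> x = f \<cdot> y" "x \<in> arr C" "y \<in> arr C" "tgt C x = src C f" "tgt C y = src C f"
  shows "x = y"
  using inv_cancel(1)[OF assms(1,3,5)] inv_cancel(1)[OF assms(1,4,6)] assms(2) by metis

lemma iso_epi:
  assumes "iso C f" "x \<cdot> f = y \<cdot> f" "x \<in> arr C" "y \<in> arr C" "src C x = tgt C f" "src C y = tgt C f"
  shows "x = y"
proof -
  have "x = (x \<cdot> f) \<cdot> inv_arr C f"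
    using assms(1,3,5) iso_arr[OF assms(1)] by simp
  also have "\<dots> = (y \<cdot> f) \<cdot> inv_arr C f"
    by (simp only: assms(2))
  also have "\<dots> = y"
    using assms(1,4,6) iso_arr[OF assms(1)] by simp
  finally show ?thesis .
qed

end

context coproduct_category
begin

declare zero_obj [simp] sum_obj [simp]

lemma inj_simps [simp]:
  assumes "X \<in> obj C" "Y \<in> obj C"
  shows "inj1 C X Y \<in> arr C" "src C (inj1 C X Y) = X" "tgt C (inj1 C X Y) = sum_ob C X Y"
    and "inj2 C X Y \<in> arr C" "src C (inj2 C X Y) = Y" "tgt C (inj2 C X Y) = sum_ob C X Y"
  using inj1_hom[OF assms] inj2_hom[OF assms] by auto

lemma copair_props:
  assumes "f \<in> arr C" "g \<in> arr C" "tgt C f = tgt C g"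
  shows "copair C f g \<in> hom C (sum_ob C (src C f) (src C g)) (tgt C g) \<and>
     copair C f g \<cdot> inj1 C (src C f) (src C g) = f \<and> copair C f g \<cdot> inj2 C (src C f) (src C g) = g"
  using theI'[OF sum_universal[of f "src C f" "tgt C f" g "src C g"]] assms
  unfolding copair_def by simp

lemma copair_simps [simp]:
  assumes "f \<in> arr C" "g \<in> arr C" "tgt C f = tgt C g"
  shows "copair C f g \<in> arr C" "src C (copair C f g) = sum_ob C (src C f) (src C g)"
    "tgt C (copair C f g) = tgt C g"
  using copair_props[OF assms] by auto

lemma copair_inj [simp]:
  assumes "f \<in> arr C" "g \<in> arr C" "tgt C f = tgt C g" "src C f = X" "src C g = Y"
  shows "copair C f g \<cdot> inj1 C X Y = f" "copair C f g \<cdot> inj2 C X Y = g"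
  using copair_props[of f g] assms by auto

lemma copair_inj_cmp [simp]:
  assumes "f \<in> arr C" "g \<in> arr C" "tgt C f = tgt C g" "src C f = X" "src C g = Y" "x \<in> arr C"
  shows "tgt C x = X \<Longrightarrow> copair C f g \<cdot> inj1 C X Y \<cdot> x = f \<cdot> x"
    and "tgt C x = Y \<Longrightarrow> copair C f g \<cdot> inj2 C X Y \<cdot> x = g \<cdot> x"
proof -
  have X: "X \<in> obj C" and Y: "Y \<in> obj C"
    using assms by auto
  show "tgt C x = X \<Longrightarrow> copair C f g \<cdot> inj1 C X Y \<cdot> x = f \<cdot> x"
    using cmp_assoc'[of x "inj1 C X Y" "copair C f g"] assms X Y by (simp del: cmp_assoc')
  show "tgt C x = Y \<Longrightarrow> copair C f g \<cdot> inj2 C X Y \<cdot> x = g \<cdot> x"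
    using cmp_assoc'[of x "inj2 C X Y" "copair C f g"] assms X Y by (simp del: cmp_assoc')
qed

lemma sum_ext:
  assumes "X \<in> obj C" "Y \<in> obj C"
    and "h \<in> arr C" "src C h = sum_ob C X Y" "h' \<in> arr C" "src C h' = sum_ob C X Y" "tgt C h = tgt C h'"
    and "h \<cdot> inj1 C X Y = h' \<cdot> inj1 C X Y" "h \<cdot> inj2 C X Y = h' \<cdot> inj2 C X Y"
  shows "h = h'"
  using sum_universal[of "h' \<cdot> inj1 C X Y" X "tgt C h'" "h' \<cdot> inj2 C X Y" Y] assms by auto

lemma sum_arr_simps [simp]:
  assumes "f \<in> arr C" "g \<in> arr C"
  shows "sum_arr C f g \<in> arr C" "src C (sum_arr C f g) = sum_ob C (src C f) (src C g)"
    "tgt C (sum_arr C f g) = sum_ob C (tgt C f) (tgt C g)"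
  using assms by (simp_all add: sum_arr_def)

lemma sum_arr_inj [simp]:
  assumes "f \<in> arr C" "g \<in> arr C" "src C f = X" "src C g = Y"
  shows "sum_arr C f g \<cdot> inj1 C X Y = inj1 C (tgt C f) (tgt C g) \<cdot> f"
    "sum_arr C f g \<cdot> inj2 C X Y = inj2 C (tgt C f) (tgt C g) \<cdot> g"
  using assms by (simp_all add: sum_arr_def)

lemma sum_arr_inj_cmp [simp]:
  assumes "f \<in> arr C" "g \<in> arr C" "src C f = X" "src C g = Y" "x \<in> arr C"
  shows "tgt C x = X \<Longrightarrow> sum_arr C f g \<cdot> inj1 C X Y \<cdot> x = inj1 C (tgt C f) (tgt C g) \<cdot> f \<cdot> x"
    "tgt C x = Y \<Longrightarrow> sum_arr C f g \<cdot> inj2 C X Y \<cdot> x = inj2 C (tgt C f) (tgt C g) \<cdot> g \<cdot> x"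
  using assms by (auto simp add: sum_arr_def)

lemma iso_sum_arr [simp]:
  assumes "iso C f" "iso C g"
  shows "iso C (sum_arr C f g)"
proof -
  note [simp] = iso_arr[OF assms(1)] iso_arr[OF assms(2)] assms
  have "sum_arr C (inv_arr C f) (inv_arr C g) \<cdot> sum_arr C f g = ide C (sum_ob C (src C f) (src C g))"
    by (rule sum_ext[of "src C f" "src C g"]) simp_all
  moreover have "sum_arr C f g \<cdot> sum_arr C (inv_arr C f) (inv_arr C g) = ide C (sum_ob C (tgt C f) (tgt C g))"
    by (rule sum_ext[of "tgt C f" "tgt C g"]) simp_all
  ultimately have "is_inverse C (sum_arr C f g) (sum_arr C (inv_arr C f) (inv_arr C g))"
    by (simp add: is_inverse_def)
  then show ?thesis
    unfolding iso_def by blast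
qed

end

section \<open>Points of symmetric monoidal categories\<close>

text \<open>The tensor of two points made a point again by the inverse left unitor of the unit
  object; by \<open>run_unit\<close> the right unitor would give the same.\<close>

definition pt :: "('o, 'a, 'm) sm_cat_scheme \<Rightarrow> 'a \<Rightarrow> 'a \<Rightarrow> 'a" where
  "pt C f g = (f \<otimes>\<^bsub>C\<^esub> g) \<cdot>\<^bsub>C\<^esub> inv_arr C (lun C (unit C))"

context symmetric_monoidal_category
begin

declare unit_obj [simp] tob_obj [simp] asc_iso [simp] lun_iso [simp] run_iso [simp]

lemma tar_simps [simp]:
  assumes "f \<in> arr C" "g \<in> arr C"
  shows "f \<otimes> g \<in> arr C" "src C (f \<otimes> g) = src C f \<boxtimes> src C g" "tgt C (f \<otimes> g) = tgt C f \<boxtimes> tgt C g"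
  using tar_hom[of f "src C f" "tgt C f" g "src C g" "tgt C g"] assms by auto

lemma coherence_simps [simp]:
  assumes "X \<in> obj C"
  shows "lun C X \<in> arr C" "src C (lun C X) = unit C \<boxtimes> X" "tgt C (lun C X) = X"
    "run C X \<in> arr C" "src C (run C X) = X \<boxtimes> unit C" "tgt C (run C X) = X"
    "Y \<in> obj C \<Longrightarrow> symm C X Y \<in> arr C" "Y \<in> obj C \<Longrightarrow> src C (symm C X Y) = X \<boxtimes> Y"
    "Y \<in> obj C \<Longrightarrow> tgt C (symm C X Y) = Y \<boxtimes> X"
    "Y \<in> obj C \<Longrightarrow> Z \<in> obj C \<Longrightarrow> asc C X Y Z \<in> arr C"
    "Y \<in> obj C \<Longrightarrow> Z \<in> obj C \<Longrightarrow> src C (asc C X Y Z) = (X \<boxtimes> Y) \<boxtimes> Z"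
    "Y \<in> obj C \<Longrightarrow> Z \<in> obj C \<Longrightarrow> tgt C (asc C X Y Z) = X \<boxtimes> (Y \<boxtimes> Z)"
  using lun_hom[of X] run_hom[of X] sym_hom[of X Y] asc_hom[of X Y Z] assms by auto

lemma tar_cmp':
  assumes "f \<in> arr C" "g \<in> arr C" "f' \<in> arr C" "g' \<in> arr C" "src C f = tgt C f'" "src C g = tgt C g'"
  shows "(f \<otimes> g) \<cdot> (f' \<otimes> g') = (f \<cdot> f') \<otimes> (g \<cdot> g')"
  using tar_cmp[of f' "src C f'" "tgt C f'" f "tgt C f" g' "src C g'" "tgt C g'" g "tgt C g"] assms
  by auto

lemma tar_cmp_cmp:
  assumes "f \<in> arr C" "g \<in> arr C" "f' \<in> arr C" "g' \<in> arr C" "src C f = tgt C f'" "src C g = tgt C g'"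
    and "x \<in> arr C" "tgt C x = src C f' \<boxtimes> src C g'"
  shows "(f \<otimes> g) \<cdot> (f' \<otimes> g') \<cdot> x = ((f \<cdot> f') \<otimes> (g \<cdot> g')) \<cdot> x"
  using cmp_assoc'[of x "f' \<otimes> g'" "f \<otimes> g"] assms by (simp add: tar_cmp' del: cmp_assoc')

lemma is_inverse_tar:
  "iso C f \<Longrightarrow> iso C g \<Longrightarrow> is_inverse C (f \<otimes> g) (inv_arr C f \<otimes> inv_arr C g)"
  by (simp add: is_inverse_def tar_cmp' tar_ide iso_arr)

lemma iso_tar [simp]: "iso C f \<Longrightarrow> iso C g \<Longrightarrow> iso C (f \<otimes> g)"
  unfolding iso_def[of _ "f \<otimes> g"] using is_inverse_tar by blast

lemma iso_symm [simp]: "X \<in> obj C \<Longrightarrow> Y \<in> obj C \<Longrightarrow> iso C (symm C X Y)"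
  unfolding iso_def by (rule exI[of _ "symm C Y X"]) (simp add: is_inverse_def sym_sym)

lemma lun_natural':
  "f \<in> arr C \<Longrightarrow> lun C (tgt C f) \<cdot> (ide C (unit C) \<otimes> f) = f \<cdot> lun C (src C f)"
  using lun_natural[of f "src C f" "tgt C f"] by auto

lemma run_natural':
  "f \<in> arr C \<Longrightarrow> run C (tgt C f) \<cdot> (f \<otimes> ide C (unit C)) = f \<cdot> run C (src C f)"
  using run_natural[of f "src C f" "tgt C f"] by auto

text \<open>The natural iso \<open>lun\<close> identifies tensoring with the unit and the identity
  functor. Coherence laws can therefore be proved after adding a unit factor, where pentagon and
  triangle apply.\<close>

lemma unit_tar_faithful:
  assumes "f \<in> hom C X Y" "g \<in> hom C X Y" "ide C (unit C) \<otimes> f = ide C (unit C) \<otimes> g"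
  shows "f = g"
proof (rule iso_epi)
  have [simp]: "X \<in> obj C" "Y \<in> obj C"
    using assms by auto
  show "iso C (lun C X)" by simp
  show "f \<cdot> lun C X = g \<cdot> lun C X"
    using assms lun_natural'[of f] lun_natural'[of g] by simp
qed (use assms in auto)

lemma tar_unit_faithful:
  assumes "f \<in> hom C X Y" "g \<in> hom C X Y" "f \<otimes> ide C (unit C) = g \<otimes> ide C (unit C)"
  shows "f = g"
proof (rule iso_epi)
  have [simp]: "X \<in> obj C" "Y \<in> obj C"
    using assms by auto
  show "iso C (run C X)" by simp
  show "f \<cdot> run C X = g \<cdot> run C X"
    using assms run_natural'[of f] run_natural'[of g] by simp
qed (use assms in auto)

section \<open>Coherence at the unit object\<close>

abbreviation (input) "I \<equiv> unit C"
abbreviation (input) "i \<equiv> ide C (unit C)"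

text \<open>Kelly's argument at the unit object: this unitor law is not an axiom but follows from
  pentagon and triangle, once a further unit is added on the left and the iso \<open>?p\<close>,
  part of the long side of the pentagon, is precomposed.\<close>

lemma lun_tensor_unit: "lun C (I \<boxtimes> I) \<cdot> asc C I I I = lun C I \<otimes> i"
proof (rule unit_tar_faithful)
  show "i \<otimes> (lun C (I \<boxtimes> I) \<cdot> asc C I I I) = i \<otimes> (lun C I \<otimes> i)"
  proof (rule iso_epi)
    let ?p = "asc C I (I \<boxtimes> I) I \<cdot> (asc C I I I \<otimes> i)"
    show "iso C ?p" by simp
    have "(i \<otimes> (lun C (I \<boxtimes> I) \<cdot> asc C I I I)) \<cdot> ?p =
      (i \<otimes> lun C (I \<boxtimes> I)) \<cdot> (i \<otimes> asc C I I I) \<cdot> asc C I (I \<boxtimes> I) I \<cdot> (asc C I I I \<otimes> i)"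
      by (simp add: tar_cmp_cmp)
    also have "\<dots> = (i \<otimes> lun C (I \<boxtimes> I)) \<cdot> asc C I I (I \<boxtimes> I) \<cdot> asc C (I \<boxtimes> I) I I"
      by (simp add: pentagon)
    also have "\<dots> = ((i \<otimes> lun C (I \<boxtimes> I)) \<cdot> asc C I I (I \<boxtimes> I)) \<cdot> asc C (I \<boxtimes> I) I I"
      by simp
    also have "\<dots> = (run C I \<otimes> (i \<otimes> i)) \<cdot> asc C (I \<boxtimes> I) I I"
      by (subst triangle) (simp_all add: tar_ide)
    also have "\<dots> = asc C I I I \<cdot> ((run C I \<otimes> i) \<otimes> i)"
      by (subst asc_natural[symmetric, of _ "I \<boxtimes> I" I _ I I _ I I]) simp_all
    also have "\<dots> = asc C I I I \<cdot> (((i \<otimes> lun C I) \<cdot> asc C I I I) \<otimes> i)"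
      by (simp add: triangle)
    also have "\<dots> = asc C I I I \<cdot> ((i \<otimes> lun C I) \<otimes> i) \<cdot> (asc C I I I \<otimes> i)"
      by (simp add: tar_cmp')
    also have "\<dots> = (asc C I I I \<cdot> ((i \<otimes> lun C I) \<otimes> i)) \<cdot> (asc C I I I \<otimes> i)"
      by simp
    also have "\<dots> = ((i \<otimes> (lun C I \<otimes> i)) \<cdot> asc C I (I \<boxtimes> I) I) \<cdot> (asc C I I I \<otimes> i)"
      by (subst asc_natural[of _ I I _ "I \<boxtimes> I" I _ I I]) simp_all
    finally show "(i \<otimes> (lun C (I \<boxtimes> I) \<cdot> asc C I I I)) \<cdot> ?p = (i \<otimes> (lun C I \<otimes> i)) \<cdot> ?p"
      by simp
  qed simp_all
qed simp_all

text \<open>Naturality of the unitor at the unitor itself, with the outer unitor cancelled.\<close>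

lemma lun_unit_tensor_unit: "lun C (I \<boxtimes> I) = i \<otimes> lun C I"
  by (rule iso_mono[of "lun C I"]) (use lun_natural'[of "lun C I"] in simp_all)

lemma run_unit_tensor_unit: "run C (I \<boxtimes> I) = run C I \<otimes> i"
  by (rule iso_mono[of "run C I"]) (use run_natural'[of "run C I"] in simp_all)

text \<open>After tensoring with the unit on the right, the triangle and
  \<open>lun_tensor_unit\<close> exhibit both unitors as the same composite with
  \<open>asc\<close>.\<close>

lemma run_unit [simp]: "run C I = lun C I"
  by (rule tar_unit_faithful[of _ "I \<boxtimes> I" I])
    (use lun_tensor_unit triangle[of I I] in \<open>simp_all add: lun_unit_tensor_unit\<close>)

lemma asc_unit: "(i \<otimes> lun C I) \<cdot> asc C I I I = lun C I \<otimes> i"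
  using triangle[of I I] by simp

text \<open>The hexagon at three unit objects equates, up to unitors, one swap of the unit with
  itself and two in a row, and two swaps cancel. Otherwise swapping points would leave an
  automorphism of \<open>I \<boxtimes> I\<close> behind.\<close>

lemma symm_unit [simp]: "symm C I I = ide C (I \<boxtimes> I)"
proof -
  let ?s = "symm C I I" and ?l = "lun C I" and ?a = "asc C I I I"
  have nat: "?s \<cdot> (i \<otimes> ?l) = (?l \<otimes> i) \<cdot> symm C I (I \<boxtimes> I)"
    by (rule sym_natural) simp_all
  have ls: "(i \<otimes> ?l) \<cdot> (i \<otimes> ?s) = ?s \<cdot> (i \<otimes> ?l)"
    using lun_natural'[of ?s] by (simp add: lun_unit_tensor_unit)
  have rs: "(?l \<otimes> i) \<cdot> (?s \<otimes> i) = ?s \<cdot> (?l \<otimes> i)"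
    using run_natural'[of ?s] by (simp add: run_unit_tensor_unit)
  have "?s \<cdot> (?l \<otimes> i) = ?s \<cdot> (i \<otimes> ?l) \<cdot> ?a"
    by (simp add: asc_unit)
  also have "\<dots> = (?s \<cdot> (i \<otimes> ?l)) \<cdot> ?a"
    by simp
  also have "\<dots> = (?l \<otimes> i) \<cdot> symm C I (I \<boxtimes> I) \<cdot> ?a"
    by (simp add: nat)
  also have "\<dots> = ((i \<otimes> ?l) \<cdot> ?a) \<cdot> symm C I (I \<boxtimes> I) \<cdot> ?a"
    by (simp only: asc_unit)
  also have "\<dots> = (i \<otimes> ?l) \<cdot> ?a \<cdot> symm C I (I \<boxtimes> I) \<cdot> ?a"
    by simp
  also have "\<dots> = (i \<otimes> ?l) \<cdot> (i \<otimes> ?s) \<cdot> ?a \<cdot> (?s \<otimes> i)"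
    by (simp only: hexagon unit_obj)
  also have "\<dots> = ((i \<otimes> ?l) \<cdot> (i \<otimes> ?s)) \<cdot> ?a \<cdot> (?s \<otimes> i)"
    by simp
  also have "\<dots> = ?s \<cdot> ((i \<otimes> ?l) \<cdot> ?a) \<cdot> (?s \<otimes> i)"
    by (simp only: ls) simp
  also have "\<dots> = ?s \<cdot> ?s \<cdot> (?l \<otimes> i)"
    by (simp only: asc_unit rs)
  also have "\<dots> = (?s \<cdot> ?s) \<cdot> (?l \<otimes> i)"
    by simp
  also have "\<dots> = ?l \<otimes> i"
    by (simp only: sym_sym unit_obj) simp
  finally have "?s \<cdot> (?l \<otimes> i) = ?l \<otimes> i" .
  then show ?thesis
    by (intro iso_epi[of "?l \<otimes> i" ?s "ide C (I \<boxtimes> I)"]) simp_all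
qed

section \<open>Coherence isomorphisms acting on pairs of points\<close>

lemma pt_simps [simp]:
  assumes "f \<in> arr C" "g \<in> arr C" "src C f = I" "src C g = I"
  shows "pt C f g \<in> arr C" "src C (pt C f g) = I" "tgt C (pt C f g) = tgt C f \<boxtimes> tgt C g"
  using assms by (simp_all add: pt_def)

lemma tar_pt [simp]:
  assumes "h \<in> arr C" "k \<in> arr C" "f \<in> arr C" "g \<in> arr C" "src C f = I" "src C g = I"
    and "src C h = tgt C f" "src C k = tgt C g"
  shows "(h \<otimes> k) \<cdot> pt C f g = pt C (h \<cdot> f) (k \<cdot> g)"
  using assms by (simp add: pt_def tar_cmp_cmp)

lemma symm_pt [simp]:
  assumes "f \<in> arr C" "g \<in> arr C" "src C f = I" "src C g = I" "tgt C f = X" "tgt C g = Y"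
  shows "symm C X Y \<cdot> pt C f g = pt C g f"
proof -
  have [simp]: "X \<in> obj C" "Y \<in> obj C"
    using assms by auto
  have "symm C X Y \<cdot> pt C f g = (symm C X Y \<cdot> (f \<otimes> g)) \<cdot> inv_arr C (lun C I)"
    using assms by (simp add: pt_def)
  also have "symm C X Y \<cdot> (f \<otimes> g) = g \<otimes> f"
    using sym_natural[of f I X g I Y] assms by simp
  finally show ?thesis
    by (simp add: pt_def)
qed

lemma asc_pt [simp]:
  assumes "f \<in> arr C" "g \<in> arr C" "h \<in> arr C" "src C f = I" "src C g = I" "src C h = I"
    "tgt C f = X" "tgt C g = Y" "tgt C h = Z"
  shows "asc C X Y Z \<cdot> pt C (pt C f g) h = pt C f (pt C g h)"
proof -
  have [simp]: "X \<in> obj C" "Y \<in> obj C" "Z \<in> obj C"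
    using assms by auto
  let ?l = "lun C I"
  \<comment> \<open>This is all that remains once naturality has moved \<open>f\<close>,
    \<open>g\<close> and \<open>h\<close> out: the two ways of splitting one unit into three agree,
    which is \<open>asc_unit\<close> read backwards.\<close>
  have a: "asc C I I I \<cdot> (inv_arr C ?l \<otimes> i) = i \<otimes> inv_arr C ?l"
  proof (rule iso_mono[of "i \<otimes> ?l"])
    have "(i \<otimes> ?l) \<cdot> asc C I I I \<cdot> (inv_arr C ?l \<otimes> i) = ((i \<otimes> ?l) \<cdot> asc C I I I) \<cdot> (inv_arr C ?l \<otimes> i)"
      by simp
    then show "(i \<otimes> ?l) \<cdot> asc C I I I \<cdot> (inv_arr C ?l \<otimes> i) = (i \<otimes> ?l) \<cdot> (i \<otimes> inv_arr C ?l)"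
      unfolding asc_unit by (simp add: tar_cmp')
  qed simp_all
  have "pt C (pt C f g) h = (((f \<otimes> g) \<otimes> h) \<cdot> (inv_arr C ?l \<otimes> i)) \<cdot> inv_arr C ?l"
    using assms by (simp add: pt_def tar_cmp')
  then have "asc C X Y Z \<cdot> pt C (pt C f g) h =
      (asc C X Y Z \<cdot> ((f \<otimes> g) \<otimes> h)) \<cdot> (inv_arr C ?l \<otimes> i) \<cdot> inv_arr C ?l"
    using assms by simp
  also have "asc C X Y Z \<cdot> ((f \<otimes> g) \<otimes> h) = (f \<otimes> (g \<otimes> h)) \<cdot> asc C I I I"
    using asc_natural[of f I X g I Y h I Z] assms by simp
  also have "((f \<otimes> (g \<otimes> h)) \<cdot> asc C I I I) \<cdot> (inv_arr C ?l \<otimes> i) \<cdot> inv_arr C ?l =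
      (f \<otimes> (g \<otimes> h)) \<cdot> (asc C I I I \<cdot> (inv_arr C ?l \<otimes> i)) \<cdot> inv_arr C ?l"
    using assms by simp
  also have "\<dots> = pt C f (pt C g h)"
    unfolding a using assms by (simp add: pt_def tar_cmp_cmp)
  finally show ?thesis .
qed

lemma inv_asc_pt [simp]:
  assumes "f \<in> arr C" "g \<in> arr C" "h \<in> arr C" "src C f = I" "src C g = I" "src C h = I"
    "tgt C f = X" "tgt C g = Y" "tgt C h = Z"
  shows "inv_arr C (asc C X Y Z) \<cdot> pt C f (pt C g h) = pt C (pt C f g) h"
proof -
  have "X \<in> obj C" "Y \<in> obj C" "Z \<in> obj C"
    using assms by auto
  then have "inv_arr C (asc C X Y Z) \<cdot> asc C X Y Z \<cdot> pt C (pt C f g) h = pt C (pt C f g) h"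
    using assms by (intro inv_cancel) auto
  then show ?thesis
    by (simp only: asc_pt[OF assms])
qed

lemma lun_pt [simp]:
  assumes "f \<in> arr C" "src C f = I" "tgt C f = X"
  shows "lun C X \<cdot> pt C i f = f"
proof -
  have "lun C X \<cdot> pt C i f = (lun C X \<cdot> (i \<otimes> f)) \<cdot> inv_arr C (lun C I)"
    using assms tgt_obj[of f] by (simp add: pt_def)
  then show ?thesis
    using assms lun_natural'[of f] by simp
qed

lemma run_pt [simp]:
  assumes "f \<in> arr C" "src C f = I" "tgt C f = X"
  shows "run C X \<cdot> pt C f i = f"
proof -
  have "run C X \<cdot> pt C f i = (run C X \<cdot> (f \<otimes> i)) \<cdot> inv_arr C (lun C I)"
    using assms tgt_obj[of f] by (simp add: pt_def)
  then show ?thesis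
    using assms run_natural'[of f] by simp
qed

text \<open>Splits a trivial component off a point. It starts \<open>join\<close> at the empty
  context, and it turns a map on a tensor with its left component fixed into a map on the right
  one.\<close>

lemma inv_lun_cmp:
  assumes "f \<in> arr C" "src C f = I" "tgt C f = X"
  shows "inv_arr C (lun C X) \<cdot> f = pt C i f"
proof -
  have "X \<in> obj C"
    using assms by auto
  then have "inv_arr C (lun C X) \<cdot> lun C X \<cdot> pt C i f = pt C i f"
    using assms by (intro inv_cancel) auto
  then show ?thesis
    by (simp only: lun_pt[OF assms])
qed

lemma inv_run_cmp:
  assumes "f \<in> arr C" "src C f = I" "tgt C f = X"
  shows "inv_arr C (run C X) \<cdot> f = pt C f i"
proof -
  have "X \<in> obj C"
    using assms by auto
  then have "inv_arr C (run C X) \<cdot> run C X \<cdot> pt C f i = pt C f i"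
    using assms by (intro inv_cancel) auto
  then show ?thesis
    by (simp only: run_pt[OF assms])
qed

end

section \<open>Functors and adjunctions\<close>

context cat_functor
begin

declare fob_obj [simp] far_ide [simp]

lemma far_simps [simp]:
  assumes "f \<in> arr C"
  shows "far F f \<in> arr D" "src D (far F f) = fob F (src C f)" "tgt D (far F f) = fob F (tgt C f)"
  using far_hom[of f "src C f" "tgt C f"] assms by auto

lemma far_cmp' [simp]:
  "f \<in> arr C \<Longrightarrow> g \<in> arr C \<Longrightarrow> src C g = tgt C f \<Longrightarrow> far F (g \<cdot>\<^bsub>C\<^esub> f) = far F g \<cdot>\<^bsub>D\<^esub> far F f"
  using far_cmp[of f "src C f" "tgt C f" g "tgt C g"] by auto

lemma is_inverse_far:
  assumes "iso C f"
  shows "is_inverse D (far F f) (far F (inv_arr C f))"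
proof -
  note [simp] = C.iso_arr[OF assms] assms
  show ?thesis
    by (simp add: is_inverse_def far_cmp'[symmetric] del: far_cmp')
qed

lemma iso_far [simp]: "iso C f \<Longrightarrow> iso D (far F f)"
  unfolding iso_def[of D] using is_inverse_far by blast

lemma far_inv: "iso C f \<Longrightarrow> far F (inv_arr C f) = inv_arr D (far F f)"
  by (rule D.inv_arr_eq[symmetric]) (rule is_inverse_far)

end

lemma cat_functor_comp:
  assumes "cat_functor C D F" "cat_functor D E G"
    and H: "\<And>X. fob H X = fob G (fob F X)" "\<And>f. far H f = far G (far F f)"
  shows "cat_functor C E H"
proof -
  interpret F: cat_functor C D F by fact
  interpret G: cat_functor D E G by fact
  show ?thesis
    by unfold_locales (auto simp: H)
qed

context adjunction
begin

lemma eta_simps [simp]: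
  assumes "X \<in> obj C"
  shows "eta X \<in> arr C" "src C (eta X) = X" "tgt C (eta X) = fob G (fob F X)"
  using eta_hom[OF assms] by auto

lemma eps_simps [simp]:
  assumes "A \<in> obj D"
  shows "eps A \<in> arr D" "src D (eps A) = fob F (fob G A)" "tgt D (eps A) = A"
  using eps_hom[OF assms] by auto

lemma eta_natural':
  "f \<in> arr C \<Longrightarrow> far G (far F f) \<cdot>\<^bsub>C\<^esub> eta (src C f) = eta (tgt C f) \<cdot>\<^bsub>C\<^esub> f"
  using eta_natural[of f "src C f" "tgt C f"] by auto

lemma eps_natural':
  "f \<in> arr D \<Longrightarrow> eps (tgt D f) \<cdot>\<^bsub>D\<^esub> far F (far G f) = f \<cdot>\<^bsub>D\<^esub> eps (src D f)"
  using eps_natural[of f "src D f" "tgt D f"] by auto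

lemma eps_natural_cmp:
  assumes "f \<in> arr D" "x \<in> arr D" "tgt D x = fob F (fob G (src D f))"
  shows "eps (tgt D f) \<cdot>\<^bsub>D\<^esub> far F (far G f) \<cdot>\<^bsub>D\<^esub> x = f \<cdot>\<^bsub>D\<^esub> eps (src D f) \<cdot>\<^bsub>D\<^esub> x"
  using assms F.D.cmp_assoc'[of x "far F (far G f)" "eps (tgt D f)", symmetric]
  by (simp add: eps_natural' del: F.D.cmp_assoc') simp

lemma transpose_transpose:
  assumes "u \<in> arr D" "src D u = fob F X" "X \<in> obj C"
  shows "eps (tgt D u) \<cdot>\<^bsub>D\<^esub> far F (far G u \<cdot>\<^bsub>C\<^esub> eta X) = u"
proof -
  have "eps (tgt D u) \<cdot>\<^bsub>D\<^esub> far F (far G u \<cdot>\<^bsub>C\<^esub> eta X) = u \<cdot>\<^bsub>D\<^esub> eps (fob F X) \<cdot>\<^bsub>D\<^esub> far F (eta X)"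
    using assms eps_natural_cmp[of u "far F (eta X)"] by simp
  then show ?thesis
    using assms by (simp add: triangle_left)
qed

lemma transpose_inject:
  assumes "u \<in> hom D (fob F X) A" "v \<in> hom D (fob F X) A" "X \<in> obj C"
    and "far G u \<cdot>\<^bsub>C\<^esub> eta X = far G v \<cdot>\<^bsub>C\<^esub> eta X"
  shows "u = v"
  using transpose_transpose[of u X] transpose_transpose[of v X] assms by simp

end

text \<open>The composite data are given by equations so that \<open>F\<close>, \<open>G\<close>,
  \<open>etaFG\<close> and \<open>epsFG\<close> fit as they are defined. In both triangle identities
  naturality first moves the unit \<open>eta'\<close> past the counit \<open>eps\<close>; then the
  two given triangle identities apply in turn.\<close>

lemma adjunction_comp:
  assumes "adjunction C D F G eta eps" "adjunction D E F' G' eta' eps'"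
    and H: "\<And>X. fob H X = fob F' (fob F X)" "\<And>f. far H f = far F' (far F f)"
    and H': "\<And>X. fob H' X = fob G (fob G' X)" "\<And>f. far H' f = far G (far G' f)"
    and e: "\<And>X. eta'' X = far G (eta' (fob F X)) \<cdot>\<^bsub>C\<^esub> eta X"
    and e': "\<And>A. eps'' A = eps' A \<cdot>\<^bsub>E\<^esub> far F' (eps (fob G' A))"
  shows "adjunction C E H H' eta'' eps''"
proof -
  interpret A: adjunction C D F G eta eps by fact
  interpret A': adjunction D E F' G' eta' eps' by fact
  interpret H: cat_functor C E H
    by (rule cat_functor_comp[OF A.F.cat_functor_axioms A'.F.cat_functor_axioms H])
  interpret H': cat_functor E C H'
    by (rule cat_functor_comp[OF A'.G.cat_functor_axioms A.G.cat_functor_axioms H'])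
  show ?thesis
  proof unfold_locales
    show "eta'' X \<in> hom C X (fob H' (fob H X))" if "X \<in> obj C" for X
      using that by (simp add: H H' e)
    show "eps'' A \<in> hom E (fob H (fob H' A)) A" if "A \<in> obj E" for A
      using that by (simp add: H H' e')
    show "far H' (far H f) \<cdot>\<^bsub>C\<^esub> eta'' X = eta'' Y \<cdot>\<^bsub>C\<^esub> f" if f: "f \<in> hom C X Y" for f X Y
    proof -
      have o: "X \<in> obj C" "Y \<in> obj C" using f by auto
      have "far H' (far H f) \<cdot>\<^bsub>C\<^esub> eta'' X =
          far G (far G' (far F' (far F f)) \<cdot>\<^bsub>D\<^esub> eta' (fob F X)) \<cdot>\<^bsub>C\<^esub> eta X"
        using f o by (simp add: H H' e)
      also have "\<dots> = far G (eta' (fob F Y)) \<cdot>\<^bsub>C\<^esub> far G (far F f) \<cdot>\<^bsub>C\<^esub> eta X"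
        using f o A'.eta_natural'[of "far F f"] by simp
      also have "\<dots> = far G (eta' (fob F Y)) \<cdot>\<^bsub>C\<^esub> eta Y \<cdot>\<^bsub>C\<^esub> f"
        using f A.eta_natural'[of f] by simp
      finally show ?thesis
        using f o by (simp add: e)
    qed
    show "eps'' B \<cdot>\<^bsub>E\<^esub> far H (far H' g) = g \<cdot>\<^bsub>E\<^esub> eps'' A" if g: "g \<in> hom E A B" for g A B
    proof -
      have o: "A \<in> obj E" "B \<in> obj E" using g by auto
      have "eps'' B \<cdot>\<^bsub>E\<^esub> far H (far H' g) =
          eps' B \<cdot>\<^bsub>E\<^esub> far F' (eps (fob G' B) \<cdot>\<^bsub>D\<^esub> far F (far G (far G' g)))"
        using g o by (simp add: H H' e')
      also have "\<dots> = eps' B \<cdot>\<^bsub>E\<^esub> far F' (far G' g) \<cdot>\<^bsub>E\<^esub> far F' (eps (fob G' A))"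
        using g o A.eps_natural'[of "far G' g"] by simp
      also have "\<dots> = g \<cdot>\<^bsub>E\<^esub> eps' A \<cdot>\<^bsub>E\<^esub> far F' (eps (fob G' A))"
        using g o A'.eps_natural_cmp[of g "far F' (eps (fob G' A))"] by simp
      finally show ?thesis
        using g o by (simp add: e')
    qed
    show "eps'' (fob H X) \<cdot>\<^bsub>E\<^esub> far H (eta'' X) = ide E (fob H X)" if X: "X \<in> obj C" for X
    proof -
      have "eps'' (fob H X) \<cdot>\<^bsub>E\<^esub> far H (eta'' X) = eps' (fob F' (fob F X)) \<cdot>\<^bsub>E\<^esub>
          far F' (eps (fob G' (fob F' (fob F X))) \<cdot>\<^bsub>D\<^esub> far F (far G (eta' (fob F X))) \<cdot>\<^bsub>D\<^esub> far F (eta X))"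
        using X by (simp add: H e e')
      also have "\<dots> = eps' (fob F' (fob F X)) \<cdot>\<^bsub>E\<^esub>
          far F' (eta' (fob F X) \<cdot>\<^bsub>D\<^esub> eps (fob F X) \<cdot>\<^bsub>D\<^esub> far F (eta X))"
        using X A.eps_natural_cmp[of "eta' (fob F X)" "far F (eta X)"] by simp
      also have "\<dots> = ide E (fob H X)"
        using X by (simp add: H A.triangle_left A'.triangle_left)
      finally show ?thesis .
    qed
    show "far H' (eps'' A) \<cdot>\<^bsub>C\<^esub> eta'' (fob H' A) = ide C (fob H' A)" if A: "A \<in> obj E" for A
    proof -
      have "far H' (eps'' A) \<cdot>\<^bsub>C\<^esub> eta'' (fob H' A) = far G (far G' (eps' A) \<cdot>\<^bsub>D\<^esub>
          far G' (far F' (eps (fob G' A))) \<cdot>\<^bsub>D\<^esub> eta' (fob F (fob G (fob G' A)))) \<cdot>\<^bsub>C\<^esub> eta (fob G (fob G' A))"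
        using A by (simp add: H' e e')
      also have "far G' (far F' (eps (fob G' A))) \<cdot>\<^bsub>D\<^esub> eta' (fob F (fob G (fob G' A))) =
          eta' (fob G' A) \<cdot>\<^bsub>D\<^esub> eps (fob G' A)"
        using A A'.eta_natural'[of "eps (fob G' A)"] by simp
      also have "far G' (eps' A) \<cdot>\<^bsub>D\<^esub> eta' (fob G' A) \<cdot>\<^bsub>D\<^esub> eps (fob G' A) = eps (fob G' A)"
        using A A.F.D.cmp_assoc'[of "eps (fob G' A)" "eta' (fob G' A)" "far G' (eps' A)", symmetric]
        by (simp add: A'.triangle_right del: A.F.D.cmp_assoc')
      finally show ?thesis
        using A by (simp add: H' A.triangle_right)
    qed
  qed
qed

locale coproduct_adjunction =
  adjunction C D F G eta eps + C: coproduct_category C + D: coproduct_category D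
  for C :: "('o1, 'a1, 'm1) coprod_cat_scheme" and D :: "('o2, 'a2, 'm2) coprod_cat_scheme"
    and F :: "('o1, 'a1, 'o2, 'a2, 'f) fctr_scheme"
    and G :: "('o2, 'a2, 'o1, 'a1, 'g) fctr_scheme" and eta eps
begin

lemma sum_cmp_simps [simp]:
  assumes "X \<in> obj C" "Y \<in> obj C"
  shows "sum_cmp C D F X Y \<in> arr D" "src D (sum_cmp C D F X Y) = sum_ob D (fob F X) (fob F Y)"
    "tgt D (sum_cmp C D F X Y) = fob F (sum_ob C X Y)"
    "sum_cmp C D F X Y \<cdot>\<^bsub>D\<^esub> inj1 D (fob F X) (fob F Y) = far F (inj1 C X Y)"
    "sum_cmp C D F X Y \<cdot>\<^bsub>D\<^esub> inj2 D (fob F X) (fob F Y) = far F (inj2 C X Y)"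
  using assms by (simp_all add: sum_cmp_def)

text \<open>Left adjoints preserve coproducts. The instances used later are \<open>L\<close>,
  \<open>F\<close> and the functors \<open>L_tensor\<close>; the last ones give
  distributivity.\<close>

lemma iso_sum_cmp [simp]:
  assumes [simp]: "X \<in> obj C" "Y \<in> obj C"
  shows "iso D (sum_cmp C D F X Y)"
proof -
  let ?S = "sum_ob D (fob F X) (fob F Y)"
  define s where "s = sum_cmp C D F X Y"
  have s [simp]: "s \<in> arr D" "src D s = ?S" "tgt D s = fob F (sum_ob C X Y)"
    "s \<cdot>\<^bsub>D\<^esub> inj1 D (fob F X) (fob F Y) = far F (inj1 C X Y)"
    "s \<cdot>\<^bsub>D\<^esub> inj2 D (fob F X) (fob F Y) = far F (inj2 C X Y)"
    by (simp_all add: s_def)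
  \<comment> \<open>The candidate inverse \<open>q\<close> is the transpose of the copairing of the
    transposed injections. One composite is checked on the injections of \<open>D\<close>, the
    other, after transposing, on the injections of \<open>C\<close>.\<close>
  define c where "c = copair C (far G (inj1 D (fob F X) (fob F Y)) \<cdot>\<^bsub>C\<^esub> eta X)
    (far G (inj2 D (fob F X) (fob F Y)) \<cdot>\<^bsub>C\<^esub> eta Y)"
  have c [simp]: "c \<in> arr C" "src C c = sum_ob C X Y" "tgt C c = fob G ?S"
    "c \<cdot>\<^bsub>C\<^esub> inj1 C X Y = far G (inj1 D (fob F X) (fob F Y)) \<cdot>\<^bsub>C\<^esub> eta X"
    "c \<cdot>\<^bsub>C\<^esub> inj2 C X Y = far G (inj2 D (fob F X) (fob F Y)) \<cdot>\<^bsub>C\<^esub> eta Y"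
    by (simp_all add: c_def)
  define q where "q = eps ?S \<cdot>\<^bsub>D\<^esub> far F c"
  have q [simp]: "q \<in> arr D" "src D q = fob F (sum_ob C X Y)" "tgt D q = ?S"
    by (simp_all add: q_def)
  have "q \<cdot>\<^bsub>D\<^esub> s = ide D ?S"
  proof (rule D.sum_ext[of "fob F X" "fob F Y"])
    have "(q \<cdot>\<^bsub>D\<^esub> s) \<cdot>\<^bsub>D\<^esub> inj1 D (fob F X) (fob F Y) = eps ?S \<cdot>\<^bsub>D\<^esub> far F (c \<cdot>\<^bsub>C\<^esub> inj1 C X Y)"
      by (simp add: q_def del: c)
        (simp del: c(4,5))
    then show "(q \<cdot>\<^bsub>D\<^esub> s) \<cdot>\<^bsub>D\<^esub> inj1 D (fob F X) (fob F Y) = ide D ?S \<cdot>\<^bsub>D\<^esub> inj1 D (fob F X) (fob F Y)"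
      using transpose_transpose[of "inj1 D (fob F X) (fob F Y)" X] by (simp only: c) simp
    have "(q \<cdot>\<^bsub>D\<^esub> s) \<cdot>\<^bsub>D\<^esub> inj2 D (fob F X) (fob F Y) = eps ?S \<cdot>\<^bsub>D\<^esub> far F (c \<cdot>\<^bsub>C\<^esub> inj2 C X Y)"
      by (simp add: q_def del: c(4,5))
    then show "(q \<cdot>\<^bsub>D\<^esub> s) \<cdot>\<^bsub>D\<^esub> inj2 D (fob F X) (fob F Y) = ide D ?S \<cdot>\<^bsub>D\<^esub> inj2 D (fob F X) (fob F Y)"
      using transpose_transpose[of "inj2 D (fob F X) (fob F Y)" Y] by (simp only: c) simp
  qed simp_all
  moreover have "s \<cdot>\<^bsub>D\<^esub> q = ide D (fob F (sum_ob C X Y))"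
  proof (rule transpose_inject[of _ "sum_ob C X Y"])
    have "far G (s \<cdot>\<^bsub>D\<^esub> q) \<cdot>\<^bsub>C\<^esub> eta (sum_ob C X Y) =
        far G s \<cdot>\<^bsub>C\<^esub> far G (eps ?S) \<cdot>\<^bsub>C\<^esub> far G (far F c) \<cdot>\<^bsub>C\<^esub> eta (sum_ob C X Y)"
      by (simp add: q_def)
    also have "\<dots> = far G s \<cdot>\<^bsub>C\<^esub> (far G (eps ?S) \<cdot>\<^bsub>C\<^esub> eta (fob G ?S)) \<cdot>\<^bsub>C\<^esub> c"
      using eta_natural'[of c] by simp
    also have "\<dots> = far G s \<cdot>\<^bsub>C\<^esub> c"
      by (subst triangle_right) simp_all
    also have "\<dots> = eta (sum_ob C X Y)"
    proof (rule C.sum_ext[of X Y])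
      have "(far G s \<cdot>\<^bsub>C\<^esub> c) \<cdot>\<^bsub>C\<^esub> inj1 C X Y = far G (s \<cdot>\<^bsub>D\<^esub> inj1 D (fob F X) (fob F Y)) \<cdot>\<^bsub>C\<^esub> eta X"
        by (simp del: s(4,5))
      then show "(far G s \<cdot>\<^bsub>C\<^esub> c) \<cdot>\<^bsub>C\<^esub> inj1 C X Y = eta (sum_ob C X Y) \<cdot>\<^bsub>C\<^esub> inj1 C X Y"
        using eta_natural'[of "inj1 C X Y"] by simp
      have "(far G s \<cdot>\<^bsub>C\<^esub> c) \<cdot>\<^bsub>C\<^esub> inj2 C X Y = far G (s \<cdot>\<^bsub>D\<^esub> inj2 D (fob F X) (fob F Y)) \<cdot>\<^bsub>C\<^esub> eta Y"
        by (simp del: s(4,5))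
      then show "(far G s \<cdot>\<^bsub>C\<^esub> c) \<cdot>\<^bsub>C\<^esub> inj2 C X Y = eta (sum_ob C X Y) \<cdot>\<^bsub>C\<^esub> inj2 C X Y"
        using eta_natural'[of "inj2 C X Y"] by simp
    qed simp_all
    finally show "far G (s \<cdot>\<^bsub>D\<^esub> q) \<cdot>\<^bsub>C\<^esub> eta (sum_ob C X Y) =
        far G (ide D (fob F (sum_ob C X Y))) \<cdot>\<^bsub>C\<^esub> eta (sum_ob C X Y)"
      by simp
  qed simp_all
  ultimately have "is_inverse D s q"
    by (simp add: is_inverse_def)
  then show ?thesis
    unfolding iso_def s_def by blast
qed

end

context symmetric_monoidal_adjunction
begin

declare mlt_iso [simp] mun_iso [simp]

lemma mun_simps [simp]:
  "mun F \<in> arr D" "src D (mun F) = unit D" "tgt D (mun F) = fob F (unit C)"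
  using F.mun_hom by auto

lemma mlt_simps [simp]:
  assumes "X \<in> obj C" "Y \<in> obj C"
  shows "mlt F X Y \<in> arr D" "src D (mlt F X Y) = fob F X \<boxtimes>\<^bsub>D\<^esub> fob F Y"
    "tgt D (mlt F X Y) = fob F (X \<boxtimes>\<^bsub>C\<^esub> Y)"
  using F.mlt_hom[OF assms] by auto

lemma mlt_natural':
  assumes "f \<in> arr C" "g \<in> arr C"
  shows "far F (f \<otimes>\<^bsub>C\<^esub> g) \<cdot>\<^bsub>D\<^esub> mlt F (src C f) (src C g) =
    mlt F (tgt C f) (tgt C g) \<cdot>\<^bsub>D\<^esub> (far F f \<otimes>\<^bsub>D\<^esub> far F g)"
  using F.mlt_natural[of f "src C f" "tgt C f" g "src C g" "tgt C g"] assms by simp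

lemma far_inv_lun_unit:
  "far F (inv_arr C (lun C (unit C))) \<cdot>\<^bsub>D\<^esub> mun F = mlt F (unit C) (unit C) \<cdot>\<^bsub>D\<^esub> pt D (mun F) (mun F)"
proof (rule F.D.iso_mono[of "far F (lun C (unit C))"])
  have "far F (lun C (unit C)) \<cdot>\<^bsub>D\<^esub> mlt F (unit C) (unit C) \<cdot>\<^bsub>D\<^esub> pt D (mun F) (mun F) =
     (far F (lun C (unit C)) \<cdot>\<^bsub>D\<^esub> mlt F (unit C) (unit C) \<cdot>\<^bsub>D\<^esub> (mun F \<otimes>\<^bsub>D\<^esub> ide D (fob F (unit C)))) \<cdot>\<^bsub>D\<^esub>
       pt D (ide D (unit D)) (mun F)"
    by simp
  also have "\<dots> = lun D (fob F (unit C)) \<cdot>\<^bsub>D\<^esub> pt D (ide D (unit D)) (mun F)"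
    by (subst F.mlt_lun) simp_all
  also have "\<dots> = far F (lun C (unit C)) \<cdot>\<^bsub>D\<^esub> far F (inv_arr C (lun C (unit C))) \<cdot>\<^bsub>D\<^esub> mun F"
    by (simp add: F.far_inv)
  finally show "far F (lun C (unit C)) \<cdot>\<^bsub>D\<^esub> far F (inv_arr C (lun C (unit C))) \<cdot>\<^bsub>D\<^esub> mun F =
    far F (lun C (unit C)) \<cdot>\<^bsub>D\<^esub> mlt F (unit C) (unit C) \<cdot>\<^bsub>D\<^esub> pt D (mun F) (mun F)"
    by simp
qed simp_all

text \<open>\<open>F\<close> sends a point to a map out of the image of the unit, and precomposing
  with \<open>mun F\<close> makes it a point again. Pairs are then preserved by naturality of
  \<open>mlt\<close> and the unit law \<open>mlt_lun\<close>.\<close>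

lemma far_pt:
  assumes "f \<in> hom C (unit C) X" "g \<in> hom C (unit C) Y"
  shows "far F (pt C f g) \<cdot>\<^bsub>D\<^esub> mun F = mlt F X Y \<cdot>\<^bsub>D\<^esub> pt D (far F f \<cdot>\<^bsub>D\<^esub> mun F) (far F g \<cdot>\<^bsub>D\<^esub> mun F)"
proof -
  have o: "X \<in> obj C" "Y \<in> obj C" using assms by auto
  have "far F (pt C f g) \<cdot>\<^bsub>D\<^esub> mun F =
      far F (f \<otimes>\<^bsub>C\<^esub> g) \<cdot>\<^bsub>D\<^esub> far F (inv_arr C (lun C (unit C))) \<cdot>\<^bsub>D\<^esub> mun F"
    using assms by (simp add: pt_def)
  also have "\<dots> = (far F (f \<otimes>\<^bsub>C\<^esub> g) \<cdot>\<^bsub>D\<^esub> mlt F (unit C) (unit C)) \<cdot>\<^bsub>D\<^esub> pt D (mun F) (mun F)"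
    using assms by (simp add: far_inv_lun_unit)
  also have "\<dots> = mlt F X Y \<cdot>\<^bsub>D\<^esub> pt D (far F f \<cdot>\<^bsub>D\<^esub> mun F) (far F g \<cdot>\<^bsub>D\<^esub> mun F)"
    using assms o mlt_natural'[of f g] by simp
  finally show ?thesis .
qed

end

section \<open>The structure of a model\<close>

lemma (in category) the_arr_simps [simp]:
  assumes "terminal C T" "X \<in> obj C"
  shows "the_arr C X T \<in> arr C" "src C (the_arr C X T) = X" "tgt C (the_arr C X T) = T"
  using theI'[of "\<lambda>f. f \<in> hom C X T"] assms unfolding the_arr_def terminal_def by auto

lemma (in category) terminal_ext:
  assumes "terminal C T" "f \<in> arr C" "g \<in> arr C" "src C f = src C g" "tgt C f = T" "tgt C g = T"
  shows "f = g"
proof -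
  have "\<exists>!f. f \<in> hom C (src C g) T"
    using assms src_obj unfolding terminal_def by blast
  then show ?thesis
    using assms by auto
qed

context cartesian_coproduct_category
begin

declare one_terminal [simp] prd_obj [simp]

lemma term_ob_obj [simp]: "term_ob C \<in> obj C"
  using one_terminal by (simp add: terminal_def del: one_terminal)

lemma pr_simps [simp]:
  assumes "X \<in> obj C" "Y \<in> obj C"
  shows "pr1 C X Y \<in> arr C" "src C (pr1 C X Y) = prd C X Y" "tgt C (pr1 C X Y) = X"
    "pr2 C X Y \<in> arr C" "src C (pr2 C X Y) = prd C X Y" "tgt C (pr2 C X Y) = Y"
  using pr1_hom[OF assms] pr2_hom[OF assms] by auto

lemma pair_props:
  assumes "f \<in> arr C" "g \<in> arr C" "src C f = src C g"
  shows "pair C f g \<in> hom C (src C g) (prd C (tgt C f) (tgt C g)) \<and>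
     pr1 C (tgt C f) (tgt C g) \<cdot> pair C f g = f \<and> pr2 C (tgt C f) (tgt C g) \<cdot> pair C f g = g"
  using theI'[OF prd_universal[of f "src C f" "tgt C f" g "tgt C g"]] assms
  unfolding pair_def by simp

lemma pair_simps [simp]:
  assumes "f \<in> arr C" "g \<in> arr C" "src C f = src C g"
  shows "pair C f g \<in> arr C" "src C (pair C f g) = src C g" "tgt C (pair C f g) = prd C (tgt C f) (tgt C g)"
    "tgt C f = X \<Longrightarrow> tgt C g = Y \<Longrightarrow> pr1 C X Y \<cdot> pair C f g = f"
    "tgt C f = X \<Longrightarrow> tgt C g = Y \<Longrightarrow> pr2 C X Y \<cdot> pair C f g = g"
  using pair_props[OF assms] by auto

lemma prd_ext:
  assumes "X \<in> obj C" "Y \<in> obj C" "h \<in> arr C" "h' \<in> arr C" "src C h = src C h'"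
    "tgt C h = prd C X Y" "tgt C h' = prd C X Y"
    "pr1 C X Y \<cdot> h = pr1 C X Y \<cdot> h'" "pr2 C X Y \<cdot> h = pr2 C X Y \<cdot> h'"
  shows "h = h'"
  using prd_universal[of "pr1 C X Y \<cdot> h'" "src C h'" X "pr2 C X Y \<cdot> h'" Y] assms by auto

lemma pair_ide_cmp:
  assumes "f \<in> arr C" "tgt C f = X"
  shows "pair C (ide C X) (ide C X) \<cdot> f = pair C f f"
proof -
  have [simp]: "X \<in> obj C" using assms by auto
  let ?d = "pair C (ide C X) (ide C X)"
  have p: "pr1 C X X \<cdot> ?d \<cdot> f = ide C X \<cdot> f" "pr2 C X X \<cdot> ?d \<cdot> f = ide C X \<cdot> f"
    by (rule cmp_reassoc; simp add: assms)+
  show ?thesis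
    by (rule prd_ext[of X X]) (use assms p in simp_all)
qed

end

lemma cart_monoidal_simps [simp]:
  "obj (cart_monoidal B) = obj B" "arr (cart_monoidal B) = arr B" "src (cart_monoidal B) = src B"
  "tgt (cart_monoidal B) = tgt B" "ide (cart_monoidal B) = ide B" "cmp (cart_monoidal B) = cmp B"
  "unit (cart_monoidal B) = term_ob B" "tob (cart_monoidal B) = prd B"
  by (simp_all add: cart_monoidal_def)

lemma hom_cart_monoidal [simp]: "hom (cart_monoidal B) = hom B"
  by (simp add: hom_def fun_eq_iff)

lemma inv_cart_monoidal [simp]:
  "is_inverse (cart_monoidal B) = is_inverse B"
  "iso (cart_monoidal B) = iso B" "inv_arr (cart_monoidal B) = inv_arr B"
  by (simp_all add: fun_eq_iff iso_def inv_arr_def is_inverse_def)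

text \<open>The unit is terminal, so the two projections of its square agree and the inverse unitor
  inside \<open>pt\<close> is the diagonal.\<close>

lemma (in cartesian_coproduct_category) pt_cart_monoidal:
  assumes "symmetric_monoidal_category (cart_monoidal C)"
    and f: "f \<in> arr C" "src C f = term_ob C" and g: "g \<in> arr C" "src C g = term_ob C"
  shows "pt (cart_monoidal C) f g = pair C f g"
proof -
  interpret S: symmetric_monoidal_category "cart_monoidal C" by fact
  let ?one = "term_ob C"
  let ?p = "pr2 C ?one ?one"
  have i [simp]: "iso C ?p"
    using S.lun_iso[of ?one] by (simp add: cart_monoidal_def flip: inv_cart_monoidal(2))
  have [simp]: "tgt C f \<in> obj C" "tgt C g \<in> obj C"
    using f g by auto
  have 1: "pr1 C ?one ?one \<cdot> inv_arr C ?p = ide C ?one"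
    by (rule terminal_ext[OF one_terminal]) simp_all
  define h where "h = pair C (f \<cdot> pr1 C ?one ?one) (g \<cdot> ?p)"
  have h [simp]: "h \<in> arr C" "src C h = prd C ?one ?one" "tgt C h = prd C (tgt C f) (tgt C g)"
    "pr1 C (tgt C f) (tgt C g) \<cdot> h = f \<cdot> pr1 C ?one ?one"
    "pr2 C (tgt C f) (tgt C g) \<cdot> h = g \<cdot> ?p"
    using f g by (simp_all add: h_def)
  have p: "pt (cart_monoidal C) f g = h \<cdot> inv_arr C ?p"
    using f g by (simp add: pt_def h_def) (simp add: cart_monoidal_def)
  have q: "pr1 C (tgt C f) (tgt C g) \<cdot> h \<cdot> inv_arr C ?p = (f \<cdot> pr1 C ?one ?one) \<cdot> inv_arr C ?p"
    "pr2 C (tgt C f) (tgt C g) \<cdot> h \<cdot> inv_arr C ?p = (g \<cdot> ?p) \<cdot> inv_arr C ?p"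
    by (rule cmp_reassoc; simp)+
  show ?thesis
    unfolding p by (rule prd_ext[of "tgt C f" "tgt C g"]) (use f g 1 q in simp_all)
qed

section \<open>The adjunctions of a model\<close>

sublocale lambda_l_model \<subseteq> BB: cartesian_coproduct_category "catB M"
  by (rule B_cartesian)
sublocale lambda_l_model \<subseteq> VV: coproduct_category "catV M"
  by (rule V_coproduct)
sublocale lambda_l_model \<subseteq> VM: symmetric_monoidal_category "catV M"
  by (rule V_monoidal)
sublocale lambda_l_model \<subseteq> CC: coproduct_category "catC M"
  by (rule C_coproduct)
sublocale lambda_l_model \<subseteq> CM: symmetric_monoidal_category "catC M"
  by (rule C_monoidal)
sublocale lambda_l_model \<subseteq> JK: symmetric_monoidal_adjunction "cart_monoidal (catB M)" "catV M"
    "funJ M" "funK M" "etaJK M" "epsJK M"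
  by (rule adjunction_JK)
sublocale lambda_l_model \<subseteq> LR: symmetric_monoidal_adjunction "catV M" "catC M"
    "funL M" "funR M" "etaLR M" "epsLR M"
  by (rule adjunction_LR)
sublocale lambda_l_model \<subseteq> LR: coproduct_adjunction "catV M" "catC M"
    "funL M" "funR M" "etaLR M" "epsLR M"
  by unfold_locales

context lambda_l_model
begin

text \<open>\<open>adjunction_JK\<close> is stated over the record \<open>cart_monoidal\<close>,
  which no longer carries the projections. Over \<open>\<B>\<close> itself the adjunction can be
  composed with that of \<open>L\<close> and \<open>R\<close> on the category where products are
  available.\<close>

lemma adjunction_BV: "adjunction \<B> \<V> J K (etaJK M) (epsJK M)"
proof -
  interpret J: cat_functor \<B> \<V> J
    using JK.F.fob_obj JK.F.far_hom JK.F.far_ide JK.F.far_cmp by unfold_locales auto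
  interpret K: cat_functor \<V> \<B> K
    using JK.G.fob_obj JK.G.far_hom JK.G.far_ide JK.G.far_cmp by unfold_locales auto
  show ?thesis
    using JK.eta_hom JK.eps_hom JK.eta_natural JK.eps_natural JK.triangle_left JK.triangle_right
    by unfold_locales auto
qed

end

sublocale lambda_l_model \<subseteq> BV: adjunction "catB M" "catV M" "funJ M" "funK M" "etaJK M" "epsJK M"
  by (rule adjunction_BV)

context lambda_l_model
begin

lemma F_simps: "fob F X = fob L (fob J X)" "far F f = far L (far J f)"
  "mlt F X Y = far L (mlt J X Y) \<cdot>\<^bsub>\<C>\<^esub> mlt L (fob J X) (fob J Y)" "mun F = far L (mun J) \<cdot>\<^bsub>\<C>\<^esub> mun L"
  by (simp_all add: F_def mcomp_def)

lemma G_simps: "fob G X = fob K (fob R X)" "far G f = far K (far R f)"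
  by (simp_all add: G_def mcomp_def)

lemma adjunction_FG: "adjunction \<B> \<C> F G etaFG epsFG"
  by (rule adjunction_comp[OF BV.adjunction_axioms LR.adjunction_axioms])
    (simp_all add: F_simps G_simps etaFG_def epsFG_def)

end

sublocale lambda_l_model \<subseteq> FG: adjunction "catB M" "catC M" F G etaFG epsFG
  by (rule adjunction_FG)
sublocale lambda_l_model \<subseteq> FG: coproduct_adjunction "catB M" "catC M" F G etaFG epsFG
  by unfold_locales

context lambda_l_model
begin

lemma L_tensor_adjunction:
  "A \<in> obj \<V> \<Longrightarrow> coproduct_adjunction \<V> \<C> (L_tensor A) (lolli M A) (coev M A) (evl M A)"
  unfolding coproduct_adjunction_def
  using adjunction_lolli VV.coproduct_category_axioms CC.coproduct_category_axioms by blast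

lemma mF_simps [simp]:
  "mun F \<in> arr \<C>" "src \<C> (mun F) = unit \<C>" "tgt \<C> (mun F) = fob F (term_ob \<B>)" "iso \<C> (mun F)"
  using JK.mun_simps JK.mun_iso by (simp_all add: F_simps)

lemma mltF_simps [simp]:
  assumes "X \<in> obj \<B>" "Y \<in> obj \<B>"
  shows "mlt F X Y \<in> arr \<C>" "src \<C> (mlt F X Y) = fob F X \<boxtimes> fob F Y"
    "tgt \<C> (mlt F X Y) = fob F (prd \<B> X Y)" "iso \<C> (mlt F X Y)"
  using JK.mlt_simps[of X Y] JK.mlt_iso[of X Y] assms by (simp_all add: F_simps)

text \<open>Preservation of pairs of points by \<open>J\<close> and then by \<open>L\<close>, where
  on the side of \<open>\<B>\<close> a pair of points is an actual pairing.\<close>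

lemma F_pair:
  assumes "f \<in> hom \<B> (term_ob \<B>) X" "g \<in> hom \<B> (term_ob \<B>) Y"
  shows "far F (pair \<B> f g) \<bullet> mun F = mlt F X Y \<bullet> pt \<C> (far F f \<bullet> mun F) (far F g \<bullet> mun F)"
proof -
  have o [simp]: "X \<in> obj \<B>" "Y \<in> obj \<B>" using assms by auto
  have m: "mlt J X Y \<in> arr \<V>" "src \<V> (mlt J X Y) = fob J X \<boxtimes>\<^bsub>\<V>\<^esub> fob J Y"
    "tgt \<V> (mlt J X Y) = fob J (prd \<B> X Y)"
    "mun J \<in> arr \<V>" "src \<V> (mun J) = unit \<V>" "tgt \<V> (mun J) = fob J (term_ob \<B>)"
    using JK.mlt_simps[of X Y] JK.mun_simps by simp_all
  have J: "far J (pair \<B> f g) \<cdot>\<^bsub>\<V>\<^esub> mun J =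
      mlt J X Y \<cdot>\<^bsub>\<V>\<^esub> pt \<V> (far J f \<cdot>\<^bsub>\<V>\<^esub> mun J) (far J g \<cdot>\<^bsub>\<V>\<^esub> mun J)"
    using JK.far_pt[of f X g Y] assms BB.pt_cart_monoidal[OF JK.F.C.symmetric_monoidal_category_axioms, of f g]
    by simp
  have "far F (pair \<B> f g) \<bullet> mun F = far L (far J (pair \<B> f g) \<cdot>\<^bsub>\<V>\<^esub> mun J) \<bullet> mun L"
    using assms m by (simp add: F_simps)
  also have "\<dots> = far L (mlt J X Y) \<bullet> far L (pt \<V> (far J f \<cdot>\<^bsub>\<V>\<^esub> mun J) (far J g \<cdot>\<^bsub>\<V>\<^esub> mun J)) \<bullet> mun L"
    unfolding J using assms m by simp
  also have "\<dots> = mlt F X Y \<bullet> pt \<C> (far F f \<bullet> mun F) (far F g \<bullet> mun F)"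
    using assms m LR.far_pt[of "far J f \<cdot>\<^bsub>\<V>\<^esub> mun J" "fob J X" "far J g \<cdot>\<^bsub>\<V>\<^esub> mun J" "fob J Y"]
    by (simp add: F_simps)
  finally show ?thesis .
qed

section \<open>Domains and codomains of the interpretation maps\<close>

lemma bang_ob_obj [simp]: "X \<in> obj \<C> \<Longrightarrow> bang_ob X \<in> obj \<C>"
  by (simp add: bang_ob_def)

lemma bang_simps [simp]:
  assumes "f \<in> arr \<C>"
  shows "bang f \<in> arr \<C>" "src \<C> (bang f) = bang_ob (src \<C> f)" "tgt \<C> (bang f) = bang_ob (tgt \<C> f)"
  using assms by (simp_all add: bang_def bang_ob_def)

lemma bang_cmp: "f \<in> arr \<C> \<Longrightarrow> g \<in> arr \<C> \<Longrightarrow> src \<C> g = tgt \<C> f \<Longrightarrow> bang (g \<bullet> f) = bang g \<bullet> bang f"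
  by (simp add: bang_def)

lemma epsFG_simps [simp]:
  "X \<in> obj \<C> \<Longrightarrow> src \<C> (epsFG X) = bang_ob X"
  "X \<in> obj \<C> \<Longrightarrow> tgt \<C> (epsFG X) = X"
  by (simp_all add: bang_ob_def)

text \<open>Proved jointly because \<open>TLolli\<close> needs \<open>tyV\<close> of its domain and
  \<open>tyC\<close> of its codomain.\<close>

lemma tyCV_obj: "tyC A \<in> obj \<C> \<and> tyV A \<in> obj \<V>"
proof (induction A)
  case (TLolli A B)
  interpret A: coproduct_adjunction \<V> \<C> "L_tensor (tyV A)" "lolli M (tyV A)" "coev M (tyV A)" "evl M (tyV A)"
    using TLolli by (simp add: L_tensor_adjunction)
  show ?case
    using TLolli by simp
qed simp_all

lemma tyC_obj [simp]: "tyC A \<in> obj \<C>" and tyV_obj [simp]: "tyV A \<in> obj \<V>"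
  using tyCV_obj by simp_all

lemma lolli_obj [simp]: "fob (lolli M (tyV A)) (tyC B) \<in> obj \<V>"
  using tyV_obj[of "TLolli A B"] by simp

lemma tyB_obj [simp]: "nonlinear P \<Longrightarrow> tyB P \<in> obj \<B>"
  by (induction P) simp_all

lemma nonlinear_ctx_simps [simp]:
  "nonlinear_ctx []"
  "nonlinear_ctx (xA # \<Phi>) \<longleftrightarrow> nonlinear (snd xA) \<and> nonlinear_ctx \<Phi>"
  by (auto simp: nonlinear_ctx_def)

lemma ctxC_obj [simp]: "ctxC \<Gamma> \<in> obj \<C>"
  by (induction \<Gamma>) simp_all

lemma ctxV_obj [simp]: "ctxV \<Gamma> \<in> obj \<V>"
  by (induction \<Gamma>) simp_all

lemma ctxB_obj [simp]: "nonlinear_ctx \<Phi> \<Longrightarrow> ctxB \<Phi> \<in> obj \<B>"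
  by (induction \<Phi>) simp_all

lemma isoL_props: "iso \<C> (isoL A) \<and> isoL A \<in> hom \<C> (fob L (tyV A)) (tyC A)"
  by (induction A) (simp_all add: bang_ob_def F_simps)

lemma isoL_simps [simp]:
  "iso \<C> (isoL A)" "isoL A \<in> arr \<C>" "src \<C> (isoL A) = fob L (tyV A)" "tgt \<C> (isoL A) = tyC A"
  using isoL_props by simp_all

lemma isoF_props: "nonlinear P \<Longrightarrow> iso \<C> (isoF P) \<and> isoF P \<in> hom \<C> (fob F (tyB P)) (tyC P)"
  by (induction P) (simp_all add: bang_ob_def)

lemma isoF_simps [simp]:
  assumes "nonlinear P"
  shows "iso \<C> (isoF P)" "isoF P \<in> arr \<C>" "src \<C> (isoF P) = fob F (tyB P)" "tgt \<C> (isoF P) = tyC P"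
  using isoF_props[OF assms] by simp_all

lemma ctx_isoL_props: "iso \<C> (ctx_isoL \<Gamma>) \<and> ctx_isoL \<Gamma> \<in> hom \<C> (fob L (ctxV \<Gamma>)) (ctxC \<Gamma>)"
  by (induction \<Gamma>) simp_all

lemma ctx_isoL_simps [simp]:
  "iso \<C> (ctx_isoL \<Gamma>)" "ctx_isoL \<Gamma> \<in> arr \<C>"
  "src \<C> (ctx_isoL \<Gamma>) = fob L (ctxV \<Gamma>)" "tgt \<C> (ctx_isoL \<Gamma>) = ctxC \<Gamma>"
  using ctx_isoL_props by simp_all

lemma ctx_isoF_props:
  "nonlinear_ctx \<Phi> \<Longrightarrow> iso \<C> (ctx_isoF \<Phi>) \<and> ctx_isoF \<Phi> \<in> hom \<C> (fob F (ctxB \<Phi>)) (ctxC \<Phi>)"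
  by (induction \<Phi>) simp_all

lemma ctx_isoF_simps [simp]:
  assumes "nonlinear_ctx \<Phi>"
  shows "iso \<C> (ctx_isoF \<Phi>)" "ctx_isoF \<Phi> \<in> arr \<C>"
    "src \<C> (ctx_isoF \<Phi>) = fob F (ctxB \<Phi>)" "tgt \<C> (ctx_isoF \<Phi>) = ctxC \<Phi>"
  using ctx_isoF_props[OF assms] by simp_all

lemma ctxC_append_cong: "ctxC \<Sigma> = ctxC \<Sigma>' \<Longrightarrow> ctxC (\<Gamma> @ \<Sigma>) = ctxC (\<Gamma> @ \<Sigma>')"
  by (induction \<Gamma>) simp_all

lemma join_props: "iso \<C> (join \<Gamma> \<Sigma>) \<and> join \<Gamma> \<Sigma> \<in> hom \<C> (ctxC (\<Gamma> @ \<Sigma>)) (ctxC \<Gamma> \<boxtimes> ctxC \<Sigma>)"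
  by (induction \<Gamma>) simp_all

lemma join_simps [simp]:
  "iso \<C> (join \<Gamma> \<Sigma>)" "join \<Gamma> \<Sigma> \<in> arr \<C>"
  "src \<C> (join \<Gamma> \<Sigma>) = ctxC (\<Gamma> @ \<Sigma>)" "tgt \<C> (join \<Gamma> \<Sigma>) = ctxC \<Gamma> \<boxtimes> ctxC \<Sigma>"
  using join_props by simp_all

lemma ctxC_snoc_cong: "ctxC (\<Gamma> @ [(x, A)]) = ctxC (\<Gamma> @ [(0, A)])"
  by (rule ctxC_append_cong) simp

lemma ext_simps [simp]:
  "iso \<C> (ext \<Gamma> A)" "ext \<Gamma> A \<in> arr \<C>"
  "src \<C> (ext \<Gamma> A) = ctxC (\<Gamma> @ [(0, A)])" "tgt \<C> (ext \<Gamma> A) = ctxC \<Gamma> \<boxtimes> tyC A"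
  by (simp_all add: ext_def)

lemma exchange_hom:
  "exchange \<Gamma> A B \<Sigma> \<in> hom \<C> (ctxC (\<Gamma> @ (y, B) # (x, A) # \<Sigma>)) (ctxC (\<Gamma> @ (x, A) # (y, B) # \<Sigma>))"
  by (induction \<Gamma>) simp_all

lemma discard_simps [simp]:
  assumes "nonlinear_ctx \<Phi>"
  shows "discard \<Phi> \<in> arr \<C>" "src \<C> (discard \<Phi>) = ctxC \<Phi>" "tgt \<C> (discard \<Phi>) = unit \<C>"
  using assms by (simp_all add: discard_def)

lemma duplicate_simps [simp]:
  assumes "nonlinear_ctx \<Phi>"
  shows "duplicate \<Phi> \<in> arr \<C>" "src \<C> (duplicate \<Phi>) = ctxC \<Phi>" "tgt \<C> (duplicate \<Phi>) = ctxC \<Phi> \<boxtimes> ctxC \<Phi>"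
  using assms by (simp_all add: duplicate_def)

lemma box_simps [simp]:
  assumes "nonlinear_ctx \<Phi>"
  shows "box \<Phi> \<in> arr \<C>" "src \<C> (box \<Phi>) = ctxC \<Phi>" "tgt \<C> (box \<Phi>) = bang_ob (ctxC \<Phi>)"
  using assms by (simp_all add: box_def bang_ob_def[of "fob F (ctxB \<Phi>)"])

text \<open>Terminality is a premise and not a locale assumption, so that both calculi can be
  treated in one locale; later it is demanded only under \<open>c = Affine\<close>.\<close>

lemma affine_discard_simps [simp]:
  assumes "terminal \<V> (unit \<V>)"
  shows "affine_discard \<Gamma> \<in> arr \<C>" "src \<C> (affine_discard \<Gamma>) = ctxC \<Gamma>"
    "tgt \<C> (affine_discard \<Gamma>) = unit \<C>"
  using assms by (simp_all add: affine_discard_def)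

lemma middle_swap_simps [simp]:
  assumes "X \<in> obj \<C>" "Y \<in> obj \<C>" "Z \<in> obj \<C>" "W \<in> obj \<C>"
  shows "middle_swap X Y Z W \<in> arr \<C>" "src \<C> (middle_swap X Y Z W) = (X \<boxtimes> Y) \<boxtimes> (Z \<boxtimes> W)"
    "tgt \<C> (middle_swap X Y Z W) = (X \<boxtimes> Z) \<boxtimes> (Y \<boxtimes> W)"
  using assms by (simp_all add: middle_swap_def)

lemma ctx_split_simps [simp]:
  assumes "nonlinear_ctx \<Phi>"
  shows "ctx_split \<Phi> \<Gamma> \<Sigma> \<in> arr \<C>" "src \<C> (ctx_split \<Phi> \<Gamma> \<Sigma>) = ctxC (\<Phi> @ \<Gamma> @ \<Sigma>)"
    "tgt \<C> (ctx_split \<Phi> \<Gamma> \<Sigma>) = ctxC (\<Phi> @ \<Gamma>) \<boxtimes> ctxC (\<Phi> @ \<Sigma>)"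
  using assms by (simp_all add: ctx_split_def)

end

section \<open>Points of the interpretation\<close>

context lambda_l_model
begin

text \<open>The interpretation sees only the list of types, so \<open>shift\<close> and the dummy
  name 0 in \<open>ext\<close> do no harm.\<close>

lemma ctxC_cong:
  assumes "map snd \<Gamma> = map snd \<Gamma>'"
  shows "ctxC \<Gamma> = ctxC \<Gamma>'"
proof -
  have "ctxC \<Sigma> = foldr (\<lambda>A X. tyC A \<boxtimes> X) (map snd \<Sigma>) (unit \<C>)" for \<Sigma>
    by (induction \<Sigma>) simp_all
  then show ?thesis
    using assms by simp
qed

lemma join_cong:
  assumes "ctxC \<Sigma> = ctxC \<Sigma>'"
  shows "map snd \<Gamma> = map snd \<Gamma>' \<Longrightarrow> join \<Gamma> \<Sigma> = join \<Gamma>' \<Sigma>'"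
proof (induction \<Gamma> arbitrary: \<Gamma>')
  case Nil
  then show ?case using assms by simp
next
  case (Cons a \<Gamma>)
  obtain b \<Gamma>'' where \<Gamma>': "\<Gamma>' = b # \<Gamma>''" "snd a = snd b" "map snd \<Gamma> = map snd \<Gamma>''"
    using Cons.prems by (cases \<Gamma>') simp_all
  show ?case
    using Cons.IH[OF \<Gamma>'(3)] ctxC_cong[OF \<Gamma>'(3)] assms \<Gamma>'(1,2) by simp
qed

lemma ext_cong: "map snd \<Gamma> = map snd \<Gamma>' \<Longrightarrow> ext \<Gamma> A = ext \<Gamma>' A"
  using ctxC_cong[of \<Gamma> \<Gamma>'] join_cong[of "[(0, A)]" "[(0, A)]" \<Gamma> \<Gamma>'] by (simp add: ext_def)

lemma map_snd_shift [simp]: "map snd (shift \<Gamma>) = map snd \<Gamma>"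
  by (simp add: shift_def case_prod_beta)

lemma ctxC_shift [simp]:
  "ctxC (shift \<Gamma>) = ctxC \<Gamma>" "ctxC (shift \<Gamma> @ [(x, A)]) = ctxC (\<Gamma> @ [(0, A)])"
  "ctxC (shift (shift \<Gamma>) @ [(x, A), (y, B)]) = ctxC (\<Gamma> @ [(1, A), (0, B)])"
  by (rule ctxC_cong; simp)+

text \<open>Semantic values: points that come from \<open>\<V>\<close>, up to the coherence map
  \<open>i\<close>. A general point of \<open>\<C>\<close> stands for a computation.\<close>

definition Lpoint :: "'ac \<Rightarrow> 'ov \<Rightarrow> 'ac \<Rightarrow> bool" where
  "Lpoint i X f \<longleftrightarrow> (\<exists>g\<in>hom \<V> (unit \<V>) X. f = i \<bullet> far L g \<bullet> mun L)"

text \<open>Semantic values of non-linear types: coming from \<open>\<B>\<close>, they can be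
  discarded, copied and boxed.\<close>

definition Fpoint :: "'ac \<Rightarrow> 'ob \<Rightarrow> 'ac \<Rightarrow> bool" where
  "Fpoint i X f \<longleftrightarrow> (\<exists>g\<in>hom \<B> (term_ob \<B>) X. f = i \<bullet> far F g \<bullet> mun F)"

lemma Lpoint_unit: "Lpoint (invC (mun L)) (unit \<V>) (idC (unit \<C>))"
  unfolding Lpoint_def by (rule bexI[of _ "ide \<V> (unit \<V>)"]) simp_all

lemma Fpoint_unit: "Fpoint (invC (mun F)) (term_ob \<B>) (idC (unit \<C>))"
  unfolding Fpoint_def by (rule bexI[of _ "ide \<B> (term_ob \<B>)"]) simp_all

lemma Lpoint_pt:
  assumes "Lpoint i X f" "Lpoint j Y g" "i \<in> hom \<C> (fob L X) X'" "j \<in> hom \<C> (fob L Y) Y'"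
  shows "Lpoint ((i \<otimes> j) \<bullet> invC (mlt L X Y)) (X \<boxtimes>\<^bsub>\<V>\<^esub> Y) (pt \<C> f g)"
proof -
  obtain f' g' where f: "f' \<in> hom \<V> (unit \<V>) X" "f = i \<bullet> far L f' \<bullet> mun L"
    and g: "g' \<in> hom \<V> (unit \<V>) Y" "g = j \<bullet> far L g' \<bullet> mun L"
    using assms unfolding Lpoint_def by blast
  have o: "X \<in> obj \<V>" "Y \<in> obj \<V>" using f g by auto
  have "((i \<otimes> j) \<bullet> invC (mlt L X Y)) \<bullet> far L (pt \<V> f' g') \<bullet> mun L = pt \<C> f g"
    using f g o assms LR.far_pt[of f' X g' Y] by simp
  then show ?thesis
    unfolding Lpoint_def using f g by (intro bexI[of _ "pt \<V> f' g'"]) simp_all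
qed

lemma Fpoint_pt:
  assumes "Fpoint i X f" "Fpoint j Y g" "i \<in> hom \<C> (fob F X) X'" "j \<in> hom \<C> (fob F Y) Y'"
  shows "Fpoint ((i \<otimes> j) \<bullet> invC (mlt F X Y)) (prd \<B> X Y) (pt \<C> f g)"
proof -
  obtain f' g' where f: "f' \<in> hom \<B> (term_ob \<B>) X" "f = i \<bullet> far F f' \<bullet> mun F"
    and g: "g' \<in> hom \<B> (term_ob \<B>) Y" "g = j \<bullet> far F g' \<bullet> mun F"
    using assms unfolding Fpoint_def by blast
  have o: "X \<in> obj \<B>" "Y \<in> obj \<B>" using f g by auto
  have "((i \<otimes> j) \<bullet> invC (mlt F X Y)) \<bullet> far F (pair \<B> f' g') \<bullet> mun F = pt \<C> f g"
    using f g o assms F_pair[of f' X g' Y] by simp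
  then show ?thesis
    unfolding Fpoint_def using f g by (intro bexI[of _ "pair \<B> f' g'"]) simp_all
qed

text \<open>\<open>F\<close> is \<open>L\<close> after \<open>J\<close>. The coherence map
  \<open>i\<close> stays the same, which fits the intended use at \<open>TBang\<close>, where
  \<open>isoL\<close> and \<open>isoF\<close> coincide.\<close>

lemma Fpoint_imp_Lpoint:
  assumes "Fpoint i X f"
  shows "Lpoint i (fob J X) f"
proof -
  obtain g where g: "g \<in> hom \<B> (term_ob \<B>) X" "f = i \<bullet> far F g \<bullet> mun F"
    using assms unfolding Fpoint_def by blast
  have m: "mun J \<in> arr \<V>" "src \<V> (mun J) = unit \<V>" "tgt \<V> (mun J) = fob J (term_ob \<B>)"
    using JK.mun_simps by simp_all
  show ?thesis
    unfolding Lpoint_def using g m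
    by (intro bexI[of _ "far J g \<cdot>\<^bsub>\<V>\<^esub> mun J"]) (simp_all add: F_simps)
qed

text \<open>The inverse of the comparison map inside \<open>isoL\<close> carries the image of an
  injection of \<open>\<V>\<close> to the injection of \<open>\<C>\<close>.\<close>

lemma Lpoint_inj:
  shows "Lpoint (isoL A) (tyV A) f \<Longrightarrow> Lpoint (isoL (TSum A B)) (tyV (TSum A B)) (inj1 \<C> (tyC A) (tyC B) \<bullet> f)"
    "Lpoint (isoL B) (tyV B) f \<Longrightarrow> Lpoint (isoL (TSum A B)) (tyV (TSum A B)) (inj2 \<C> (tyC A) (tyC B) \<bullet> f)"
proof -
  let ?s = "sum_cmp \<V> \<C> L (tyV A) (tyV B)"
  show "Lpoint (isoL (TSum A B)) (tyV (TSum A B)) (inj1 \<C> (tyC A) (tyC B) \<bullet> f)"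
    if f: "Lpoint (isoL A) (tyV A) f"
  proof -
    obtain g where g: "g \<in> hom \<V> (unit \<V>) (tyV A)" "f = isoL A \<bullet> far L g \<bullet> mun L"
      using f unfolding Lpoint_def by blast
    have c: "invC ?s \<bullet> far L (inj1 \<V> (tyV A) (tyV B)) = inj1 \<C> (fob L (tyV A)) (fob L (tyV B))"
      by (simp del: LR.sum_cmp_simps(4,5) add: LR.sum_cmp_simps(4,5)[symmetric])
    have "invC ?s \<bullet> far L (inj1 \<V> (tyV A) (tyV B)) \<bullet> far L g \<bullet> mun L =
        inj1 \<C> (fob L (tyV A)) (fob L (tyV B)) \<bullet> far L g \<bullet> mun L"
      by (rule CC.cmp_reassoc[OF c]) (use g in simp_all)
    then show ?thesis
      unfolding Lpoint_def using g
      by (intro bexI[of _ "inj1 \<V> (tyV A) (tyV B) \<cdot>\<^bsub>\<V>\<^esub> g"]) simp_all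
  qed
  show "Lpoint (isoL (TSum A B)) (tyV (TSum A B)) (inj2 \<C> (tyC A) (tyC B) \<bullet> f)"
    if f: "Lpoint (isoL B) (tyV B) f"
  proof -
    obtain g where g: "g \<in> hom \<V> (unit \<V>) (tyV B)" "f = isoL B \<bullet> far L g \<bullet> mun L"
      using f unfolding Lpoint_def by blast
    have c: "invC ?s \<bullet> far L (inj2 \<V> (tyV A) (tyV B)) = inj2 \<C> (fob L (tyV A)) (fob L (tyV B))"
      by (simp del: LR.sum_cmp_simps(4,5) add: LR.sum_cmp_simps(4,5)[symmetric])
    have "invC ?s \<bullet> far L (inj2 \<V> (tyV A) (tyV B)) \<bullet> far L g \<bullet> mun L =
        inj2 \<C> (fob L (tyV A)) (fob L (tyV B)) \<bullet> far L g \<bullet> mun L"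
      by (rule CC.cmp_reassoc[OF c]) (use g in simp_all)
    then show ?thesis
      unfolding Lpoint_def using g
      by (intro bexI[of _ "inj2 \<V> (tyV A) (tyV B) \<cdot>\<^bsub>\<V>\<^esub> g"]) simp_all
  qed
qed

lemma Fpoint_inj:
  assumes [simp]: "nonlinear A" "nonlinear B"
  shows "Fpoint (isoF A) (tyB A) f \<Longrightarrow> Fpoint (isoF (TSum A B)) (tyB (TSum A B)) (inj1 \<C> (tyC A) (tyC B) \<bullet> f)"
    "Fpoint (isoF B) (tyB B) f \<Longrightarrow> Fpoint (isoF (TSum A B)) (tyB (TSum A B)) (inj2 \<C> (tyC A) (tyC B) \<bullet> f)"
proof -
  let ?s = "sum_cmp \<B> \<C> F (tyB A) (tyB B)"
  show "Fpoint (isoF (TSum A B)) (tyB (TSum A B)) (inj1 \<C> (tyC A) (tyC B) \<bullet> f)"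
    if f: "Fpoint (isoF A) (tyB A) f"
  proof -
    obtain g where g: "g \<in> hom \<B> (term_ob \<B>) (tyB A)" "f = isoF A \<bullet> far F g \<bullet> mun F"
      using f unfolding Fpoint_def by blast
    have c: "invC ?s \<bullet> far F (inj1 \<B> (tyB A) (tyB B)) = inj1 \<C> (fob F (tyB A)) (fob F (tyB B))"
      by (simp del: FG.sum_cmp_simps(4,5) add: FG.sum_cmp_simps(4,5)[symmetric])
    have "invC ?s \<bullet> far F (inj1 \<B> (tyB A) (tyB B)) \<bullet> far F g \<bullet> mun F =
        inj1 \<C> (fob F (tyB A)) (fob F (tyB B)) \<bullet> far F g \<bullet> mun F"
      by (rule CC.cmp_reassoc[OF c]) (use g in simp_all)
    then show ?thesis
      unfolding Fpoint_def using g
      by (intro bexI[of _ "inj1 \<B> (tyB A) (tyB B) \<cdot>\<^bsub>\<B>\<^esub> g"]) simp_all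
  qed
  show "Fpoint (isoF (TSum A B)) (tyB (TSum A B)) (inj2 \<C> (tyC A) (tyC B) \<bullet> f)"
    if f: "Fpoint (isoF B) (tyB B) f"
  proof -
    obtain g where g: "g \<in> hom \<B> (term_ob \<B>) (tyB B)" "f = isoF B \<bullet> far F g \<bullet> mun F"
      using f unfolding Fpoint_def by blast
    have c: "invC ?s \<bullet> far F (inj2 \<B> (tyB A) (tyB B)) = inj2 \<C> (fob F (tyB A)) (fob F (tyB B))"
      by (simp del: FG.sum_cmp_simps(4,5) add: FG.sum_cmp_simps(4,5)[symmetric])
    have "invC ?s \<bullet> far F (inj2 \<B> (tyB A) (tyB B)) \<bullet> far F g \<bullet> mun F =
        inj2 \<C> (fob F (tyB A)) (fob F (tyB B)) \<bullet> far F g \<bullet> mun F"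
      by (rule CC.cmp_reassoc[OF c]) (use g in simp_all)
    then show ?thesis
      unfolding Fpoint_def using g
      by (intro bexI[of _ "inj2 \<B> (tyB A) (tyB B) \<cdot>\<^bsub>\<B>\<^esub> g"]) simp_all
  qed
qed

text \<open>Points are looked up by variable name, so one assignment \<rho> serves every context:
  splitting and exchange leave \<rho> unchanged, and a binder extends it by
  \<open>case_nat\<close>.\<close>

primrec env :: "(nat \<Rightarrow> 'ac) \<Rightarrow> ctx \<Rightarrow> 'ac" where
  "env \<rho> [] = idC (unit \<C>)"
| "env \<rho> (xA # \<Gamma>) = pt \<C> (\<rho> (fst xA)) (env \<rho> \<Gamma>)"

definition points :: "(nat \<Rightarrow> 'ac) \<Rightarrow> ctx \<Rightarrow> bool" where
  "points \<rho> \<Gamma> \<longleftrightarrow> (\<forall>(x, A)\<in>set \<Gamma>. \<rho> x \<in> hom \<C> (unit \<C>) (tyC A))"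

lemma points_simps [simp]:
  "points \<rho> []"
  "points \<rho> (xA # \<Gamma>) \<longleftrightarrow> \<rho> (fst xA) \<in> hom \<C> (unit \<C>) (tyC (snd xA)) \<and> points \<rho> \<Gamma>"
  "points \<rho> (\<Gamma> @ \<Sigma>) \<longleftrightarrow> points \<rho> \<Gamma> \<and> points \<rho> \<Sigma>"
  "points (case_nat g \<rho>) (shift \<Gamma>) \<longleftrightarrow> points \<rho> \<Gamma>"
  by (auto simp: points_def shift_def case_prod_beta)

lemma env_simps' [simp]:
  assumes "points \<rho> \<Gamma>"
  shows "env \<rho> \<Gamma> \<in> arr \<C>" "src \<C> (env \<rho> \<Gamma>) = unit \<C>" "tgt \<C> (env \<rho> \<Gamma>) = ctxC \<Gamma>"
proof -
  have "env \<rho> \<Gamma> \<in> hom \<C> (unit \<C>) (ctxC \<Gamma>)"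
    using assms by (induction \<Gamma>) simp_all
  then show "env \<rho> \<Gamma> \<in> arr \<C>" "src \<C> (env \<rho> \<Gamma>) = unit \<C>" "tgt \<C> (env \<rho> \<Gamma>) = ctxC \<Gamma>"
    by simp_all
qed

lemma env_shift [simp]: "env (case_nat g \<rho>) (shift \<Gamma>) = env \<rho> \<Gamma>"
  by (induction \<Gamma>) (auto simp: shift_def)

lemma join_env [simp]:
  "points \<rho> \<Gamma> \<Longrightarrow> points \<rho> \<Sigma> \<Longrightarrow> join \<Gamma> \<Sigma> \<bullet> env \<rho> (\<Gamma> @ \<Sigma>) = pt \<C> (env \<rho> \<Gamma>) (env \<rho> \<Sigma>)"
  by (induction \<Gamma>) (simp_all add: CM.inv_lun_cmp)

lemma inv_join_env [simp]:
  assumes "points \<rho> \<Gamma>" "points \<rho> \<Sigma>"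
  shows "invC (join \<Gamma> \<Sigma>) \<bullet> pt \<C> (env \<rho> \<Gamma>) (env \<rho> \<Sigma>) = env \<rho> (\<Gamma> @ \<Sigma>)"
  using CC.inv_cancel(1)[of "join \<Gamma> \<Sigma>" "env \<rho> (\<Gamma> @ \<Sigma>)"] assms by simp

lemma ext_env [simp]:
  assumes "points \<rho> \<Gamma>" "\<rho> x \<in> hom \<C> (unit \<C>) (tyC A)"
  shows "ext \<Gamma> A \<bullet> env \<rho> (\<Gamma> @ [(x, A)]) = pt \<C> (env \<rho> \<Gamma>) (\<rho> x)"
proof -
  have j: "join \<Gamma> [(0, A)] = join \<Gamma> [(x, A)]"
    by (rule join_cong) simp_all
  have "ctxC (\<Gamma> @ [(0, A)]) = ctxC (\<Gamma> @ [(x, A)])"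
    by (rule ctxC_cong) simp
  then show ?thesis
    unfolding ext_def using assms by (simp add: j)
qed

lemma inv_ext_env:
  assumes "points \<rho> \<Gamma>" "g \<in> hom \<C> (unit \<C>) (tyC A)"
  shows "invC (ext \<Gamma> A) \<bullet> pt \<C> (env \<rho> \<Gamma>) g = env (case_nat g \<rho>) (shift \<Gamma> @ [(0, A)])"
proof -
  have e: "ext \<Gamma> A = ext (shift \<Gamma>) A"
    by (rule ext_cong) simp
  have "ext (shift \<Gamma>) A \<bullet> env (case_nat g \<rho>) (shift \<Gamma> @ [(0, A)]) = pt \<C> (env \<rho> \<Gamma>) g"
    using ext_env[of "case_nat g \<rho>" "shift \<Gamma>" 0 A] assms by simp
  then have "invC (ext \<Gamma> A) \<bullet> pt \<C> (env \<rho> \<Gamma>) g =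
      invC (ext \<Gamma> A) \<bullet> ext \<Gamma> A \<bullet> env (case_nat g \<rho>) (shift \<Gamma> @ [(0, A)])"
    by (simp only: e)
  then show ?thesis
    using assms by simp
qed

lemma exchange_env:
  assumes "points \<rho> (\<Gamma> @ [(x, A), (y, B)] @ \<Sigma>)"
  shows "exchange \<Gamma> A B \<Sigma> \<bullet> env \<rho> (\<Gamma> @ [(y, B), (x, A)] @ \<Sigma>) = env \<rho> (\<Gamma> @ [(x, A), (y, B)] @ \<Sigma>)"
  using assms
proof (induction \<Gamma>)
  case Nil
  then show ?case by simp
next
  case (Cons a \<Gamma>)
  then show ?case
    using exchange_hom[of \<Gamma> A B \<Sigma> y x] by simp
qed

section \<open>Environments of values and the structural maps\<close>

definition Fenv :: "(nat \<Rightarrow> 'ac) \<Rightarrow> ctx \<Rightarrow> bool" where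
  "Fenv \<rho> \<Phi> \<longleftrightarrow> (\<forall>(x, A)\<in>set \<Phi>. Fpoint (isoF A) (tyB A) (\<rho> x))"

definition Lenv :: "(nat \<Rightarrow> 'ac) \<Rightarrow> ctx \<Rightarrow> bool" where
  "Lenv \<rho> \<Gamma> \<longleftrightarrow> (\<forall>(x, A)\<in>set \<Gamma>. Lpoint (isoL A) (tyV A) (\<rho> x))"

lemma Fpoint_env: "nonlinear_ctx \<Phi> \<Longrightarrow> Fenv \<rho> \<Phi> \<Longrightarrow> Fpoint (ctx_isoF \<Phi>) (ctxB \<Phi>) (env \<rho> \<Phi>)"
proof (induction \<Phi>)
  case Nil
  then show ?case by (simp add: Fpoint_unit)
next
  case (Cons a \<Phi>)
  have "Fpoint (isoF (snd a)) (tyB (snd a)) (\<rho> (fst a))" "Fpoint (ctx_isoF \<Phi>) (ctxB \<Phi>) (env \<rho> \<Phi>)"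
    using Cons by (auto simp: Fenv_def case_prod_beta)
  then show ?case
    using Fpoint_pt[of "isoF (snd a)" "tyB (snd a)" "\<rho> (fst a)" "ctx_isoF \<Phi>" "ctxB \<Phi>" "env \<rho> \<Phi>"] Cons.prems
    by simp
qed

lemma Lpoint_env: "Lenv \<rho> \<Gamma> \<Longrightarrow> Lpoint (ctx_isoL \<Gamma>) (ctxV \<Gamma>) (env \<rho> \<Gamma>)"
proof (induction \<Gamma>)
  case Nil
  then show ?case by (simp add: Lpoint_unit)
next
  case (Cons a \<Gamma>)
  have "Lpoint (isoL (snd a)) (tyV (snd a)) (\<rho> (fst a))" "Lpoint (ctx_isoL \<Gamma>) (ctxV \<Gamma>) (env \<rho> \<Gamma>)"
    using Cons by (auto simp: Lenv_def case_prod_beta)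
  then show ?case
    using Lpoint_pt[of "isoL (snd a)" "tyV (snd a)" "\<rho> (fst a)" "ctx_isoL \<Gamma>" "ctxV \<Gamma>" "env \<rho> \<Gamma>"]
    by simp
qed

text \<open>The environment comes from a map out of the terminal object of \<open>\<B>\<close>;
  followed by the map back it is the identity by terminality, and the coherence maps cancel.\<close>

lemma discard_env:
  assumes "nonlinear_ctx \<Phi>" "Fenv \<rho> \<Phi>"
  shows "discard \<Phi> \<bullet> env \<rho> \<Phi> = idC (unit \<C>)"
proof -
  obtain g where g: "g \<in> hom \<B> (term_ob \<B>) (ctxB \<Phi>)" "env \<rho> \<Phi> = ctx_isoF \<Phi> \<bullet> far F g \<bullet> mun F"
    using Fpoint_env[OF assms] unfolding Fpoint_def by blast
  let ?t = "the_arr \<B> (ctxB \<Phi>) (term_ob \<B>)"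
  have t: "?t \<cdot>\<^bsub>\<B>\<^esub> g = ide \<B> (term_ob \<B>)"
    by (rule BB.terminal_ext[OF BB.one_terminal]) (use g assms in simp_all)
  have "far F ?t \<bullet> far F g \<bullet> mun F = far F (?t \<cdot>\<^bsub>\<B>\<^esub> g) \<bullet> mun F"
    using g assms by simp
  then show ?thesis
    using g assms by (simp add: discard_def t)
qed

lemma affine_discard_env:
  assumes "terminal \<V> (unit \<V>)" "Lenv \<rho> \<Gamma>"
  shows "affine_discard \<Gamma> \<bullet> env \<rho> \<Gamma> = idC (unit \<C>)"
proof -
  obtain g where g: "g \<in> hom \<V> (unit \<V>) (ctxV \<Gamma>)" "env \<rho> \<Gamma> = ctx_isoL \<Gamma> \<bullet> far L g \<bullet> mun L"
    using Lpoint_env[OF assms(2)] unfolding Lpoint_def by blast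
  let ?t = "the_arr \<V> (ctxV \<Gamma>) (unit \<V>)"
  have t: "?t \<cdot>\<^bsub>\<V>\<^esub> g = ide \<V> (unit \<V>)"
    by (rule VV.terminal_ext[OF assms(1)]) (use g assms in simp_all)
  have "far L ?t \<bullet> far L g \<bullet> mun L = far L (?t \<cdot>\<^bsub>\<V>\<^esub> g) \<bullet> mun L"
    using g assms by simp
  then show ?thesis
    using g assms by (simp add: affine_discard_def t)
qed

text \<open>In \<open>\<B>\<close> a map followed by the diagonal is its pairing with itself, and
  \<open>F_pair\<close> carries this across \<open>F\<close>.\<close>

lemma duplicate_env:
  assumes "nonlinear_ctx \<Phi>" "Fenv \<rho> \<Phi>"
  shows "duplicate \<Phi> \<bullet> env \<rho> \<Phi> = pt \<C> (env \<rho> \<Phi>) (env \<rho> \<Phi>)"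
proof -
  obtain g where g: "g \<in> hom \<B> (term_ob \<B>) (ctxB \<Phi>)" "env \<rho> \<Phi> = ctx_isoF \<Phi> \<bullet> far F g \<bullet> mun F"
    using Fpoint_env[OF assms] unfolding Fpoint_def by blast
  let ?d = "pair \<B> (ide \<B> (ctxB \<Phi>)) (ide \<B> (ctxB \<Phi>))"
  have "far F ?d \<bullet> far F g \<bullet> mun F = far F (?d \<cdot>\<^bsub>\<B>\<^esub> g) \<bullet> mun F"
    using g assms by simp
  also have "\<dots> = mlt F (ctxB \<Phi>) (ctxB \<Phi>) \<bullet> pt \<C> (far F g \<bullet> mun F) (far F g \<bullet> mun F)"
    using g F_pair[of g "ctxB \<Phi>" g "ctxB \<Phi>"] BB.pair_ide_cmp[of g "ctxB \<Phi>"] by simp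
  finally show ?thesis
    using g assms by (simp add: duplicate_def)
qed

text \<open>The value \<open>lift\<close> of a computation \<open>g : I \<rightarrow> \<lbrakk>A\<rbrakk>\<close>.\<close>

definition promote :: "'ac \<Rightarrow> 'ac" where
  "promote g = bang g \<bullet> box []"

lemma promote_simps [simp]:
  assumes "g \<in> arr \<C>" "src \<C> g = unit \<C>"
  shows "promote g \<in> arr \<C>" "src \<C> (promote g) = unit \<C>" "tgt \<C> (promote g) = bang_ob (tgt \<C> g)"
  using assms by (simp_all add: promote_def)

text \<open>Naturality of the unit \<open>etaFG\<close> at the map of \<open>\<B>\<close> behind the
  environment; this is why the environment has to come from \<open>\<B>\<close>.\<close>

lemma box_env:
  assumes "nonlinear_ctx \<Phi>" "Fenv \<rho> \<Phi>"
  shows "box \<Phi> \<bullet> env \<rho> \<Phi> = promote (env \<rho> \<Phi>)"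
proof -
  obtain g where g: "g \<in> hom \<B> (term_ob \<B>) (ctxB \<Phi>)" "env \<rho> \<Phi> = ctx_isoF \<Phi> \<bullet> far F g \<bullet> mun F"
    using Fpoint_env[OF assms] unfolding Fpoint_def by blast
  let ?i = "ctx_isoF \<Phi>"
  have "box \<Phi> \<bullet> env \<rho> \<Phi> = bang ?i \<bullet> far F (etaFG (ctxB \<Phi>) \<cdot>\<^bsub>\<B>\<^esub> g) \<bullet> mun F"
    using g assms by (simp add: box_def bang_ob_def)
  also have "etaFG (ctxB \<Phi>) \<cdot>\<^bsub>\<B>\<^esub> g = far G (far F g) \<cdot>\<^bsub>\<B>\<^esub> etaFG (term_ob \<B>)"
    using g FG.eta_natural'[of g] by simp
  also have "bang ?i \<bullet> far F (far G (far F g) \<cdot>\<^bsub>\<B>\<^esub> etaFG (term_ob \<B>)) \<bullet> mun F =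
      bang ?i \<bullet> bang (far F g) \<bullet> far F (etaFG (term_ob \<B>)) \<bullet> mun F"
    using g assms by (simp add: bang_def)
  \<comment> \<open>\<open>promote\<close> contains \<open>box []\<close>, whose coherence map is
    \<open>invC (mun F)\<close>; inserting the inverse pair produces it.\<close>
  also have "\<dots> = bang ?i \<bullet> bang (far F g) \<bullet> bang (mun F) \<bullet> bang (invC (mun F)) \<bullet> far F (etaFG (term_ob \<B>)) \<bullet> mun F"
  proof -
    have "bang (mun F) \<bullet> bang (invC (mun F)) = idC (bang_ob (fob F (term_ob \<B>)))"
      by (simp add: bang_cmp[symmetric]) (simp add: bang_def bang_ob_def)
    then have "bang (mun F) \<bullet> bang (invC (mun F)) \<bullet> far F (etaFG (term_ob \<B>)) \<bullet> mun F =
        idC (bang_ob (fob F (term_ob \<B>))) \<bullet> far F (etaFG (term_ob \<B>)) \<bullet> mun F"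
      by (rule CC.cmp_reassoc) (simp_all add: bang_ob_def)
    then show ?thesis
      by (simp add: bang_ob_def)
  qed
  also have "\<dots> = promote (env \<rho> \<Phi>)"
    using g assms by (simp add: promote_def box_def bang_cmp bang_ob_def)
  finally show ?thesis .
qed

text \<open>Whatever the computation \<open>g\<close>, up to \<open>mun F\<close> its promotion is
  \<open>F\<close> applied to a transpose of \<open>g\<close>. This makes \<open>Lift\<close> of an
  arbitrary term a value.\<close>

lemma Fpoint_promote:
  assumes "g \<in> hom \<C> (unit \<C>) (tyC A)"
  shows "Fpoint (isoF (TBang A)) (tyB (TBang A)) (promote g)"
proof -
  have "promote g = far F (far G g \<cdot>\<^bsub>\<B>\<^esub> far G (invC (mun F)) \<cdot>\<^bsub>\<B>\<^esub> etaFG (term_ob \<B>)) \<bullet> mun F"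
    using assms by (simp add: promote_def box_def bang_def bang_ob_def)
  then show ?thesis
    unfolding Fpoint_def using assms
    by (intro bexI[of _ "far G g \<cdot>\<^bsub>\<B>\<^esub> far G (invC (mun F)) \<cdot>\<^bsub>\<B>\<^esub> etaFG (term_ob \<B>)"])
      (simp_all add: bang_ob_def)
qed

text \<open>Forcing a lifted computation gives it back: the counit slides past \<open>g\<close> and
  past \<open>invC (mun F)\<close> by naturality, and a triangle identity removes the rest.\<close>

lemma eps_promote:
  assumes "g \<in> hom \<C> (unit \<C>) X"
  shows "epsFG X \<bullet> promote g = g"
proof -
  have o: "X \<in> obj \<C>" using assms by auto
  have n: "epsFG (tgt \<C> f) \<bullet> bang f \<bullet> x = f \<bullet> epsFG (src \<C> f) \<bullet> x"
    if "f \<in> arr \<C>" "x \<in> arr \<C>" "tgt \<C> x = bang_ob (src \<C> f)" for f x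
    using FG.eps_natural_cmp[of f x] that by (simp add: bang_def bang_ob_def)
  have "epsFG X \<bullet> promote g = g \<bullet> epsFG (unit \<C>) \<bullet> bang (invC (mun F)) \<bullet> far F (etaFG (term_ob \<B>)) \<bullet> mun F"
    using n[of g "box []"] assms o by (simp add: promote_def) (simp add: box_def)
  also have "\<dots> = g \<bullet> invC (mun F) \<bullet> epsFG (fob F (term_ob \<B>)) \<bullet> far F (etaFG (term_ob \<B>)) \<bullet> mun F"
    using n[of "invC (mun F)" "far F (etaFG (term_ob \<B>)) \<bullet> mun F"] by (simp add: bang_ob_def)
  also have "epsFG (fob F (term_ob \<B>)) \<bullet> far F (etaFG (term_ob \<B>)) \<bullet> mun F = ide \<C> (fob F (term_ob \<B>)) \<bullet> mun F"
    by (rule CC.cmp_reassoc[OF FG.triangle_left]) simp_all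
  finally show ?thesis
    using assms by simp
qed

lemma middle_swap_pt [simp]:
  assumes "a \<in> hom \<C> (unit \<C>) X" "b \<in> hom \<C> (unit \<C>) Y" "c \<in> hom \<C> (unit \<C>) Z" "d \<in> hom \<C> (unit \<C>) W"
  shows "middle_swap X Y Z W \<bullet> pt \<C> (pt \<C> a b) (pt \<C> c d) = pt \<C> (pt \<C> a c) (pt \<C> b d)"
proof -
  have "X \<in> obj \<C>" "Y \<in> obj \<C>" "Z \<in> obj \<C>" "W \<in> obj \<C>"
    using assms by auto
  then show ?thesis
    using assms by (simp add: middle_swap_def)
qed

lemma ctx_split_env:
  assumes "nonlinear_ctx \<Phi>" "Fenv \<rho> \<Phi>" "points \<rho> (\<Phi> @ \<Gamma> @ \<Sigma>)"
  shows "ctx_split \<Phi> \<Gamma> \<Sigma> \<bullet> env \<rho> (\<Phi> @ \<Gamma> @ \<Sigma>) = pt \<C> (env \<rho> (\<Phi> @ \<Gamma>)) (env \<rho> (\<Phi> @ \<Sigma>))"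
  using assms by (simp add: ctx_split_def duplicate_env)

end

section \<open>Application, distributivity and recursion\<close>

context lambda_l_model
begin

section \<open>Currying and evaluation at points\<close>

lemma lolli_adjunction: "coproduct_adjunction \<V> \<C> (L_tensor (tyV A)) (lolli M (tyV A)) (coev M (tyV A)) (evl M (tyV A))"
  by (rule L_tensor_adjunction) simp

lemma L_tensor_simps [simp]:
  "fob (L_tensor A) X = fob L (X \<boxtimes>\<^bsub>\<V>\<^esub> A)" "far (L_tensor A) f = far L (f \<otimes>\<^bsub>\<V>\<^esub> ide \<V> A)"
  by (simp_all add: L_tensor_def)

lemma curry_simps [simp]:
  assumes "X \<in> obj \<V>" "f \<in> arr \<C>" "src \<C> f = fob L (X \<boxtimes>\<^bsub>\<V>\<^esub> tyV A)"
  shows "curry (tyV A) X f \<in> arr \<V>" "src \<V> (curry (tyV A) X f) = X"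
    "tgt \<V> (curry (tyV A) X f) = fob (lolli M (tyV A)) (tgt \<C> f)"
proof -
  interpret A: coproduct_adjunction \<V> \<C> "L_tensor (tyV A)" "lolli M (tyV A)" "coev M (tyV A)" "evl M (tyV A)"
    by (rule lolli_adjunction)
  show "curry (tyV A) X f \<in> arr \<V>" "src \<V> (curry (tyV A) X f) = X"
    "tgt \<V> (curry (tyV A) X f) = fob (lolli M (tyV A)) (tgt \<C> f)"
    using assms by (simp_all add: curry_def)
qed

lemma evl_curry:
  assumes "X \<in> obj \<V>" "f \<in> hom \<C> (fob L (X \<boxtimes>\<^bsub>\<V>\<^esub> tyV A)) B"
  shows "evl M (tyV A) B \<bullet> far L (curry (tyV A) X f \<otimes>\<^bsub>\<V>\<^esub> ide \<V> (tyV A)) = f"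
proof -
  interpret A: coproduct_adjunction \<V> \<C> "L_tensor (tyV A)" "lolli M (tyV A)" "coev M (tyV A)" "evl M (tyV A)"
    by (rule lolli_adjunction)
  show ?thesis
    using A.transpose_transpose[of f X] assms unfolding curry_def L_tensor_simps by simp
qed

lemma evl_simps [simp]:
  assumes "B \<in> obj \<C>"
  shows "evl M (tyV A) B \<in> arr \<C>"
    "src \<C> (evl M (tyV A) B) = fob L (fob (lolli M (tyV A)) B \<boxtimes>\<^bsub>\<V>\<^esub> tyV A)"
    "tgt \<C> (evl M (tyV A) B) = B"
proof -
  interpret A: coproduct_adjunction \<V> \<C> "L_tensor (tyV A)" "lolli M (tyV A)" "coev M (tyV A)" "evl M (tyV A)"
    by (rule lolli_adjunction)
  show "evl M (tyV A) B \<in> arr \<C>"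
    "src \<C> (evl M (tyV A) B) = fob L (fob (lolli M (tyV A)) B \<boxtimes>\<^bsub>\<V>\<^esub> tyV A)"
    "tgt \<C> (evl M (tyV A) B) = B"
    using assms by simp_all
qed

definition app :: "ty \<Rightarrow> ty \<Rightarrow> 'ac \<Rightarrow> 'ac \<Rightarrow> 'ac" where
  "app A B f g = evl M (tyV A) (tyC B) \<bullet> mlt L (tyV (TLolli A B)) (tyV A) \<bullet> pt \<C> f (invC (isoL A) \<bullet> g)"

text \<open>The beta law at points. Naturality of \<open>mlt L\<close> turns the tensor of
  \<open>L\<close> of the curried map with an identity into \<open>L\<close> of a tensor, where
  \<open>evl_curry\<close> applies.\<close>

lemma app_lam:
  assumes d: "den d \<in> hom \<C> (ctxC (\<Gamma> @ [(0, A)])) (tyC B)"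
    and e: "e \<in> hom \<C> (unit \<C>) (ctxC \<Gamma>)" and g: "g \<in> hom \<C> (unit \<C>) (tyC A)"
  shows "app A B (den (DLam \<Gamma> A B d) \<bullet> e) g = den d \<bullet> invC (ext \<Gamma> A) \<bullet> pt \<C> e g"
proof -
  let ?h = "den d \<bullet> invC (ext \<Gamma> A) \<bullet> (ctx_isoL \<Gamma> \<otimes> isoL A) \<bullet> invC (mlt L (ctxV \<Gamma>) (tyV A))"
  let ?c = "curry (tyV A) (ctxV \<Gamma>) ?h"
  let ?p = "pt \<C> (invC (ctx_isoL \<Gamma>) \<bullet> e) (invC (isoL A) \<bullet> g)"
  have c: "?c \<in> arr \<V>" "src \<V> ?c = ctxV \<Gamma>" "tgt \<V> ?c = fob (lolli M (tyV A)) (tyC B)"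
    using d by simp_all
  have "app A B (den (DLam \<Gamma> A B d) \<bullet> e) g = evl M (tyV A) (tyC B) \<bullet>
      mlt L (fob (lolli M (tyV A)) (tyC B)) (tyV A) \<bullet> (far L ?c \<otimes> far L (ide \<V> (tyV A))) \<bullet> ?p"
    using c e g by (simp add: app_def)
  also have "mlt L (fob (lolli M (tyV A)) (tyC B)) (tyV A) \<bullet> (far L ?c \<otimes> far L (ide \<V> (tyV A))) \<bullet> ?p =
      (far L (?c \<otimes>\<^bsub>\<V>\<^esub> ide \<V> (tyV A)) \<bullet> mlt L (ctxV \<Gamma>) (tyV A)) \<bullet> ?p"
    by (rule CC.cmp_reassoc) (use LR.mlt_natural'[of ?c "ide \<V> (tyV A)"] c e g in simp_all)
  also have "evl M (tyV A) (tyC B) \<bullet> (far L (?c \<otimes>\<^bsub>\<V>\<^esub> ide \<V> (tyV A)) \<bullet> mlt L (ctxV \<Gamma>) (tyV A)) \<bullet> ?p =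
      evl M (tyV A) (tyC B) \<bullet> far L (?c \<otimes>\<^bsub>\<V>\<^esub> ide \<V> (tyV A)) \<bullet> mlt L (ctxV \<Gamma>) (tyV A) \<bullet> ?p"
    using c e g by simp
  also have "\<dots> = ?h \<bullet> mlt L (ctxV \<Gamma>) (tyV A) \<bullet> ?p"
    by (rule CC.cmp_reassoc[OF evl_curry]) (use c d e g in simp_all)
  also have "\<dots> = den d \<bullet> invC (ext \<Gamma> A) \<bullet> pt \<C> e g"
    using d e g by simp
  finally show ?thesis .
qed

text \<open>Distributivity is not an axiom on \<open>\<C>\<close>. But the objects in question come
  from \<open>\<V>\<close>, and tensoring with \<open>Y'\<close> followed by \<open>L\<close> is a
  left adjoint and preserves sums. Conjugating by \<open>y\<close>, \<open>a\<close>,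
  \<open>b\<close> and the symmetry transfers this to \<open>\<C>\<close>.\<close>

lemma iso_distributor:
  assumes y: "iso \<C> y" "src \<C> y = fob L Y'" "tgt \<C> y = Y" "Y' \<in> obj \<V>"
    and a: "iso \<C> a" "src \<C> a = fob L A'" "tgt \<C> a = A" "A' \<in> obj \<V>"
    and b: "iso \<C> b" "src \<C> b = fob L B'" "tgt \<C> b = B" "B' \<in> obj \<V>"
  shows "iso \<C> (copair \<C> (idC Y \<otimes> inj1 \<C> A B) (idC Y \<otimes> inj2 \<C> A B))"
proof -
  interpret T: coproduct_adjunction \<V> \<C> "L_tensor Y'" "lolli M Y'" "coev M Y'" "evl M Y'"
    by (rule L_tensor_adjunction) fact
  have o [simp]: "Y \<in> obj \<C>" "A \<in> obj \<C>" "B \<in> obj \<C>" "Y' \<in> obj \<V>" "A' \<in> obj \<V>" "B' \<in> obj \<V>"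
    using y a b CC.iso_arr CC.tgt_obj by blast+
  note [simp] = y(1-3) a(1-3) b(1-3) CC.iso_arr[OF y(1)] CC.iso_arr[OF a(1)] CC.iso_arr[OF b(1)]
  \<comment> \<open>\<phi> moves one summand into the image of \<open>L_tensor Y'\<close>, and
    \<theta> moves the tensor with the whole sum back. Between them stands the comparison map of
    \<open>L_tensor Y'\<close>, so the distributor becomes a composite of isos.\<close>
  define \<phi> where "\<phi> c C = mlt L C Y' \<bullet> (invC c \<otimes> invC y) \<bullet> symm \<C> Y (tgt \<C> c)" for c C
  define s where "s = sum_arr \<C> a b \<bullet> invC (sum_cmp \<V> \<C> L A' B')"
  define \<theta> where "\<theta> = symm \<C> (sum_ob \<C> A B) Y \<bullet> (s \<otimes> y) \<bullet> invC (mlt L (sum_ob \<V> A' B') Y')"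
  have \<phi> [simp]: "\<phi> c C \<in> arr \<C>" "iso \<C> (\<phi> c C)" "src \<C> (\<phi> c C) = Y \<boxtimes> tgt \<C> c"
    "tgt \<C> (\<phi> c C) = fob L (C \<boxtimes>\<^bsub>\<V>\<^esub> Y')"
    if "iso \<C> c" "src \<C> c = fob L C" "C \<in> obj \<V>" for c C
    using that CC.iso_arr[OF that(1)] CC.tgt_obj[of c] by (simp_all add: \<phi>_def)
  have s [simp]: "iso \<C> s" "s \<in> arr \<C>" "src \<C> s = fob L (sum_ob \<V> A' B')" "tgt \<C> s = sum_ob \<C> A B"
    by (simp_all add: s_def)
  have \<theta> [simp]: "iso \<C> \<theta>" "\<theta> \<in> arr \<C>" "src \<C> \<theta> = fob L (sum_ob \<V> A' B' \<boxtimes>\<^bsub>\<V>\<^esub> Y')"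
    "tgt \<C> \<theta> = Y \<boxtimes> sum_ob \<C> A B"
    by (simp_all add: \<theta>_def)
  have \<theta>_\<phi>: "\<theta> \<bullet> far L (j \<otimes>\<^bsub>\<V>\<^esub> ide \<V> Y') \<bullet> \<phi> c C = idC Y \<otimes> k"
    if c: "iso \<C> c" "src \<C> c = fob L C" "C \<in> obj \<V>"
      and j: "j \<in> hom \<V> C (sum_ob \<V> A' B')" and k: "k \<in> hom \<C> (tgt \<C> c) (sum_ob \<C> A B)"
      and s_j: "s \<bullet> far L j = k \<bullet> c" for c C j k
  proof -
    note [simp] = CC.iso_arr[OF c(1)]
    have [simp]: "tgt \<C> c \<in> obj \<C>" by simp
    let ?w = "(invC c \<otimes> invC y) \<bullet> symm \<C> Y (tgt \<C> c)"
    have "far L (j \<otimes>\<^bsub>\<V>\<^esub> ide \<V> Y') \<bullet> mlt L C Y' \<bullet> ?w =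
        (mlt L (sum_ob \<V> A' B') Y' \<bullet> (far L j \<otimes> far L (ide \<V> Y'))) \<bullet> ?w"
      by (rule CC.cmp_reassoc) (use LR.mlt_natural'[of j "ide \<V> Y'"] c j in simp_all)
    then have "\<theta> \<bullet> far L (j \<otimes>\<^bsub>\<V>\<^esub> ide \<V> Y') \<bullet> \<phi> c C =
        symm \<C> (sum_ob \<C> A B) Y \<bullet> (s \<otimes> y) \<bullet> (far L j \<otimes> far L (ide \<V> Y')) \<bullet> ?w"
      using c j by (simp add: \<theta>_def \<phi>_def)
    also have "(s \<otimes> y) \<bullet> (far L j \<otimes> far L (ide \<V> Y')) \<bullet> ?w = (k \<otimes> idC Y) \<bullet> symm \<C> Y (tgt \<C> c)"
    proof -
      have "s \<bullet> far L j \<bullet> invC c = (k \<bullet> c) \<bullet> invC c"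
        by (rule CC.cmp_reassoc[OF s_j]) (use c j in simp_all)
      then show ?thesis
        using c j k by (simp add: CM.tar_cmp_cmp)
    qed
    also have "symm \<C> (sum_ob \<C> A B) Y \<bullet> (k \<otimes> idC Y) \<bullet> symm \<C> Y (tgt \<C> c) =
        ((idC Y \<otimes> k) \<bullet> symm \<C> (tgt \<C> c) Y) \<bullet> symm \<C> Y (tgt \<C> c)"
      by (rule CC.cmp_reassoc[OF CM.sym_natural[of _ "tgt \<C> c" _ _ Y]]) (use k in simp_all)
    also have "\<dots> = idC Y \<otimes> k"
      using k by (simp add: CM.sym_sym)
    finally show ?thesis .
  qed
  have si: "s \<bullet> far L (inj1 \<V> A' B') = inj1 \<C> A B \<bullet> a" "s \<bullet> far L (inj2 \<V> A' B') = inj2 \<C> A B \<bullet> b"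
    by (simp_all add: s_def del: LR.sum_cmp_simps(4,5) add: LR.sum_cmp_simps(4,5)[symmetric])
  have "copair \<C> (idC Y \<otimes> inj1 \<C> A B) (idC Y \<otimes> inj2 \<C> A B) =
      \<theta> \<bullet> sum_cmp \<V> \<C> (L_tensor Y') A' B' \<bullet> sum_arr \<C> (\<phi> a A') (\<phi> b B')"
  proof (rule CC.sum_ext[of "Y \<boxtimes> A" "Y \<boxtimes> B"])
    let ?S = "sum_cmp \<V> \<C> (L_tensor Y') A' B'"
    have S: "?S \<in> arr \<C>" "src \<C> ?S = sum_ob \<C> (fob L (A' \<boxtimes>\<^bsub>\<V>\<^esub> Y')) (fob L (B' \<boxtimes>\<^bsub>\<V>\<^esub> Y'))"
      "tgt \<C> ?S = fob L (sum_ob \<V> A' B' \<boxtimes>\<^bsub>\<V>\<^esub> Y')"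
      using T.sum_cmp_simps[of A' B'] by simp_all
    have S1: "?S \<bullet> inj1 \<C> (fob L (A' \<boxtimes>\<^bsub>\<V>\<^esub> Y')) (fob L (B' \<boxtimes>\<^bsub>\<V>\<^esub> Y')) \<bullet> \<phi> a A' =
        far L (inj1 \<V> A' B' \<otimes>\<^bsub>\<V>\<^esub> ide \<V> Y') \<bullet> \<phi> a A'"
      by (rule CC.cmp_reassoc) (use T.sum_cmp_simps(4)[of A' B'] S in simp_all)
    have S2: "?S \<bullet> inj2 \<C> (fob L (A' \<boxtimes>\<^bsub>\<V>\<^esub> Y')) (fob L (B' \<boxtimes>\<^bsub>\<V>\<^esub> Y')) \<bullet> \<phi> b B' =
        far L (inj2 \<V> A' B' \<otimes>\<^bsub>\<V>\<^esub> ide \<V> Y') \<bullet> \<phi> b B'"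
      by (rule CC.cmp_reassoc) (use T.sum_cmp_simps(5)[of A' B'] S in simp_all)
    show "copair \<C> (idC Y \<otimes> inj1 \<C> A B) (idC Y \<otimes> inj2 \<C> A B) \<bullet> inj1 \<C> (Y \<boxtimes> A) (Y \<boxtimes> B) =
      (\<theta> \<bullet> ?S \<bullet> sum_arr \<C> (\<phi> a A') (\<phi> b B')) \<bullet> inj1 \<C> (Y \<boxtimes> A) (Y \<boxtimes> B)"
      using S S1 si \<theta>_\<phi>[of a A' "inj1 \<V> A' B'" "inj1 \<C> A B"] by simp
    show "copair \<C> (idC Y \<otimes> inj1 \<C> A B) (idC Y \<otimes> inj2 \<C> A B) \<bullet> inj2 \<C> (Y \<boxtimes> A) (Y \<boxtimes> B) =
      (\<theta> \<bullet> ?S \<bullet> sum_arr \<C> (\<phi> a A') (\<phi> b B')) \<bullet> inj2 \<C> (Y \<boxtimes> A) (Y \<boxtimes> B)"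
      using S S2 si \<theta>_\<phi>[of b B' "inj2 \<V> A' B'" "inj2 \<C> A B"] by simp
  qed (use T.sum_cmp_simps[of A' B'] in simp_all)
  then show ?thesis
    using T.sum_cmp_simps[of A' B'] T.iso_sum_cmp[of A' B'] by simp
qed

lemma iso_distributor_ctx [simp]:
  "iso \<C> (copair \<C> (idC (ctxC \<Gamma>) \<otimes> inj1 \<C> (tyC A) (tyC B)) (idC (ctxC \<Gamma>) \<otimes> inj2 \<C> (tyC A) (tyC B)))"
  by (rule iso_distributor[of "ctx_isoL \<Gamma>" "ctxV \<Gamma>" _ "isoL A" "tyV A" _ "isoL B" "tyV B"]) simp_all

lemma distr_simps [simp]:
  "distr (ctxC \<Gamma>) (tyC A) (tyC B) \<in> arr \<C>"
  "src \<C> (distr (ctxC \<Gamma>) (tyC A) (tyC B)) = ctxC \<Gamma> \<boxtimes> sum_ob \<C> (tyC A) (tyC B)"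
  "tgt \<C> (distr (ctxC \<Gamma>) (tyC A) (tyC B)) = sum_ob \<C> (ctxC \<Gamma> \<boxtimes> tyC A) (ctxC \<Gamma> \<boxtimes> tyC B)"
  by (simp_all add: distr_def)

lemma distr_pt:
  assumes e: "e \<in> hom \<C> (unit \<C>) (ctxC \<Gamma>)"
  shows "g \<in> hom \<C> (unit \<C>) (tyC A) \<Longrightarrow> distr (ctxC \<Gamma>) (tyC A) (tyC B) \<bullet> pt \<C> e (inj1 \<C> (tyC A) (tyC B) \<bullet> g) =
      inj1 \<C> (ctxC \<Gamma> \<boxtimes> tyC A) (ctxC \<Gamma> \<boxtimes> tyC B) \<bullet> pt \<C> e g"
    "g \<in> hom \<C> (unit \<C>) (tyC B) \<Longrightarrow> distr (ctxC \<Gamma>) (tyC A) (tyC B) \<bullet> pt \<C> e (inj2 \<C> (tyC A) (tyC B) \<bullet> g) =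
      inj2 \<C> (ctxC \<Gamma> \<boxtimes> tyC A) (ctxC \<Gamma> \<boxtimes> tyC B) \<bullet> pt \<C> e g"
proof -
  let ?c = "copair \<C> (idC (ctxC \<Gamma>) \<otimes> inj1 \<C> (tyC A) (tyC B)) (idC (ctxC \<Gamma>) \<otimes> inj2 \<C> (tyC A) (tyC B))"
  show "distr (ctxC \<Gamma>) (tyC A) (tyC B) \<bullet> pt \<C> e (inj1 \<C> (tyC A) (tyC B) \<bullet> g) =
      inj1 \<C> (ctxC \<Gamma> \<boxtimes> tyC A) (ctxC \<Gamma> \<boxtimes> tyC B) \<bullet> pt \<C> e g" if g: "g \<in> hom \<C> (unit \<C>) (tyC A)"
  proof -
    let ?x = "inj1 \<C> (ctxC \<Gamma> \<boxtimes> tyC A) (ctxC \<Gamma> \<boxtimes> tyC B) \<bullet> pt \<C> e g"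
    have "?c \<bullet> ?x = pt \<C> e (inj1 \<C> (tyC A) (tyC B) \<bullet> g)"
      using e g by simp
    moreover have "invC ?c \<bullet> ?c \<bullet> ?x = ?x"
      by (rule CC.inv_cancel(1)) (use e g in simp_all)
    ultimately show ?thesis
      by (simp add: distr_def)
  qed
  show "distr (ctxC \<Gamma>) (tyC A) (tyC B) \<bullet> pt \<C> e (inj2 \<C> (tyC A) (tyC B) \<bullet> g) =
      inj2 \<C> (ctxC \<Gamma> \<boxtimes> tyC A) (ctxC \<Gamma> \<boxtimes> tyC B) \<bullet> pt \<C> e g" if g: "g \<in> hom \<C> (unit \<C>) (tyC B)"
  proof -
    let ?x = "inj2 \<C> (ctxC \<Gamma> \<boxtimes> tyC A) (ctxC \<Gamma> \<boxtimes> tyC B) \<bullet> pt \<C> e g"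
    have "?c \<bullet> ?x = pt \<C> e (inj2 \<C> (tyC A) (tyC B) \<bullet> g)"
      using e g by simp
    moreover have "invC ?c \<bullet> ?c \<bullet> ?x = ?x"
      by (rule CC.inv_cancel(1)) (use e g in simp_all)
    ultimately show ?thesis
      by (simp add: distr_def)
  qed
qed

section \<open>Recursion by initial algebras and final coalgebras\<close>

lemma Omg_simps [simp]:
  assumes "X \<in> obj \<B>"
  shows "Omg M X \<in> obj \<C>" "iso \<C> (omg M X)" "omg M X \<in> arr \<C>"
    "src \<C> (omg M X) = fob F X \<boxtimes> bang_ob (Omg M X)" "tgt \<C> (omg M X) = Omg M X"
  using omg_initial[OF assms] omg_final[OF assms]
  by (auto simp: initial_algebra_def inverse_final_coalgebra_def)

lemma rec_fold_props:
  assumes \<Phi>: "nonlinear_ctx \<Phi>" and f: "f \<in> hom \<C> (ctxC (\<Phi> @ [(0, TBang A)])) (tyC A)"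
  shows "rec_fold \<Phi> A f \<in> hom \<C> (Omg M (ctxB \<Phi>)) (tyC A) \<and>
    rec_fold \<Phi> A f \<bullet> omg M (ctxB \<Phi>) = f \<bullet> invC (ext \<Phi> (TBang A)) \<bullet> (ctx_isoF \<Phi> \<otimes> bang (rec_fold \<Phi> A f))"
proof -
  let ?X = "ctxB \<Phi>"
  \<comment> \<open>The equation defining \<open>rec_fold\<close> has
    \<open>ctx_isoF \<Phi> \<otimes> bang s\<close> in one piece; splitting it shows
    \<open>s\<close> to be the algebra morphism into \<open>?a\<close>.\<close>
  let ?a = "f \<bullet> invC (ext \<Phi> (TBang A)) \<bullet> (ctx_isoF \<Phi> \<otimes> idC (bang_ob (tyC A)))"
  have "?a \<in> hom \<C> (fob F ?X \<boxtimes> bang_ob (tyC A)) (tyC A)"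
    using \<Phi> f by simp
  then have "\<exists>!h. h \<in> hom \<C> (Omg M ?X) (tyC A) \<and> h \<bullet> omg M ?X = ?a \<bullet> (idC (fob F ?X) \<otimes> bang h)"
    using omg_initial[OF ctxB_obj[OF \<Phi>]] tyC_obj unfolding initial_algebra_def by blast
  moreover have "?a \<bullet> (idC (fob F ?X) \<otimes> bang h) = f \<bullet> invC (ext \<Phi> (TBang A)) \<bullet> (ctx_isoF \<Phi> \<otimes> bang h)"
    if "h \<in> hom \<C> (Omg M ?X) (tyC A)" for h
    using that \<Phi> f by (simp add: CM.tar_cmp')
  ultimately have "\<exists>!h. h \<in> hom \<C> (Omg M ?X) (tyC A) \<and>
      h \<bullet> omg M ?X = f \<bullet> invC (ext \<Phi> (TBang A)) \<bullet> (ctx_isoF \<Phi> \<otimes> bang h)"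
    by metis
  then show ?thesis
    unfolding rec_fold_def by (rule theI')
qed

lemma rec_unfold_props:
  assumes \<Phi>: "nonlinear_ctx \<Phi>"
  shows "rec_unfold \<Phi> \<in> hom \<C> (ctxC \<Phi>) (Omg M (ctxB \<Phi>)) \<and>
    invC (omg M (ctxB \<Phi>)) \<bullet> rec_unfold \<Phi> =
       (idC (fob F (ctxB \<Phi>)) \<otimes> bang (rec_unfold \<Phi>)) \<bullet> (invC (ctx_isoF \<Phi>) \<otimes> box \<Phi>) \<bullet> duplicate \<Phi>"
proof -
  let ?X = "ctxB \<Phi>"
  let ?a = "(invC (ctx_isoF \<Phi>) \<otimes> box \<Phi>) \<bullet> duplicate \<Phi>"
  have "?a \<in> hom \<C> (ctxC \<Phi>) (fob F ?X \<boxtimes> bang_ob (ctxC \<Phi>))"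
    using \<Phi> by simp
  then have "\<exists>!h. h \<in> hom \<C> (ctxC \<Phi>) (Omg M ?X) \<and>
      invC (omg M ?X) \<bullet> h = (idC (fob F ?X) \<otimes> bang h) \<bullet> ?a"
    using omg_final[OF ctxB_obj[OF \<Phi>]] ctxC_obj unfolding inverse_final_coalgebra_def by blast
  then show ?thesis
    unfolding rec_unfold_def by (rule theI')
qed

lemma rec_simps [simp]:
  assumes "nonlinear_ctx \<Phi>"
  shows "rec_unfold \<Phi> \<in> arr \<C>" "src \<C> (rec_unfold \<Phi>) = ctxC \<Phi>" "tgt \<C> (rec_unfold \<Phi>) = Omg M (ctxB \<Phi>)"
    "f \<in> hom \<C> (ctxC (\<Phi> @ [(0, TBang A)])) (tyC A) \<Longrightarrow> rec_fold \<Phi> A f \<in> arr \<C>"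
    "f \<in> hom \<C> (ctxC (\<Phi> @ [(0, TBang A)])) (tyC A) \<Longrightarrow> src \<C> (rec_fold \<Phi> A f) = Omg M (ctxB \<Phi>)"
    "f \<in> hom \<C> (ctxC (\<Phi> @ [(0, TBang A)])) (tyC A) \<Longrightarrow> tgt \<C> (rec_fold \<Phi> A f) = tyC A"
  using rec_fold_props[of \<Phi> f A] rec_unfold_props[of \<Phi>] assms by simp_all

text \<open>For \<open>e = id\<close> this is the recursion equation; the other instances are the approximants of the least fixed point.\<close>

lemma rec_unroll:
  assumes \<Phi>: "nonlinear_ctx \<Phi>" and f: "f \<in> hom \<C> (ctxC (\<Phi> @ [(0, TBang A)])) (tyC A)"
    and e: "e \<in> hom \<C> (Omg M (ctxB \<Phi>)) (Omg M (ctxB \<Phi>))" and \<rho>: "Fenv \<rho> \<Phi>" "points \<rho> \<Phi>"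
  shows "rec_fold \<Phi> A f \<bullet> (omg M (ctxB \<Phi>) \<bullet> (idC (fob F (ctxB \<Phi>)) \<otimes> bang e) \<bullet> invC (omg M (ctxB \<Phi>))) \<bullet>
      rec_unfold \<Phi> \<bullet> env \<rho> \<Phi> =
    f \<bullet> invC (ext \<Phi> (TBang A)) \<bullet> pt \<C> (env \<rho> \<Phi>) (promote (rec_fold \<Phi> A f \<bullet> e \<bullet> rec_unfold \<Phi> \<bullet> env \<rho> \<Phi>))"
proof -
  let ?s = "rec_fold \<Phi> A f" and ?g = "rec_unfold \<Phi>" and ?o = "omg M (ctxB \<Phi>)" and ?X = "fob F (ctxB \<Phi>)"
  let ?v = "env \<rho> \<Phi>"
  have f': "f \<in> arr \<C>" "src \<C> f = ctxC (\<Phi> @ [(0, TBang A)])" "tgt \<C> f = tyC A"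
    and e': "e \<in> arr \<C>" "src \<C> e = Omg M (ctxB \<Phi>)" "tgt \<C> e = Omg M (ctxB \<Phi>)"
    using f e by simp_all
  \<comment> \<open>The coalgebra equation at an environment: as it consists of values, it is copied
    and one copy is boxed.\<close>
  have "invC ?o \<bullet> ?g \<bullet> ?v =
      ((idC ?X \<otimes> bang ?g) \<bullet> (invC (ctx_isoF \<Phi>) \<otimes> box \<Phi>) \<bullet> duplicate \<Phi>) \<bullet> ?v"
    by (rule CC.cmp_reassoc) (use rec_unfold_props[OF \<Phi>] \<Phi> \<rho> in simp_all)
  also have "\<dots> = pt \<C> (invC (ctx_isoF \<Phi>) \<bullet> ?v) (bang ?g \<bullet> promote ?v)"
    using \<Phi> \<rho> by (simp add: duplicate_env box_env)
  finally have g: "invC ?o \<bullet> ?g \<bullet> ?v = pt \<C> (invC (ctx_isoF \<Phi>) \<bullet> ?v) (bang ?g \<bullet> promote ?v)" .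
  let ?w = "pt \<C> (invC (ctx_isoF \<Phi>) \<bullet> ?v) (bang e \<bullet> bang ?g \<bullet> promote ?v)"
  have "?s \<bullet> (?o \<bullet> (idC ?X \<otimes> bang e) \<bullet> invC ?o) \<bullet> ?g \<bullet> ?v = ?s \<bullet> ?o \<bullet> (idC ?X \<otimes> bang e) \<bullet> invC ?o \<bullet> ?g \<bullet> ?v"
    using \<Phi> \<rho> f' e' by simp
  also have "\<dots> = ?s \<bullet> ?o \<bullet> ?w"
    unfolding g using \<Phi> \<rho> e' by simp
  also have "\<dots> = (f \<bullet> invC (ext \<Phi> (TBang A)) \<bullet> (ctx_isoF \<Phi> \<otimes> bang ?s)) \<bullet> ?w"
    by (rule CC.cmp_reassoc) (use rec_fold_props[OF \<Phi> f] \<Phi> \<rho> f' e' in simp_all)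
  also have "\<dots> = f \<bullet> invC (ext \<Phi> (TBang A)) \<bullet> pt \<C> ?v (bang ?s \<bullet> bang e \<bullet> bang ?g \<bullet> promote ?v)"
    using \<Phi> \<rho> f' e' by simp
  also have "bang ?s \<bullet> bang e \<bullet> bang ?g \<bullet> promote ?v = promote (?s \<bullet> e \<bullet> ?g \<bullet> ?v)"
    using \<Phi> \<rho> f' e' by (simp add: promote_def bang_cmp)
  finally show ?thesis .
qed

lemma den_hom:
  assumes "derives c d \<Gamma> m A" "c = Affine \<Longrightarrow> terminal \<V> (unit \<V>)"
  shows "den d \<in> hom \<C> (ctxC \<Gamma>) (tyC A)"
  using assms
proof (induction rule: derives.induct)
  case (var_l \<Phi> x A)
  then show ?case using ctxC_snoc_cong[of \<Phi> x A] by simp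
next
  case (var_a \<Gamma> x A)
  then show ?case using ctxC_snoc_cong[of \<Gamma> x A] by simp
next
  case (let_in \<Phi> \<Gamma> \<Sigma> d m A B e n C)
  have "ctxC (\<Phi> @ \<Sigma> @ [(1, A)]) = ctxC (\<Phi> @ \<Sigma> @ [(0, A)])"
    using ctxC_snoc_cong[of "\<Phi> @ \<Sigma>" 1 A] by simp
  then show ?case using let_in by simp
next
  case (exch d \<Gamma> x A y B \<Sigma> m C)
  then show ?case
    using exchange_hom[of \<Gamma> A B \<Sigma> y x] by simp
next
  case (force d \<Gamma> m A)
  then show ?case by (simp add: bang_ob_def)
qed simp_all

end

section \<open>Recursion as a supremum\<close>

lemma scott_continuous_comp:
  assumes "scott_continuous D a E b f" "scott_continuous E b H c g"
  shows "scott_continuous D a H c (\<lambda>x. g (f x))"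
proof -
  have "chain_in E b (\<lambda>n. f (s n))" if "chain_in D a s" for s
    using that assms(1) unfolding chain_in_def scott_continuous_def by blast
  then show ?thesis
    using assms unfolding scott_continuous_def by blast
qed

text \<open>Enrichment provides joint continuity; pairing a chain with a constant one extracts
  continuity in a single argument.\<close>

lemma scott_continuous_pair_left:
  assumes h: "scott_continuous (D \<times> E) (pair_le a b) H c h" and y: "y \<in> D" "a y y"
  shows "scott_continuous E b H c (\<lambda>x. h (y, x))"
proof -
  have "chain_in (D \<times> E) (pair_le a b) (\<lambda>n. (y, s n))" if "chain_in E b s" for s
    using that y by (simp add: chain_in_def pair_le_def)
  moreover have "sup_in (D \<times> E) (pair_le a b) (\<lambda>n. (y, s n)) (y, x)" if "sup_in E b s x" for s x
    using that y by (auto simp: sup_in_def pair_le_def)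
  moreover have "pair_le a b (y, x) (y, z)" if "b x z" for x z
    using that y by (simp add: pair_le_def)
  ultimately show ?thesis
    using h y unfolding scott_continuous_def by blast
qed

lemma scott_continuous_pair_right:
  assumes h: "scott_continuous (D \<times> E) (pair_le a b) H c h" and y: "y \<in> E" "b y y"
  shows "scott_continuous D a H c (\<lambda>x. h (x, y))"
proof -
  have "chain_in (D \<times> E) (pair_le a b) (\<lambda>n. (s n, y))" if "chain_in D a s" for s
    using that y by (simp add: chain_in_def pair_le_def)
  moreover have "sup_in (D \<times> E) (pair_le a b) (\<lambda>n. (s n, y)) (x, y)" if "sup_in D a s x" for s x
    using that y by (auto simp: sup_in_def pair_le_def)
  moreover have "pair_le a b (x, y) (z, y)" if "a x z" for x z
    using that y by (simp add: pair_le_def)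
  ultimately show ?thesis
    using h y unfolding scott_continuous_def by blast
qed

lemma cpo_sup_unique: "cpo D le \<Longrightarrow> sup_in D le s x \<Longrightarrow> sup_in D le s y \<Longrightarrow> x = y"
  unfolding cpo_def sup_in_def by blast

lemma sup_in_Suc:
  assumes "cpo D le" "chain_in D le s" "sup_in D le s x"
  shows "sup_in D le (\<lambda>n. s (Suc n)) x"
proof -
  have "le (s n) y" if "y \<in> D" "\<forall>n. le (s (Suc n)) y" for n y
    using that assms unfolding cpo_def chain_in_def by meson
  then show ?thesis
    using assms(3) unfolding sup_in_def by blast
qed

locale adequate_lnl_model = lambda_l_model M
  for M :: "('ob, 'ab, 'ov, 'av, 'oc, 'ac, 'm) ordered_lnl_model_scheme" +
  assumes adequate: "computationally_adequate M"
begin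

abbreviation "botC \<equiv> bot_arr \<C> (leC M)"

lemma order_C: "pointed_cpo_enriched \<C> (leC M)"
  using adequate by (simp add: computationally_adequate_def order_enriched_def)

lemma cpo_C: "X \<in> obj \<C> \<Longrightarrow> Y \<in> obj \<C> \<Longrightarrow> cpo (hom \<C> X Y) (leC M)"
  using order_C unfolding pointed_cpo_enriched_def cpo_enriched_def by blast

lemma le_refl: "f \<in> arr \<C> \<Longrightarrow> leC M f f"
  using cpo_C[of "src \<C> f" "tgt \<C> f"] unfolding cpo_def by auto

lemma least_bot:
  assumes "X \<in> obj \<C>" "Y \<in> obj \<C>"
  shows "least_in (hom \<C> X Y) (leC M) (botC X Y)"
proof -
  obtain b where b: "least_in (hom \<C> X Y) (leC M) b"
    using order_C assms unfolding pointed_cpo_enriched_def by blast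
  moreover have "b' = b" if "least_in (hom \<C> X Y) (leC M) b'" for b'
    using b that cpo_C[OF assms] unfolding least_in_def cpo_def by blast
  ultimately show ?thesis
    unfolding bot_arr_def by (rule theI)
qed

lemma bot_simps [simp]:
  assumes "X \<in> obj \<C>" "Y \<in> obj \<C>"
  shows "botC X Y \<in> arr \<C>" "src \<C> (botC X Y) = X" "tgt \<C> (botC X Y) = Y"
  using least_bot[OF assms] by (simp_all add: least_in_def)

lemma bot_cmp [simp]:
  "f \<in> arr \<C> \<Longrightarrow> Y = tgt \<C> f \<Longrightarrow> Z \<in> obj \<C> \<Longrightarrow> botC Y Z \<bullet> f = botC (src \<C> f) Z"
  "g \<in> arr \<C> \<Longrightarrow> Y = src \<C> g \<Longrightarrow> X \<in> obj \<C> \<Longrightarrow> g \<bullet> botC X Y = botC X (tgt \<C> g)"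
proof -
  show "botC Y Z \<bullet> f = botC (src \<C> f) Z" if "f \<in> arr \<C>" "Y = tgt \<C> f" "Z \<in> obj \<C>"
  proof -
    have "f \<in> hom \<C> (src \<C> f) Y" "src \<C> f \<in> obj \<C>" "Y \<in> obj \<C>"
      using that by auto
    then show ?thesis
      using order_C that(3) unfolding pointed_cpo_enriched_def by blast
  qed
  show "g \<bullet> botC X Y = botC X (tgt \<C> g)" if "g \<in> arr \<C>" "Y = src \<C> g" "X \<in> obj \<C>"
  proof -
    have "g \<in> hom \<C> Y (tgt \<C> g)" "tgt \<C> g \<in> obj \<C>" "Y \<in> obj \<C>"
      using that by auto
    then show ?thesis
      using order_C that(3) unfolding pointed_cpo_enriched_def by blast
  qed
qed

section \<open>Continuity of composition, tensor and bang\<close>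

lemma cmp_continuous:
  assumes "X \<in> obj \<C>" "Y \<in> obj \<C>" "Z \<in> obj \<C>"
  shows "g \<in> hom \<C> Y Z \<Longrightarrow> scott_continuous (hom \<C> X Y) (leC M) (hom \<C> X Z) (leC M) (\<lambda>f. g \<bullet> f)"
    "f \<in> hom \<C> X Y \<Longrightarrow> scott_continuous (hom \<C> Y Z) (leC M) (hom \<C> X Z) (leC M) (\<lambda>g. g \<bullet> f)"
proof -
  have c: "scott_continuous (hom \<C> Y Z \<times> hom \<C> X Y) (pair_le (leC M) (leC M)) (hom \<C> X Z) (leC M) (\<lambda>(g, f). g \<bullet> f)"
    using order_C assms unfolding pointed_cpo_enriched_def cpo_enriched_def by blast
  show "g \<in> hom \<C> Y Z \<Longrightarrow> scott_continuous (hom \<C> X Y) (leC M) (hom \<C> X Z) (leC M) (\<lambda>f. g \<bullet> f)"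
    using scott_continuous_pair_left[OF c, of g] le_refl[of g] by simp
  show "f \<in> hom \<C> X Y \<Longrightarrow> scott_continuous (hom \<C> Y Z) (leC M) (hom \<C> X Z) (leC M) (\<lambda>g. g \<bullet> f)"
    using scott_continuous_pair_right[OF c, of f] le_refl[of f] by simp
qed

lemma tar_continuous:
  assumes "X \<in> obj \<C>" "Y \<in> obj \<C>" "X' \<in> obj \<C>" "Y' \<in> obj \<C>" "g \<in> hom \<C> X' Y'"
  shows "scott_continuous (hom \<C> X Y) (leC M) (hom \<C> (X' \<boxtimes> X) (Y' \<boxtimes> Y)) (leC M) (\<lambda>f. g \<otimes> f)"
proof -
  have "tensor_continuous \<C> (leC M)"
    using adequate by (simp add: computationally_adequate_def order_enriched_def)
  then have c: "scott_continuous (hom \<C> X' Y' \<times> hom \<C> X Y) (pair_le (leC M) (leC M))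
      (hom \<C> (X' \<boxtimes> X) (Y' \<boxtimes> Y)) (leC M) (\<lambda>(g, f). g \<otimes> f)"
    using assms unfolding tensor_continuous_def by blast
  show ?thesis
    using scott_continuous_pair_left[OF c, of g] le_refl[of g] assms by simp
qed

lemma bang_continuous:
  assumes "X \<in> obj \<C>" "Y \<in> obj \<C>"
  shows "scott_continuous (hom \<C> X Y) (leC M) (hom \<C> (bang_ob X) (bang_ob Y)) (leC M) bang"
proof -
  have c: "locally_continuous \<C> (leC M) \<V> (leV M) R" "locally_continuous \<V> (leV M) \<B> (leB M) K"
    "locally_continuous \<B> (leB M) \<V> (leV M) J" "locally_continuous \<V> (leV M) \<C> (leC M) L"
    using adequate by (simp_all add: computationally_adequate_def order_enriched_def)
  have o: "fob R X \<in> obj \<V>" "fob R Y \<in> obj \<V>" "fob K (fob R X) \<in> obj \<B>" "fob K (fob R Y) \<in> obj \<B>"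
    "fob J (fob K (fob R X)) \<in> obj \<V>" "fob J (fob K (fob R Y)) \<in> obj \<V>"
    using assms by simp_all
  have "scott_continuous (hom \<C> X Y) (leC M) (hom \<V> (fob R X) (fob R Y)) (leV M) (far R)"
    using c(1) assms unfolding locally_continuous_def by blast
  moreover have "scott_continuous (hom \<V> (fob R X) (fob R Y)) (leV M)
      (hom \<B> (fob K (fob R X)) (fob K (fob R Y))) (leB M) (far K)"
    using c(2) o unfolding locally_continuous_def by blast
  moreover have "scott_continuous (hom \<B> (fob K (fob R X)) (fob K (fob R Y))) (leB M)
      (hom \<V> (fob J (fob K (fob R X))) (fob J (fob K (fob R Y)))) (leV M) (far J)"
    using c(3) o unfolding locally_continuous_def by blast
  moreover have "scott_continuous (hom \<V> (fob J (fob K (fob R X))) (fob J (fob K (fob R Y)))) (leV M)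
      (hom \<C> (bang_ob X) (bang_ob Y)) (leC M) (far L)"
    using c(4) o unfolding locally_continuous_def by (simp add: bang_ob_def F_simps G_simps)
  ultimately have "scott_continuous (hom \<C> X Y) (leC M) (hom \<C> (bang_ob X) (bang_ob Y)) (leC M)
      (\<lambda>f. far L (far J (far K (far R f))))"
    by (rule scott_continuous_comp[OF scott_continuous_comp[OF scott_continuous_comp]])
  then show ?thesis
    by (simp add: bang_def[abs_def] F_simps G_simps)
qed

text \<open>Since \<open>omg\<close> is invertible, the fixed points of this operator are exactly
  the endomorphisms of the initial algebra.\<close>

definition omg_step :: "'ob \<Rightarrow> 'ac \<Rightarrow> 'ac" where
  "omg_step X e = omg M X \<bullet> (idC (fob F X) \<otimes> bang e) \<bullet> invC (omg M X)"

primrec omg_approx :: "'ob \<Rightarrow> nat \<Rightarrow> 'ac" where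
  "omg_approx X 0 = botC (Omg M X) (Omg M X)"
| "omg_approx X (Suc n) = omg_step X (omg_approx X n)"

lemma omg_step_continuous:
  assumes "X \<in> obj \<B>"
  shows "scott_continuous (hom \<C> (Omg M X) (Omg M X)) (leC M) (hom \<C> (Omg M X) (Omg M X)) (leC M) (omg_step X)"
proof -
  let ?O = "Omg M X" and ?P = "fob F X \<boxtimes> bang_ob (Omg M X)"
  have o: "?O \<in> obj \<C>" "?P \<in> obj \<C>" "bang_ob ?O \<in> obj \<C>" "fob F X \<in> obj \<C>"
    using assms by simp_all
  have 1: "scott_continuous (hom \<C> (bang_ob ?O) (bang_ob ?O)) (leC M) (hom \<C> ?P ?P) (leC M) (\<lambda>f. idC (fob F X) \<otimes> f)"
    by (rule tar_continuous) (use o in simp_all)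
  have 2: "scott_continuous (hom \<C> ?P ?P) (leC M) (hom \<C> ?O ?P) (leC M) (\<lambda>f. f \<bullet> invC (omg M X))"
    by (rule cmp_continuous) (use o assms in simp_all)
  have 3: "scott_continuous (hom \<C> ?O ?P) (leC M) (hom \<C> ?O ?O) (leC M) (\<lambda>f. omg M X \<bullet> f)"
    by (rule cmp_continuous) (use o assms in simp_all)
  show ?thesis
    unfolding omg_step_def[abs_def]
    by (rule scott_continuous_comp[OF scott_continuous_comp[OF scott_continuous_comp[OF bang_continuous 1] 2] 3])
      (use o in simp_all)
qed

lemma omg_approx_chain:
  assumes "X \<in> obj \<B>"
  shows "chain_in (hom \<C> (Omg M X) (Omg M X)) (leC M) (omg_approx X)"
proof -
  let ?D = "hom \<C> (Omg M X) (Omg M X)"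
  have D: "omg_approx X n \<in> ?D" for n
  proof (induction n)
    case 0
    then show ?case using assms by simp
  next
    case (Suc n)
    then show ?case
      using omg_step_continuous[OF assms] unfolding scott_continuous_def by simp
  qed
  moreover have "leC M (omg_approx X n) (omg_approx X (Suc n))" for n
  proof (induction n)
    case 0
    then show ?case
      using least_bot[of "Omg M X" "Omg M X"] assms D[of "Suc 0"] unfolding least_in_def by simp
  next
    case (Suc n)
    have "leC M (omg_step X (omg_approx X n)) (omg_step X (omg_approx X (Suc n)))"
      using omg_step_continuous[OF assms] D[of n] D[of "Suc n"] Suc unfolding scott_continuous_def by blast
    then show ?case by simp
  qed
  ultimately show ?thesis
    unfolding chain_in_def by blast
qed

text \<open>The supremum of the approximants is a fixed point of \<open>omg_step\<close>, hence an algebra endomorphism of the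
  initial algebra, hence the identity.\<close>

lemma omg_approx_sup:
  assumes X: "X \<in> obj \<B>"
  shows "sup_in (hom \<C> (Omg M X) (Omg M X)) (leC M) (omg_approx X) (idC (Omg M X))"
proof -
  let ?D = "hom \<C> (Omg M X) (Omg M X)"
  have cpo: "cpo ?D (leC M)"
    using X by (simp add: cpo_C)
  note chain = omg_approx_chain[OF X]
  obtain x where x: "sup_in ?D (leC M) (omg_approx X) x"
    using cpo chain unfolding cpo_def by blast
  have "sup_in ?D (leC M) (\<lambda>n. omg_step X (omg_approx X n)) (omg_step X x)"
    using omg_step_continuous[OF X] chain x unfolding scott_continuous_def by blast
  moreover have "sup_in ?D (leC M) (\<lambda>n. omg_step X (omg_approx X n)) x"
    using sup_in_Suc[OF cpo chain x] by simp
  ultimately have fixed: "omg_step X x = x"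
    by (rule cpo_sup_unique[OF cpo])
  have xD: "x \<in> arr \<C>" "src \<C> x = Omg M X" "tgt \<C> x = Omg M X"
    using x by (simp_all add: sup_in_def)
  have "x \<bullet> omg M X = omg_step X x \<bullet> omg M X"
    by (simp only: fixed)
  also have "\<dots> = omg M X \<bullet> (idC (fob F X) \<otimes> bang x)"
    using X xD by (simp add: omg_step_def)
  finally have 1: "x \<bullet> omg M X = omg M X \<bullet> (idC (fob F X) \<otimes> bang x)" .
  have 2: "idC (Omg M X) \<bullet> omg M X = omg M X \<bullet> (idC (fob F X) \<otimes> bang (idC (Omg M X)))"
    using X by (simp add: CM.tar_ide bang_def bang_ob_def)
  have "\<exists>!h. h \<in> hom \<C> (Omg M X) (Omg M X) \<and> h \<bullet> omg M X = omg M X \<bullet> (idC (fob F X) \<otimes> bang h)"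
    using omg_initial[OF X] unfolding initial_algebra_def by blast
  moreover have "x \<in> hom \<C> (Omg M X) (Omg M X)" "idC (Omg M X) \<in> hom \<C> (Omg M X) (Omg M X)"
    using xD X by simp_all
  ultimately have "x = idC (Omg M X)"
    using 1 2 by blast
  then show ?thesis
    using x by simp
qed

text \<open>One unfolding on the semantic side: the recursion variable is bound to
  \<open>promote g\<close>, the counterpart of substituting \<open>Lift (Rec A m)\<close>.\<close>

definition rec_body :: "ctx \<Rightarrow> ty \<Rightarrow> 'ac \<Rightarrow> (nat \<Rightarrow> 'ac) \<Rightarrow> 'ac \<Rightarrow> 'ac" where
  "rec_body \<Phi> A f \<rho> g = f \<bullet> invC (ext \<Phi> (TBang A)) \<bullet> pt \<C> (env \<rho> \<Phi>) (promote g)"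

lemma rec_fixpoint:
  assumes "nonlinear_ctx \<Phi>" "f \<in> hom \<C> (ctxC (\<Phi> @ [(0, TBang A)])) (tyC A)" "Fenv \<rho> \<Phi>" "points \<rho> \<Phi>"
  shows "rec_fold \<Phi> A f \<bullet> rec_unfold \<Phi> \<bullet> env \<rho> \<Phi> = rec_body \<Phi> A f \<rho> (rec_fold \<Phi> A f \<bullet> rec_unfold \<Phi> \<bullet> env \<rho> \<Phi>)"
proof -
  have "bang (idC (Omg M (ctxB \<Phi>))) = idC (bang_ob (Omg M (ctxB \<Phi>)))"
    using assms by (simp add: bang_def bang_ob_def)
  then show ?thesis
    using rec_unroll[OF assms(1,2) _ assms(3,4), of "idC (Omg M (ctxB \<Phi>))"] assms
    by (simp add: rec_body_def CM.tar_ide)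
qed

text \<open>Scott induction. Inserting \<open>omg_approx\<close> between unfolding and folding gives
  the iterates of \<open>rec_body\<close> from \<bottom>. Composition is continuous, so by
  \<open>omg_approx_sup\<close> their supremum is the composite with the identity inserted, which is
  the denotation of \<open>Rec\<close>.\<close>

lemma rec_induct:
  assumes \<Phi>: "nonlinear_ctx \<Phi>" and f: "f \<in> hom \<C> (ctxC (\<Phi> @ [(0, TBang A)])) (tyC A)"
    and \<rho>: "Fenv \<rho> \<Phi>" "points \<rho> \<Phi>"
    and bot: "P (botC (unit \<C>) (tyC A))"
    and step: "\<And>g. g \<in> hom \<C> (unit \<C>) (tyC A) \<Longrightarrow> P g \<Longrightarrow> P (rec_body \<Phi> A f \<rho> g)"
    and adm: "\<And>s x. chain_in (hom \<C> (unit \<C>) (tyC A)) (leC M) s \<Longrightarrow>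
      sup_in (hom \<C> (unit \<C>) (tyC A)) (leC M) s x \<Longrightarrow> (\<And>n. P (s n)) \<Longrightarrow> P x"
  shows "P (rec_fold \<Phi> A f \<bullet> rec_unfold \<Phi> \<bullet> env \<rho> \<Phi>)"
proof -
  let ?X = "ctxB \<Phi>" and ?D = "hom \<C> (unit \<C>) (tyC A)"
  let ?O = "Omg M ?X"
  have X: "?X \<in> obj \<B>"
    using \<Phi> by simp
  have f': "f \<in> arr \<C>" "src \<C> f = ctxC (\<Phi> @ [(0, TBang A)])" "tgt \<C> f = tyC A"
    using f by simp_all
  define h where "h e = rec_fold \<Phi> A f \<bullet> e \<bullet> rec_unfold \<Phi> \<bullet> env \<rho> \<Phi>" for e
  have e: "omg_approx ?X n \<in> hom \<C> ?O ?O" for n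
    using omg_approx_chain[OF X] unfolding chain_in_def by blast
  have "scott_continuous (hom \<C> ?O ?O) (leC M) (hom \<C> (unit \<C>) ?O) (leC M) (\<lambda>e. e \<bullet> rec_unfold \<Phi> \<bullet> env \<rho> \<Phi>)"
    by (rule cmp_continuous) (use \<Phi> \<rho> X in simp_all)
  moreover have "scott_continuous (hom \<C> (unit \<C>) ?O) (leC M) ?D (leC M) (\<lambda>e. rec_fold \<Phi> A f \<bullet> e)"
    by (rule cmp_continuous) (use \<Phi> f' X in simp_all)
  ultimately have h: "scott_continuous (hom \<C> ?O ?O) (leC M) ?D (leC M) h"
    unfolding h_def[abs_def] by (rule scott_continuous_comp)
  have hD: "h (omg_approx ?X n) \<in> ?D" for n
    using h e unfolding scott_continuous_def by blast
  have "P (h (omg_approx ?X n))" for n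
  proof (induction n)
    case 0
    then show ?case
      using bot \<Phi> \<rho> f' X by (simp add: h_def)
  next
    case (Suc n)
    have "h (omg_approx ?X (Suc n)) = rec_body \<Phi> A f \<rho> (h (omg_approx ?X n))"
      using rec_unroll[OF \<Phi> f e \<rho>] by (simp add: h_def rec_body_def omg_step_def)
    then show ?case
      using step[OF hD Suc] by simp
  qed
  moreover have "chain_in ?D (leC M) (\<lambda>n. h (omg_approx ?X n))"
    using hD h e omg_approx_chain[OF X] unfolding scott_continuous_def chain_in_def by blast
  moreover have "sup_in ?D (leC M) (\<lambda>n. h (omg_approx ?X n)) (h (idC ?O))"
    using h omg_approx_chain[OF X] omg_approx_sup[OF X] unfolding scott_continuous_def by blast
  ultimately have "P (h (idC ?O))"
    by (rule adm[rotated 2])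
  then show ?thesis
    using \<Phi> \<rho> X by (simp add: h_def)
qed

end

section \<open>Substitution\<close>

text \<open>\<open>up_sub\<close> contains a renaming, so composing substitutions under a binder
  first needs the laws that mix renamings and substitutions.\<close>

lemma up_sub_comp_ren: "up_sub s (up_ren r x) = up_sub (\<lambda>x. s (r x)) x"
  by (cases x) (simp_all add: up_sub_def up_ren_def)

lemma sub_ren: "sub s (ren r m) = sub (\<lambda>x. s (r x)) m"
  by (induction m arbitrary: s r) (simp_all add: up_sub_comp_ren)

lemma up_ren_comp: "up_ren r (up_ren q x) = up_ren (\<lambda>x. r (q x)) x"
  by (cases x) (simp_all add: up_ren_def)

lemma ren_ren: "ren r (ren q m) = ren (\<lambda>x. r (q x)) m"
  by (induction m arbitrary: r q) (simp_all add: up_ren_comp)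

lemma ren_up_sub: "ren (up_ren r) (up_sub s x) = up_sub (\<lambda>x. ren r (s x)) x"
  by (cases x) (simp_all add: up_sub_def up_ren_def ren_ren)

lemma ren_sub: "ren r (sub s m) = sub (\<lambda>x. ren r (s x)) m"
  by (induction m arbitrary: r s) (simp_all add: ren_up_sub)

lemma sub_up_sub: "sub (up_sub t) (up_sub s x) = up_sub (\<lambda>x. sub t (s x)) x"
  by (cases x) (simp_all add: up_sub_def sub_ren ren_sub)

lemma sub_sub: "sub t (sub s m) = sub (\<lambda>x. sub t (s x)) m"
  by (induction m arbitrary: t s) (simp_all add: sub_up_sub)

lemma up_sub_Var: "up_sub Var = Var"
  by (rule HOL.ext) (simp add: up_sub_def split: nat.split)

lemma sub_Var [simp]: "sub Var m = m"
  by (induction m) (simp_all add: up_sub_Var)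

text \<open>Filling a binder after a substitution gives the form \<open>case_nat v s\<close>, which
  matches the extended environment \<open>case_nat g \<rho>\<close> in the induction
  hypothesis.\<close>

lemma sub1_up_sub [simp]: "sub1 (sub (up_sub s) m) v = sub (case_nat v s) m"
proof -
  have "(\<lambda>x. sub (case_nat v Var) (up_sub s x)) = case_nat v s"
    by (rule HOL.ext) (simp add: up_sub_def sub_ren split: nat.split)
  then show ?thesis
    by (simp add: sub1_def sub_sub)
qed

lemma sub2_up_sub [simp]: "sub2 (sub (up_sub (up_sub s)) m) v w = sub (case_nat w (case_nat v s)) m"
proof -
  have "(\<lambda>x. sub (case_nat w (case_nat v Var)) (up_sub (up_sub s) x)) = case_nat w (case_nat v s)"
    by (rule HOL.ext) (simp add: up_sub_def sub_ren split: nat.split)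
  then show ?thesis
    by (simp add: sub2_def sub_sub)
qed

section \<open>Evaluation counting the unfoldings of recursion\<close>

text \<open>Only unfolding \<open>Rec\<close> is charged. The nesting \<open>i + (j + l)\<close> for
  \<open>App\<close> is that of two nested uses of \<open>bind\<close>.\<close>

inductive evals_in :: "nat \<Rightarrow> trm \<Rightarrow> trm \<Rightarrow> bool" where
  "evals_in 0 (Var x) (Var x)"
| "evals_in 0 Star Star"
| "evals_in i m Star \<Longrightarrow> evals_in j n v \<Longrightarrow> evals_in (i + j) (Seq m n) v"
| "evals_in i m v \<Longrightarrow> evals_in i (Lft A B m) (Lft A B v)"
| "evals_in i m v \<Longrightarrow> evals_in i (Rgt A B m) (Rgt A B v)"
| "evals_in i m (Lft A B v) \<Longrightarrow> evals_in j (sub1 n v) w \<Longrightarrow> evals_in (i + j) (Case m n p) w"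
| "evals_in i m (Rgt A B v) \<Longrightarrow> evals_in j (sub1 p v) w \<Longrightarrow> evals_in (i + j) (Case m n p) w"
| "evals_in i m v \<Longrightarrow> evals_in j n w \<Longrightarrow> evals_in (i + j) (Pair m n) (Pair v w)"
| "evals_in i m (Pair v v') \<Longrightarrow> evals_in j (sub2 n v v') w \<Longrightarrow> evals_in (i + j) (Let m n) w"
| "evals_in 0 (Lam A m) (Lam A m)"
| "evals_in i m (Lam A m') \<Longrightarrow> evals_in j n v \<Longrightarrow> evals_in l (sub1 m' v) w \<Longrightarrow>
    evals_in (i + (j + l)) (App m n) w"
| "evals_in 0 (Lift m) (Lift m)"
| "evals_in i m (Lift m') \<Longrightarrow> evals_in j m' v \<Longrightarrow> evals_in (i + j) (Force m) v"
| "evals_in i (sub1 m (Lift (Rec A m))) v \<Longrightarrow> evals_in (Suc i) (Rec A m) v"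

inductive_simps evals_in_simps:
  "evals_in l (Var x) w" "evals_in l Star w" "evals_in l (Seq m n) w" "evals_in l (Lft A B m) w"
  "evals_in l (Rgt A B m) w" "evals_in l (Case m n p) w" "evals_in l (Pair m n) w"
  "evals_in l (Let m n) w" "evals_in l (Lam A m) w" "evals_in l (App m n) w" "evals_in l (Lift m) w"
  "evals_in l (Force m) w" "evals_in l (Rec A m) w"

lemma evals_iff_evals_in: "m \<Down> v \<longleftrightarrow> (\<exists>l. evals_in l m v)"
proof
  show "m \<Down> v \<Longrightarrow> \<exists>l. evals_in l m v"
    by (induction rule: evals.induct) (blast intro: evals_in.intros)+
  show "\<exists>l. evals_in l m v \<Longrightarrow> m \<Down> v"
  proof (elim exE)
    show "evals_in l m v \<Longrightarrow> m \<Down> v" for l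
      by (induction rule: evals_in.induct) (blast intro: evals.intros)+
  qed
qed

type_synonym outcomes = "nat \<Rightarrow> trm \<Rightarrow> bool"

abbreviation (input) runs :: "trm \<Rightarrow> outcomes" where
  "runs m \<equiv> \<lambda>l w. evals_in l m w"

text \<open>Together with \<open>ret\<close>, the relational monad that adds up costs. The compound
  evaluation rules except that of \<open>Rec\<close> become equations in it, so that the single
  lemma \<open>crel_bind\<close> covers all sequencing.\<close>

definition bind :: "outcomes \<Rightarrow> (trm \<Rightarrow> outcomes) \<Rightarrow> outcomes" where
  "bind c q = (\<lambda>l w. \<exists>i j v. l = i + j \<and> c i v \<and> q v j w)"

definition ret :: "trm \<Rightarrow> outcomes" where
  "ret v = (\<lambda>l w. l = 0 \<and> w = v)"

lemma bind_ret: "bind c (\<lambda>v. ret (g v)) = (\<lambda>l w. \<exists>v. c l v \<and> w = g v)"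
  unfolding bind_def ret_def by (intro HOL.ext) (metis add_0_right)

section \<open>Evaluation rules as sequencing of outcomes\<close>

lemma runs_Seq: "runs (Seq m n) = bind (runs m) (\<lambda>v l w. v = Star \<and> evals_in l n w)"
  by (simp add: fun_eq_iff bind_def ret_def evals_in_simps)

lemma runs_Lft: "runs (Lft A B m) = bind (runs m) (\<lambda>v. ret (Lft A B v))"
  by (auto simp: fun_eq_iff bind_ret evals_in_simps)

lemma runs_Rgt: "runs (Rgt A B m) = bind (runs m) (\<lambda>v. ret (Rgt A B v))"
  by (auto simp: fun_eq_iff bind_ret evals_in_simps)

lemma runs_Case: "runs (Case m n p) = bind (runs m) (\<lambda>u l w.
    (\<exists>A B v. u = Lft A B v \<and> evals_in l (sub1 n v) w) \<or> (\<exists>A B v. u = Rgt A B v \<and> evals_in l (sub1 p v) w))"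
  by (simp add: fun_eq_iff bind_def ret_def evals_in_simps) blast

lemma runs_Pair: "runs (Pair m n) = bind (runs m) (\<lambda>v. bind (runs n) (\<lambda>w. ret (Pair v w)))"
  unfolding bind_ret by (simp add: fun_eq_iff bind_def evals_in_simps) blast

lemma runs_Let: "runs (Let m n) = bind (runs m) (\<lambda>u l w. \<exists>v v'. u = Pair v v' \<and> evals_in l (sub2 n v v') w)"
  by (simp add: fun_eq_iff bind_def ret_def evals_in_simps) blast

lemma runs_App: "runs (App m n) =
    bind (runs m) (\<lambda>u. bind (runs n) (\<lambda>v l w. \<exists>A m'. u = Lam A m' \<and> evals_in l (sub1 m' v) w))"
  by (simp add: fun_eq_iff bind_def ret_def evals_in_simps) blast

lemma runs_Force: "runs (Force m) = bind (runs m) (\<lambda>u l w. \<exists>m'. u = Lift m' \<and> evals_in l m' w)"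
  by (simp add: fun_eq_iff bind_def ret_def evals_in_simps) blast

lemma evals_in_Rec: "evals_in l (Rec A m) w \<longleftrightarrow> (\<exists>i. l = Suc i \<and> evals_in i (sub1 m (Lift (Rec A m))) w)"
  by (simp add: evals_in_simps)

text \<open>Related substitutions insert values for variables; the outcomes of such a term therefore
  coincide with \<open>ret\<close>.\<close>

lemma runs_value: "is_value v \<Longrightarrow> runs v = ret v"
proof (induction v rule: is_value.induct)
  case (5 v w)
  then show ?case
    by (simp add: runs_Pair) (simp add: bind_def ret_def)
next
  case (3 v A B)
  then show ?case
    by (simp add: runs_Lft) (simp add: bind_def ret_def)
next
  case (4 v A B)
  then show ?case
    by (simp add: runs_Rgt) (simp add: bind_def ret_def)
qed (auto simp: ret_def fun_eq_iff evals_in_simps)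

section \<open>The logical relation\<close>

context adequate_lnl_model
begin

text \<open>\<open>computes b A W k f c\<close> lifts a relation \<open>W\<close> between values to computations. For \<open>b = True\<close> (soundness) it is indexed
  by the unfoldings of recursion still available. For \<open>b = False\<close> (adequacy) the index plays no role;
  since \<open>f\<close> is only observed through maps into the unit, the relation is closed under suprema of
  chains although \<open>W\<close> need not be.\<close>

definition computes :: "bool \<Rightarrow> ty \<Rightarrow> (nat \<Rightarrow> 'ac \<Rightarrow> trm \<Rightarrow> bool) \<Rightarrow> nat \<Rightarrow> 'ac \<Rightarrow> outcomes \<Rightarrow> bool" where
  "computes b A W k f c \<longleftrightarrow> f \<in> hom \<C> (unit \<C>) (tyC A) \<and>
     (if b then \<forall>l\<le>k. \<forall>v. c l v \<longrightarrow> W (k - l) f v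
      else \<forall>\<kappa>\<in>hom \<C> (tyC A) (unit \<C>). \<kappa> \<bullet> f \<noteq> bot_unit M \<longrightarrow>
        (\<exists>l v g. c l v \<and> W k g v \<and> \<kappa> \<bullet> g \<noteq> bot_unit M))"

text \<open>\<open>computes\<close> takes the value relation as a parameter so that this recursion
  on types stays primitive. At \<open>TLolli\<close> the \<open>Lpoint\<close> condition is demanded
  explicitly, as behaviour under application does not imply that the point comes from
  \<open>\<V>\<close>; at the other types it follows (\<open>vrel_Lpoint\<close>). Quantifying over
  \<open>j \<le> k\<close> makes the relation monotone in the index.\<close>

primrec vrel :: "bool \<Rightarrow> ty \<Rightarrow> nat \<Rightarrow> 'ac \<Rightarrow> trm \<Rightarrow> bool" where
  "vrel b TI k f v \<longleftrightarrow> f = idC (unit \<C>) \<and> v = Star"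
| "vrel b (TSum A B) k f v \<longleftrightarrow>
     (\<exists>g w. f = inj1 \<C> (tyC A) (tyC B) \<bullet> g \<and> v = Lft A B w \<and> vrel b A k g w) \<or>
     (\<exists>g w. f = inj2 \<C> (tyC A) (tyC B) \<bullet> g \<and> v = Rgt A B w \<and> vrel b B k g w)"
| "vrel b (TTen A B) k f v \<longleftrightarrow>
     (\<exists>g h w w'. f = pt \<C> g h \<and> v = Pair w w' \<and> vrel b A k g w \<and> vrel b B k h w')"
| "vrel b (TLolli A B) k f v \<longleftrightarrow> Lpoint (isoL (TLolli A B)) (tyV (TLolli A B)) f \<and>
     (\<exists>m. v = Lam A m \<and> (\<forall>j\<le>k. \<forall>g w. vrel b A j g w \<longrightarrow>
        computes b B (vrel b B) j (app A B f g) (runs (sub1 m w))))"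
| "vrel b (TBang A) k f v \<longleftrightarrow>
     (\<exists>m g. f = promote g \<and> v = Lift m \<and> (\<forall>j\<le>k. computes b A (vrel b A) j g (runs m)))"

abbreviation "crel b A k f c \<equiv> computes b A (vrel b A) k f c"

lemma crel_hom: "crel b A k f c \<Longrightarrow> f \<in> hom \<C> (unit \<C>) (tyC A)"
  by (simp add: computes_def)

lemma vrel_mono: "vrel b A k f v \<Longrightarrow> j \<le> k \<Longrightarrow> vrel b A j f v"
proof (induction A arbitrary: f v)
  case (TSum A B)
  then show ?case unfolding vrel.simps by blast
next
  case (TTen A B)
  then show ?case unfolding vrel.simps by blast
next
  case (TLolli A B)
  from TLolli.prems show ?case
    unfolding vrel.simps using order_trans[of _ j k] by blast
next
  case (TBang A)
  from TBang.prems show ?case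
    unfolding vrel.simps using order_trans[of _ j k] by blast
qed simp

lemma vrel_Lpoint: "vrel b A k f v \<Longrightarrow> Lpoint (isoL A) (tyV A) f"
proof (induction A arbitrary: f v)
  case TI
  then show ?case by (simp add: Lpoint_unit)
next
  case (TSum A B)
  from TSum.prems show ?case
    unfolding vrel.simps
  proof (elim disjE exE conjE)
    fix g w assume "f = inj1 \<C> (tyC A) (tyC B) \<bullet> g" "vrel b A k g w"
    then show ?thesis
      using TSum.IH(1) Lpoint_inj(1) by blast
  next
    fix g w assume "f = inj2 \<C> (tyC A) (tyC B) \<bullet> g" "vrel b B k g w"
    then show ?thesis
      using TSum.IH(2) Lpoint_inj(2) by blast
  qed
next
  case (TTen A B)
  then obtain g h w w' where *: "f = pt \<C> g h" "vrel b A k g w" "vrel b B k h w'"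
    by auto
  then show ?case
    using Lpoint_pt[OF TTen.IH(1)[OF *(2)] TTen.IH(2)[OF *(3)]] by simp
next
  case (TBang A)
  then obtain g where "f = promote g" "g \<in> hom \<C> (unit \<C>) (tyC A)"
    unfolding vrel.simps using crel_hom order_refl by blast
  then show ?case
    using Fpoint_imp_Lpoint[OF Fpoint_promote[of g A]] by simp
next
  case (TLolli A B)
  then show ?case by simp
qed

text \<open>Only function values need not come from \<open>\<B>\<close>, and a non-linear type has
  no function type outside a \<open>TBang\<close>.\<close>

lemma vrel_Fpoint: "nonlinear A \<Longrightarrow> vrel b A k f v \<Longrightarrow> Fpoint (isoF A) (tyB A) f"
proof (induction A arbitrary: f v)
  case TI
  then show ?case by (simp add: Fpoint_unit)
next
  case (TSum A B)
  then have nl: "nonlinear A" "nonlinear B" by simp_all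
  from TSum.prems(2) show ?case
    unfolding vrel.simps
  proof (elim disjE exE conjE)
    fix g w assume "f = inj1 \<C> (tyC A) (tyC B) \<bullet> g" "vrel b A k g w"
    then show ?thesis
      using TSum.IH(1) Fpoint_inj(1)[of A B] nl by blast
  next
    fix g w assume "f = inj2 \<C> (tyC A) (tyC B) \<bullet> g" "vrel b B k g w"
    then show ?thesis
      using TSum.IH(2) Fpoint_inj(2)[of A B] nl by blast
  qed
next
  case (TTen A B)
  then obtain g h w w' where *: "f = pt \<C> g h" "vrel b A k g w" "vrel b B k h w'"
    by auto
  then show ?case
    using Fpoint_pt[OF TTen.IH(1)[OF _ *(2)] TTen.IH(2)[OF _ *(3)]] TTen.prems(1) by simp
next
  case (TBang A)
  then obtain g where "f = promote g" "g \<in> hom \<C> (unit \<C>) (tyC A)"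
    unfolding vrel.simps using crel_hom order_refl by blast
  then show ?case
    using Fpoint_promote[of g A] by simp
qed simp

lemma vrel_hom: "vrel b A k f v \<Longrightarrow> f \<in> hom \<C> (unit \<C>) (tyC A)"
  using vrel_Lpoint[of b A k f v] by (auto simp: Lpoint_def)

lemma vrel_is_value: "vrel b A k f v \<Longrightarrow> is_value v"
  by (induction A arbitrary: f v) (auto intro: is_value.intros)

lemma crel_ret: "vrel b A k f v \<Longrightarrow> crel b A k f (ret v)"
  using vrel_hom[of b A k f v] unfolding computes_def ret_def by auto

lemma crel_value: "vrel b A k f v \<Longrightarrow> crel b A k f (runs v)"
  using crel_ret runs_value[OF vrel_is_value] by metis

lemma crel_Star: "crel b TI k (idC (unit \<C>)) (runs Star)"
  by (rule crel_value) simp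

text \<open>For soundness the cost \<open>i\<close> of the first part is deducted, and the
  continuation runs at index \<open>k - i\<close>. For adequacy an observation \<kappa> of the whole
  becomes, through \<open>h\<close>, an observation of \<open>f\<close>. It yields a value
  \<open>g\<close>, and \<kappa> then observes the continuation at \<open>g\<close>.\<close>

lemma crel_bind:
  assumes f: "crel b A k f c" and h: "h \<in> hom \<C> (tyC A) (tyC B)"
    and q: "\<And>j g v. j \<le> k \<Longrightarrow> vrel b A j g v \<Longrightarrow> crel b B j (h \<bullet> g) (q v)"
  shows "crel b B k (h \<bullet> f) (bind c q)"
proof (cases b)
  case True
  have "vrel b B (k - l) (h \<bullet> f) w" if l: "l \<le> k" and w: "bind c q l w" for l w
  proof -
    obtain i j v where *: "l = i + j" "c i v" "q v j w"
      using w unfolding bind_def by blast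
    have "vrel b A (k - i) f v"
      using f True * l unfolding computes_def by simp
    then have "crel b B (k - i) (h \<bullet> f) (q v)"
      using q[of "k - i" f v] by simp
    then have "vrel b B (k - i - j) (h \<bullet> f) w"
      using True * l unfolding computes_def by simp
    then show ?thesis
      using * by simp
  qed
  then show ?thesis
    using True h crel_hom[OF f] unfolding computes_def by simp
next
  case False
  have "\<exists>l w g. bind c q l w \<and> vrel b B k g w \<and> \<kappa> \<bullet> g \<noteq> bot_unit M"
    if \<kappa>: "\<kappa> \<in> hom \<C> (tyC B) (unit \<C>)" and ne: "\<kappa> \<bullet> h \<bullet> f \<noteq> bot_unit M" for \<kappa>
  proof -
    have "(\<kappa> \<bullet> h) \<bullet> f \<noteq> bot_unit M" "\<kappa> \<bullet> h \<in> hom \<C> (tyC A) (unit \<C>)"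
      using \<kappa> ne h crel_hom[OF f] by simp_all
    then obtain i v g where g: "c i v" "vrel b A k g v" "(\<kappa> \<bullet> h) \<bullet> g \<noteq> bot_unit M"
      using f False unfolding computes_def by auto
    then have "\<kappa> \<bullet> h \<bullet> g \<noteq> bot_unit M"
      using \<kappa> h vrel_hom[OF g(2)] by simp
    then obtain j w g' where "q v j w" "vrel b B k g' w" "\<kappa> \<bullet> g' \<noteq> bot_unit M"
      using q[OF order_refl g(2)] False \<kappa> unfolding computes_def by auto
    then show ?thesis
      using g(1) unfolding bind_def by blast
  qed
  then show ?thesis
    using False h crel_hom[OF f] unfolding computes_def by simp
qed

text \<open>The other component \<open>e\<close> is absorbed into the map: \<open>?h\<close> inserts
  it to the right of its argument. As it is merely carried along, \<open>e\<close> may be a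
  computation still to be evaluated.\<close>

lemma crel_bind_left:
  assumes f: "crel b A k f c" and e: "e \<in> hom \<C> (unit \<C>) Y" and h: "h \<in> hom \<C> (tyC A \<boxtimes> Y) (tyC B)"
    and q: "\<And>j g v. j \<le> k \<Longrightarrow> vrel b A j g v \<Longrightarrow> crel b B j (h \<bullet> pt \<C> g e) (q v)"
  shows "crel b B k (h \<bullet> pt \<C> f e) (bind c q)"
proof -
  have Y: "Y \<in> obj \<C>" using e by auto
  let ?h = "h \<bullet> (idC (tyC A) \<otimes> e) \<bullet> invC (run \<C> (tyC A))"
  have *: "?h \<bullet> g = h \<bullet> pt \<C> g e" if "g \<in> hom \<C> (unit \<C>) (tyC A)" for g
    using that e h Y by (simp add: CM.inv_run_cmp)
  have "crel b B k (?h \<bullet> f) (bind c q)"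
  proof (rule crel_bind[OF f])
    show "?h \<in> hom \<C> (tyC A) (tyC B)"
      using e h Y by simp
    show "crel b B j (?h \<bullet> g) (q v)" if "j \<le> k" "vrel b A j g v" for j g v
      using q[OF that] *[OF vrel_hom[OF that(2)]] by (simp only:)
  qed
  then show ?thesis
    using *[OF crel_hom[OF f]] by (simp only:)
qed

lemma crel_bind_right:
  assumes f: "crel b A k f c" and e: "e \<in> hom \<C> (unit \<C>) Y" and h: "h \<in> hom \<C> (Y \<boxtimes> tyC A) (tyC B)"
    and q: "\<And>j g v. j \<le> k \<Longrightarrow> vrel b A j g v \<Longrightarrow> crel b B j (h \<bullet> pt \<C> e g) (q v)"
  shows "crel b B k (h \<bullet> pt \<C> e f) (bind c q)"
proof -
  have Y: "Y \<in> obj \<C>" using e by auto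
  let ?h = "h \<bullet> (e \<otimes> idC (tyC A)) \<bullet> invC (lun \<C> (tyC A))"
  have *: "?h \<bullet> g = h \<bullet> pt \<C> e g" if "g \<in> hom \<C> (unit \<C>) (tyC A)" for g
    using that e h Y by (simp add: CM.inv_lun_cmp)
  have "crel b B k (?h \<bullet> f) (bind c q)"
  proof (rule crel_bind[OF f])
    show "?h \<in> hom \<C> (tyC A) (tyC B)"
      using e h Y by simp
    show "crel b B j (?h \<bullet> g) (q v)" if "j \<le> k" "vrel b A j g v" for j g v
      using q[OF that] *[OF vrel_hom[OF that(2)]] by (simp only:)
  qed
  then show ?thesis
    using *[OF crel_hom[OF f]] by (simp only:)
qed

section \<open>Environments related to substitutions\<close>

definition related :: "bool \<Rightarrow> nat \<Rightarrow> (nat \<Rightarrow> 'ac) \<Rightarrow> (nat \<Rightarrow> trm) \<Rightarrow> ctx \<Rightarrow> bool" where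
  "related b k \<rho> s \<Gamma> \<longleftrightarrow> (\<forall>(x, A)\<in>set \<Gamma>. vrel b A k (\<rho> x) (s x))"

lemma related_append [simp]: "related b k \<rho> s (\<Gamma> @ \<Sigma>) \<longleftrightarrow> related b k \<rho> s \<Gamma> \<and> related b k \<rho> s \<Sigma>"
  by (auto simp: related_def)

lemma related_single [simp]: "related b k \<rho> s ((x, A) # \<Gamma>) \<longleftrightarrow> vrel b A k (\<rho> x) (s x) \<and> related b k \<rho> s \<Gamma>"
  by (auto simp: related_def)

lemma related_Nil [simp]: "related b k \<rho> s []"
  by (simp add: related_def)

lemma related_shift [simp]: "related b k (case_nat g \<rho>) (case_nat v s) (shift \<Gamma>) \<longleftrightarrow> related b k \<rho> s \<Gamma>"
  by (auto simp: related_def shift_def)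

lemma related_mono: "related b k \<rho> s \<Gamma> \<Longrightarrow> j \<le> k \<Longrightarrow> related b j \<rho> s \<Gamma>"
  unfolding related_def using vrel_mono by blast

lemma related_Lenv: "related b k \<rho> s \<Gamma> \<Longrightarrow> Lenv \<rho> \<Gamma>"
  unfolding related_def Lenv_def using vrel_Lpoint by blast

lemma related_Fenv: "related b k \<rho> s \<Phi> \<Longrightarrow> nonlinear_ctx \<Phi> \<Longrightarrow> Fenv \<rho> \<Phi>"
  unfolding related_def Fenv_def nonlinear_ctx_def using vrel_Fpoint by fastforce

lemma related_points [simp]: "related b k \<rho> s \<Gamma> \<Longrightarrow> points \<rho> \<Gamma>"
  unfolding related_def points_def using vrel_hom by blast

lemma ctx_split_related:
  assumes "nonlinear_ctx \<Phi>" "related b k \<rho> s (\<Phi> @ \<Gamma>)" "related b k \<rho> s (\<Phi> @ \<Sigma>)"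
  shows "ctx_split \<Phi> \<Gamma> \<Sigma> \<bullet> env \<rho> (\<Phi> @ \<Gamma> @ \<Sigma>) = pt \<C> (env \<rho> (\<Phi> @ \<Gamma>)) (env \<rho> (\<Phi> @ \<Sigma>))"
  using assms related_Fenv related_points[of b k \<rho> s "\<Phi> @ \<Gamma> @ \<Sigma>"] by (intro ctx_split_env) auto

text \<open>The term occurs in its own unfolding. For soundness an unfolding costs one step, so
  induction on the index breaks this circle; for adequacy induction along the approximants takes its
  place.\<close>

lemma crel_Rec:
  assumes \<Phi>: "nonlinear_ctx \<Phi>" and f: "f \<in> hom \<C> (ctxC (\<Phi> @ [(0, TBang A)])) (tyC A)"
    and \<rho>: "Fenv \<rho> \<Phi>" "points \<rho> \<Phi>"
    and body: "\<And>j g. j \<le> k \<Longrightarrow> (\<And>i. i \<le> j \<Longrightarrow> crel b A i g (runs (Rec A m))) \<Longrightarrow>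
      crel b A j (rec_body \<Phi> A f \<rho> g) (runs (sub1 m (Lift (Rec A m))))"
  shows "crel b A k (rec_fold \<Phi> A f \<bullet> rec_unfold \<Phi> \<bullet> env \<rho> \<Phi>) (runs (Rec A m))"
proof (cases b)
  case True
  let ?r = "rec_fold \<Phi> A f \<bullet> rec_unfold \<Phi> \<bullet> env \<rho> \<Phi>"
  have r: "?r \<in> hom \<C> (unit \<C>) (tyC A)"
    using \<Phi> f \<rho> by simp
  have "crel b A j ?r (runs (Rec A m))" if "j \<le> k" for j
    using that
  proof (induction j rule: less_induct)
    case (less j)
    have "vrel b A (j - l) ?r v" if l: "l \<le> j" "evals_in l (Rec A m) v" for l v
    proof -
      obtain i where i: "l = Suc i" "evals_in i (sub1 m (Lift (Rec A m))) v"
        using l evals_in_Rec by blast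
      \<comment> \<open>Here \<open>j\<close> is positive because \<open>Suc i \<le> j\<close>, so
        the induction hypothesis covers all indices up to \<open>j - 1\<close>.\<close>
      have "crel b A (j - 1) (rec_body \<Phi> A f \<rho> ?r) (runs (sub1 m (Lift (Rec A m))))"
        by (rule body) (use less i l in auto)
      then have "crel b A (j - 1) ?r (runs (sub1 m (Lift (Rec A m))))"
        by (simp only: rec_fixpoint[OF \<Phi> f \<rho>, symmetric])
      then have "vrel b A (j - 1 - i) ?r v"
        using True i l unfolding computes_def by auto
      then show ?thesis
        using i by simp
    qed
    then show ?case
      using True r unfolding computes_def by simp
  qed
  then show ?thesis by simp
next
  case False
  let ?D = "hom \<C> (unit \<C>) (tyC A)"
  have "\<forall>j\<le>k. crel b A j (rec_fold \<Phi> A f \<bullet> rec_unfold \<Phi> \<bullet> env \<rho> \<Phi>) (runs (Rec A m))"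
  proof (rule rec_induct[OF \<Phi> f \<rho>])
    \<comment> \<open>Vacuous: composition is strict, so no \<kappa> observes \<bottom>.\<close>
    show "\<forall>j\<le>k. crel b A j (botC (unit \<C>) (tyC A)) (runs (Rec A m))"
      using False by (simp add: computes_def bot_unit_def)
  next
    fix g assume "\<forall>j\<le>k. crel b A j g (runs (Rec A m))"
    then have "crel b A j (rec_body \<Phi> A f \<rho> g) (runs (sub1 m (Lift (Rec A m))))" if "j \<le> k" for j
      using that by (intro body) auto
    \<comment> \<open>The outcomes of \<open>Rec\<close> are those of its unfolding at a cost one
      higher, and for \<open>b = False\<close> only the existence of an outcome counts.\<close>
    then show "\<forall>j\<le>k. crel b A j (rec_body \<Phi> A f \<rho> g) (runs (Rec A m))"
      using False unfolding computes_def evals_in_Rec by (simp del: in_hom_iff) blast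
  next
    fix s x
    assume s: "chain_in ?D (leC M) s" "sup_in ?D (leC M) s x"
      and P: "\<And>n. \<forall>j\<le>k. crel b A j (s n) (runs (Rec A m))"
    have x: "x \<in> ?D" and sn: "\<And>n. s n \<in> ?D"
      using s by (auto simp: sup_in_def chain_in_def)
    \<comment> \<open>By continuity, if \<kappa> took every \<open>s n\<close> to \<bottom>, it
      would take the supremum there as well. The value witnessing the claim for \<open>x\<close> is
      thus one for a single \<open>s n\<close>, and no limit of values is formed.\<close>
    have "\<exists>n. \<kappa> \<bullet> s n \<noteq> bot_unit M" if \<kappa>: "\<kappa> \<in> hom \<C> (tyC A) (unit \<C>)" "\<kappa> \<bullet> x \<noteq> bot_unit M" for \<kappa>
    proof (rule ccontr)
      assume "\<nexists>n. \<kappa> \<bullet> s n \<noteq> bot_unit M"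
      then have bots: "(\<lambda>n. \<kappa> \<bullet> s n) = (\<lambda>n. bot_unit M)"
        by simp
      let ?E = "hom \<C> (unit \<C>) (unit \<C>)"
      have "sup_in ?E (leC M) (\<lambda>n. \<kappa> \<bullet> s n) (\<kappa> \<bullet> x)"
        using cmp_continuous(1)[of "unit \<C>" "tyC A" "unit \<C>" \<kappa>] s \<kappa> unfolding scott_continuous_def by auto
      moreover have "sup_in ?E (leC M) (\<lambda>n. bot_unit M) (bot_unit M)"
        by (simp add: sup_in_def bot_unit_def le_refl)
      ultimately show False
        using cpo_sup_unique[OF cpo_C, of "unit \<C>" "unit \<C>"] \<kappa>(2) bots by auto
    qed
    then show "\<forall>j\<le>k. crel b A j x (runs (Rec A m))"
      using False x P unfolding computes_def by (simp del: in_hom_iff) blast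
  qed
  then show ?thesis by simp
qed

text \<open>In the cases with several subterms the denotation is a fixed map applied to a pair of
  points. Computations in it are replaced by values one at a time, in evaluation order, by
  \<open>crel_bind_left\<close> and \<open>crel_bind_right\<close>; the environment follows to lower
  indices by \<open>related_mono\<close>.\<close>

theorem fundamental:
  assumes "derives c d \<Gamma> m A" "c = Affine \<Longrightarrow> terminal \<V> (unit \<V>)" "related b k \<rho> s \<Gamma>"
  shows "crel b A k (den d \<bullet> env \<rho> \<Gamma>) (runs (sub s m))"
  using assms
proof (induction arbitrary: k \<rho> s rule: derives.induct)
  case (var_l \<Phi> x A)
  then have v: "vrel b A k (\<rho> x) (s x)" and \<Phi>: "related b k \<rho> s \<Phi>" by simp_all
  have "den (DVarL \<Phi> x A) \<bullet> env \<rho> (\<Phi> @ [(x, A)]) = \<rho> x"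
    using var_l v \<Phi> vrel_hom[OF v] discard_env[OF _ related_Fenv[OF \<Phi>]] ctxC_snoc_cong[of \<Phi> x A] by simp
  then show ?case
    using crel_value[OF v] by simp
next
  case (star_l \<Phi>)
  have "den (DStarL \<Phi>) \<bullet> env \<rho> \<Phi> = idC (unit \<C>)"
    using star_l discard_env[OF _ related_Fenv] by simp
  then show ?case
    by (simp only: sub.simps crel_Star)
next
  case (lift_l \<Phi> d m A)
  have d: "den d \<in> hom \<C> (ctxC \<Phi>) (tyC A)"
    using den_hom[OF lift_l(3)] lift_l by simp
  have "den (DLiftL \<Phi> d) \<bullet> env \<rho> \<Phi> = promote (den d \<bullet> env \<rho> \<Phi>)"
    using lift_l d box_env[OF _ related_Fenv, of \<Phi> b k \<rho> s] by (simp add: promote_def bang_cmp)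
  moreover have "vrel b (TBang A) k (promote (den d \<bullet> env \<rho> \<Phi>)) (Lift (sub s m))"
    unfolding vrel.simps using lift_l.IH lift_l.prems related_mono by blast
  ultimately show ?case
    by (simp only: sub.simps crel_value)
next
  case (var_a \<Gamma> x A)
  then have v: "vrel b A k (\<rho> x) (s x)" and \<Gamma>: "related b k \<rho> s \<Gamma>" by simp_all
  have "den (DVarA \<Gamma> x A) \<bullet> env \<rho> (\<Gamma> @ [(x, A)]) = \<rho> x"
    using var_a v \<Gamma> vrel_hom[OF v] affine_discard_env[OF _ related_Lenv[OF \<Gamma>]] ctxC_snoc_cong[of \<Gamma> x A] by simp
  then show ?case
    using crel_value[OF v] by simp
next
  case (star_a \<Gamma>)
  have "den (DStarA \<Gamma>) \<bullet> env \<rho> \<Gamma> = idC (unit \<C>)"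
    using star_a affine_discard_env[OF _ related_Lenv] by simp
  then show ?case
    by (simp only: sub.simps crel_Star)
next
  case (lift_a \<Phi> \<Gamma> d m A)
  then have r: "related b k \<rho> s \<Phi>" "related b k \<rho> s \<Gamma>" by simp_all
  have d: "den d \<in> hom \<C> (ctxC \<Phi>) (tyC A)"
    using den_hom[OF lift_a(4)] lift_a by simp
  have "den (DLiftA \<Phi> \<Gamma> d) \<bullet> env \<rho> (\<Phi> @ \<Gamma>) = promote (den d \<bullet> env \<rho> \<Phi>)"
    using lift_a r d box_env[OF _ related_Fenv[OF r(1)]] affine_discard_env[OF _ related_Lenv[OF r(2)]]
    by (simp add: promote_def bang_cmp)
  moreover have "vrel b (TBang A) k (promote (den d \<bullet> env \<rho> \<Phi>)) (Lift (sub s m))"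
    unfolding vrel.simps using lift_a.IH lift_a.prems(1) r related_mono by blast
  ultimately show ?case
    by (simp only: sub.simps crel_value)
next
  case (seq \<Phi> \<Gamma> \<Sigma> d m e n A)
  then have r: "related b k \<rho> s (\<Phi> @ \<Gamma>)" "related b k \<rho> s (\<Phi> @ \<Sigma>)" by simp_all
  note split = ctx_split_related[OF seq(1) r] and pts = related_points[OF r(1)] related_points[OF r(2)]
  have d: "den d \<in> hom \<C> (ctxC (\<Phi> @ \<Gamma>)) (tyC TI)" and e: "den e \<in> hom \<C> (ctxC (\<Phi> @ \<Sigma>)) (tyC A)"
    using den_hom[OF seq(3)] den_hom[OF seq(4)] seq by blast+
  let ?e = "den e \<bullet> env \<rho> (\<Phi> @ \<Sigma>)"
  have "den (DSeq \<Phi> \<Gamma> \<Sigma> A d e) \<bullet> env \<rho> (\<Phi> @ \<Gamma> @ \<Sigma>) = lun \<C> (tyC A) \<bullet> pt \<C> (den d \<bullet> env \<rho> (\<Phi> @ \<Gamma>)) ?e"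
    using seq r d e split pts by simp
  moreover have "crel b A k (lun \<C> (tyC A) \<bullet> pt \<C> (den d \<bullet> env \<rho> (\<Phi> @ \<Gamma>)) ?e) (runs (sub s (Seq m n)))"
    unfolding sub.simps runs_Seq
  proof (rule crel_bind_left)
    show "crel b TI k (den d \<bullet> env \<rho> (\<Phi> @ \<Gamma>)) (runs (sub s m))"
      using seq.IH(1) seq.prems(1) r by blast
    show "crel b A j (lun \<C> (tyC A) \<bullet> pt \<C> g ?e) (\<lambda>l w. v = Star \<and> evals_in l (sub s n) w)"
      if "j \<le> k" "vrel b TI j g v" for j g v
      using seq.IH(2)[OF _ related_mono[OF r(2) that(1)]] seq.prems(1) that pts e by simp
  qed (use e pts in simp_all)
  ultimately show ?case by (simp only:)
next
  case (force d \<Gamma> m A)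
  have d: "den d \<in> hom \<C> (ctxC \<Gamma>) (tyC (TBang A))"
    using den_hom[OF force(1)] force by blast
  have "crel b A k (epsFG (tyC A) \<bullet> den d \<bullet> env \<rho> \<Gamma>) (runs (sub s (Force m)))"
    unfolding sub.simps runs_Force
  proof (rule crel_bind)
    show "crel b (TBang A) k (den d \<bullet> env \<rho> \<Gamma>) (runs (sub s m))"
      using force by blast
    show "crel b A j (epsFG (tyC A) \<bullet> g) (\<lambda>l w. \<exists>m'. v = Lift m' \<and> evals_in l m' w)"
      if v: "vrel b (TBang A) j g v" for j g v
    proof -
      obtain m' g' where g: "g = promote g'" "v = Lift m'" "crel b A j g' (runs m')"
        using v order_refl[of j] unfolding vrel.simps by blast
      then show ?thesis
        using eps_promote[OF crel_hom[OF g(3)]] by simp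
    qed
  qed (simp add: bang_ob_def)
  then show ?case
    using d force.prems by (simp add: bang_ob_def del: vrel.simps)
next
  case (lft d \<Gamma> m A B)
  have d: "den d \<in> hom \<C> (ctxC \<Gamma>) (tyC A)"
    using den_hom[OF lft(1)] lft by blast
  have "crel b (TSum A B) k (inj1 \<C> (tyC A) (tyC B) \<bullet> den d \<bullet> env \<rho> \<Gamma>) (runs (sub s (Lft A B m)))"
    unfolding sub.simps runs_Lft
  proof (rule crel_bind)
    show "crel b A k (den d \<bullet> env \<rho> \<Gamma>) (runs (sub s m))"
      using lft by blast
    show "crel b (TSum A B) j (inj1 \<C> (tyC A) (tyC B) \<bullet> g) (ret (Lft A B v))" if "vrel b A j g v" for j g v
      by (rule crel_ret) (use that in auto)
  qed simp
  then show ?case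
    using d lft.prems by (simp del: vrel.simps)
next
  case (rgt d \<Gamma> m B A)
  have d: "den d \<in> hom \<C> (ctxC \<Gamma>) (tyC B)"
    using den_hom[OF rgt(1)] rgt by blast
  have "crel b (TSum A B) k (inj2 \<C> (tyC A) (tyC B) \<bullet> den d \<bullet> env \<rho> \<Gamma>) (runs (sub s (Rgt A B m)))"
    unfolding sub.simps runs_Rgt
  proof (rule crel_bind)
    show "crel b B k (den d \<bullet> env \<rho> \<Gamma>) (runs (sub s m))"
      using rgt by blast
    show "crel b (TSum A B) j (inj2 \<C> (tyC A) (tyC B) \<bullet> g) (ret (Rgt A B v))" if "vrel b B j g v" for j g v
      by (rule crel_ret) (use that in auto)
  qed simp
  then show ?case
    using d rgt.prems by (simp del: vrel.simps)
next
  case (case_of \<Phi> \<Gamma> \<Sigma> d m A B e\<^sub>1 n C e\<^sub>2 p)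
  then have r: "related b k \<rho> s (\<Phi> @ \<Gamma>)" "related b k \<rho> s (\<Phi> @ \<Sigma>)" by simp_all
  note split = ctx_split_related[OF case_of(1) r] and pts = related_points[OF r(1)] related_points[OF r(2)]
  have d: "den d \<in> hom \<C> (ctxC (\<Phi> @ \<Gamma>)) (tyC (TSum A B))"
    and e1: "den e\<^sub>1 \<in> hom \<C> (ctxC (shift (\<Phi> @ \<Sigma>) @ [(0, A)])) (tyC C)"
    and e2: "den e\<^sub>2 \<in> hom \<C> (ctxC (shift (\<Phi> @ \<Sigma>) @ [(0, B)])) (tyC C)"
    using den_hom[OF case_of(3)] den_hom[OF case_of(4)] den_hom[OF case_of(5)] case_of by blast+
  let ?\<rho> = "env \<rho> (\<Phi> @ \<Sigma>)" and ?X = "ctxC (\<Phi> @ \<Sigma>)"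
  \<comment> \<open>The rest of the computation after the scrutinee, with the environment as its
    fixed left component.\<close>
  let ?h = "copair \<C> (den e\<^sub>1 \<bullet> invC (ext (\<Phi> @ \<Sigma>) A)) (den e\<^sub>2 \<bullet> invC (ext (\<Phi> @ \<Sigma>) B)) \<bullet> distr ?X (tyC A) (tyC B)"
  have h: "?h \<in> hom \<C> (?X \<boxtimes> tyC (TSum A B)) (tyC C)"
    using e1 e2 by simp
  have "den (DCase \<Phi> \<Gamma> \<Sigma> A B d e\<^sub>1 e\<^sub>2) \<bullet> env \<rho> (\<Phi> @ \<Gamma> @ \<Sigma>) = ?h \<bullet> pt \<C> ?\<rho> (den d \<bullet> env \<rho> (\<Phi> @ \<Gamma>))"
    using case_of r d e1 e2 split pts by simp
  moreover have "crel b C k (?h \<bullet> pt \<C> ?\<rho> (den d \<bullet> env \<rho> (\<Phi> @ \<Gamma>))) (runs (sub s (Case m n p)))"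
    unfolding sub.simps runs_Case
  proof (rule crel_bind_right[OF _ _ h])
    show "crel b (TSum A B) k (den d \<bullet> env \<rho> (\<Phi> @ \<Gamma>)) (runs (sub s m))"
      using case_of.IH(1) case_of.prems(1) r by blast
    show "?\<rho> \<in> hom \<C> (unit \<C>) ?X"
      using pts by simp
    fix j g u assume j: "j \<le> k" and "vrel b (TSum A B) j g u"
    then consider (l) g' v where "g = inj1 \<C> (tyC A) (tyC B) \<bullet> g'" "u = Lft A B v" "vrel b A j g' v"
      | (r) g' v where "g = inj2 \<C> (tyC A) (tyC B) \<bullet> g'" "u = Rgt A B v" "vrel b B j g' v"
      by auto
    then show "crel b C j (?h \<bullet> pt \<C> ?\<rho> g) (\<lambda>l w.
      (\<exists>A B v. u = Lft A B v \<and> evals_in l (sub1 (sub (up_sub s) n) v) w) \<or>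
      (\<exists>A B v. u = Rgt A B v \<and> evals_in l (sub1 (sub (up_sub s) p) v) w))"
    proof cases
      case l
      have g': "g' \<in> hom \<C> (unit \<C>) (tyC A)" using vrel_hom[OF l(3)] .
      have "?h \<bullet> pt \<C> ?\<rho> g = den e\<^sub>1 \<bullet> env (case_nat g' \<rho>) (shift (\<Phi> @ \<Sigma>) @ [(0, A)])"
        using l(1) g' pts e1 e2 distr_pt(1)[of ?\<rho> "\<Phi> @ \<Sigma>" g' A B] inv_ext_env[of \<rho> "\<Phi> @ \<Sigma>" g' A] by simp
      then show ?thesis
        using case_of.IH(2)[of j "case_nat g' \<rho>" "case_nat v s"] case_of.prems(1) l related_mono[OF r(2) j] by simp
    next
      case r': r
      have g': "g' \<in> hom \<C> (unit \<C>) (tyC B)" using vrel_hom[OF r'(3)] .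
      have "?h \<bullet> pt \<C> ?\<rho> g = den e\<^sub>2 \<bullet> env (case_nat g' \<rho>) (shift (\<Phi> @ \<Sigma>) @ [(0, B)])"
        using r'(1) g' pts e1 e2 distr_pt(2)[of ?\<rho> "\<Phi> @ \<Sigma>" g' B A] inv_ext_env[of \<rho> "\<Phi> @ \<Sigma>" g' B] by simp
      then show ?thesis
        using case_of.IH(3)[of j "case_nat g' \<rho>" "case_nat v s"] case_of.prems(1) r' related_mono[OF r(2) j] by simp
    qed
  qed
  ultimately show ?case by (simp only:)
next
  case (pair \<Phi> \<Gamma> \<Sigma> d m A e n B)
  then have r: "related b k \<rho> s (\<Phi> @ \<Gamma>)" "related b k \<rho> s (\<Phi> @ \<Sigma>)" by simp_all
  note split = ctx_split_related[OF pair(1) r] and pts = related_points[OF r(1)] related_points[OF r(2)]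
  have d: "den d \<in> hom \<C> (ctxC (\<Phi> @ \<Gamma>)) (tyC A)" and e: "den e \<in> hom \<C> (ctxC (\<Phi> @ \<Sigma>)) (tyC B)"
    using den_hom[OF pair(3)] den_hom[OF pair(4)] pair by blast+
  \<comment> \<open>The identity \<open>?i\<close> gives pairing the shape of a map applied to a
    pair, as the bind lemmas require.\<close>
  let ?e = "den e \<bullet> env \<rho> (\<Phi> @ \<Sigma>)" and ?i = "idC (tyC (TTen A B))"
  have "den (DPair \<Phi> \<Gamma> \<Sigma> d e) \<bullet> env \<rho> (\<Phi> @ \<Gamma> @ \<Sigma>) = ?i \<bullet> pt \<C> (den d \<bullet> env \<rho> (\<Phi> @ \<Gamma>)) ?e"
    using pair r d e split pts by simp
  moreover have "crel b (TTen A B) k (?i \<bullet> pt \<C> (den d \<bullet> env \<rho> (\<Phi> @ \<Gamma>)) ?e) (runs (sub s (Pair m n)))"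
    unfolding sub.simps runs_Pair
  proof (rule crel_bind_left)
    show "crel b A k (den d \<bullet> env \<rho> (\<Phi> @ \<Gamma>)) (runs (sub s m))"
      using pair.IH(1) pair.prems(1) r by blast
    show "crel b (TTen A B) j (?i \<bullet> pt \<C> g ?e) (bind (runs (sub s n)) (\<lambda>w. ret (Pair v w)))"
      if j: "j \<le> k" and g: "vrel b A j g v" for j g v
    proof (rule crel_bind_right)
      show "crel b B j ?e (runs (sub s n))"
        using pair.IH(2)[OF _ related_mono[OF r(2) j]] pair.prems(1) by blast
      show "g \<in> hom \<C> (unit \<C>) (tyC A)"
        using vrel_hom[OF g] .
      fix i h w assume i: "i \<le> j" and h: "vrel b B i h w"
      have "vrel b (TTen A B) i (pt \<C> g h) (Pair v w)"
        unfolding vrel.simps using vrel_mono[OF g i] h by blast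
      then show "crel b (TTen A B) i (?i \<bullet> pt \<C> g h) (ret (Pair v w))"
        using crel_ret vrel_hom[OF g] vrel_hom[OF h] by simp
    qed simp
  qed (use e pts in simp_all)
  ultimately show ?case by (simp only:)
next
  case (let_in \<Phi> \<Gamma> \<Sigma> d m A B e n C)
  then have r: "related b k \<rho> s (\<Phi> @ \<Gamma>)" "related b k \<rho> s (\<Phi> @ \<Sigma>)" by simp_all
  note split = ctx_split_related[OF let_in(1) r] and pts = related_points[OF r(1)] related_points[OF r(2)]
  let ?\<Delta> = "\<Phi> @ \<Sigma>"
  have d: "den d \<in> hom \<C> (ctxC (\<Phi> @ \<Gamma>)) (tyC (TTen A B))"
    and e: "den e \<in> hom \<C> (ctxC (shift (shift ?\<Delta>) @ [(1, A), (0, B)])) (tyC C)"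
    using den_hom[OF let_in(3)] den_hom[OF let_in(4)] let_in by blast+
  have c: "ctxC (\<Phi> @ \<Sigma> @ [(1, A)]) = ctxC (\<Phi> @ \<Sigma> @ [(0, A)])"
    using ctxC_snoc_cong[of ?\<Delta> 1 A] by simp
  let ?h = "den e \<bullet> invC (ext (\<Phi> @ \<Sigma> @ [(1, A)]) B) \<bullet> (invC (ext ?\<Delta> A) \<otimes> idC (tyC B)) \<bullet>
    invC (asc \<C> (ctxC ?\<Delta>) (tyC A) (tyC B)) \<bullet> symm \<C> (tyC A \<boxtimes> tyC B) (ctxC ?\<Delta>)"
  have h: "?h \<in> hom \<C> (tyC (TTen A B) \<boxtimes> ctxC ?\<Delta>) (tyC C)"
    using e c by simp
  have "den (DLet \<Phi> \<Gamma> \<Sigma> A B d e) \<bullet> env \<rho> (\<Phi> @ \<Gamma> @ \<Sigma>) = ?h \<bullet> pt \<C> (den d \<bullet> env \<rho> (\<Phi> @ \<Gamma>)) (env \<rho> ?\<Delta>)"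
    using let_in r d e c split pts by simp
  moreover have "crel b C k (?h \<bullet> pt \<C> (den d \<bullet> env \<rho> (\<Phi> @ \<Gamma>)) (env \<rho> ?\<Delta>)) (runs (sub s (Let m n)))"
    unfolding sub.simps runs_Let
  proof (rule crel_bind_left[OF _ _ h])
    show "crel b (TTen A B) k (den d \<bullet> env \<rho> (\<Phi> @ \<Gamma>)) (runs (sub s m))"
      using let_in.IH(1) let_in.prems(1) r by blast
    show "env \<rho> ?\<Delta> \<in> hom \<C> (unit \<C>) (ctxC ?\<Delta>)"
      using pts by simp
    fix j g u assume j: "j \<le> k" and "vrel b (TTen A B) j g u"
    then obtain g1 g2 v1 v2 where u: "g = pt \<C> g1 g2" "u = Pair v1 v2" and v: "vrel b A j g1 v1" "vrel b B j g2 v2"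
      by auto
    note g = vrel_hom[OF v(1)] vrel_hom[OF v(2)]
    let ?\<rho>1 = "case_nat g1 \<rho>"
    let ?\<Delta>1 = "shift ?\<Delta> @ [(0, A)]"
    let ?\<Delta>2 = "shift (shift ?\<Delta>) @ [(1, A), (0, B)]"
    have p: "points \<rho> ?\<Delta>" "points ?\<rho>1 ?\<Delta>1"
      using pts g by simp_all
    \<comment> \<open>\<open>den\<close> uses the unshifted context with the name 1, whereas two
      uses of \<open>inv_ext_env\<close> produce shifted ones; \<open>ext\<close> sees the types
      only, so the two agree.\<close>
    have "ext (\<Phi> @ \<Sigma> @ [(1, A)]) B = ext ?\<Delta>1 B"
      by (rule ext_cong) simp
    moreover have "shift ?\<Delta>1 @ [(0, B)] = ?\<Delta>2"
      by (simp add: shift_def)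
    ultimately have "invC (ext (\<Phi> @ \<Sigma> @ [(1, A)]) B) \<bullet> pt \<C> (invC (ext ?\<Delta> A) \<bullet> pt \<C> (env \<rho> ?\<Delta>) g1) g2 =
        env (case_nat g2 ?\<rho>1) ?\<Delta>2"
      using inv_ext_env[OF p(1) g(1)] inv_ext_env[OF p(2) g(2)] by simp
    then have "?h \<bullet> pt \<C> g (env \<rho> ?\<Delta>) = den e \<bullet> env (case_nat g2 ?\<rho>1) ?\<Delta>2"
      using u g e c p by simp
    then show "crel b C j (?h \<bullet> pt \<C> g (env \<rho> ?\<Delta>))
        (\<lambda>l w. \<exists>v v'. u = Pair v v' \<and> evals_in l (sub2 (sub (up_sub (up_sub s)) n) v v') w)"
      using let_in.IH(2)[of j "case_nat g2 ?\<rho>1" "case_nat v2 (case_nat v1 s)"] let_in.prems(1) u v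
        related_mono[OF r(2) j] by simp
  qed
  ultimately show ?case by (simp only:)
next
  case (lam d \<Gamma> A m B)
  have d: "den d \<in> hom \<C> (ctxC (\<Gamma> @ [(0, A)])) (tyC B)"
    using den_hom[OF lam(1)] lam by simp
  have p: "points \<rho> \<Gamma>"
    using lam.prems by simp
  let ?f = "den (DLam \<Gamma> A B d) \<bullet> env \<rho> \<Gamma>"
  \<comment> \<open>The closure is a value: the curried body is already a map of
    \<open>\<V>\<close>, and the environment of values contributes \<open>u\<close>.\<close>
  have "Lpoint (isoL (TLolli A B)) (tyV (TLolli A B)) ?f"
  proof -
    obtain u where u: "u \<in> hom \<V> (unit \<V>) (ctxV \<Gamma>)" "env \<rho> \<Gamma> = ctx_isoL \<Gamma> \<bullet> far L u \<bullet> mun L"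
      using Lpoint_env[OF related_Lenv[OF lam.prems(2)]] unfolding Lpoint_def by blast
    let ?h = "den d \<bullet> invC (ext \<Gamma> A) \<bullet> (ctx_isoL \<Gamma> \<otimes> isoL A) \<bullet> invC (mlt L (ctxV \<Gamma>) (tyV A))"
    show ?thesis
      unfolding Lpoint_def using u d
      by (intro bexI[of _ "curry (tyV A) (ctxV \<Gamma>) ?h \<cdot>\<^bsub>\<V>\<^esub> u"]) simp_all
  qed
  moreover have "crel b B j (app A B ?f g) (runs (sub1 (sub (up_sub s) m) w))"
    if j: "j \<le> k" and g: "vrel b A j g w" for j g w
  proof -
    have "app A B ?f g = den d \<bullet> env (case_nat g \<rho>) (shift \<Gamma> @ [(0, A)])"
      using app_lam[OF d _ vrel_hom[OF g], of "env \<rho> \<Gamma>"] inv_ext_env[OF p vrel_hom[OF g]] p by simp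
    then show ?thesis
      using lam.IH[of j "case_nat g \<rho>" "case_nat w s"] lam.prems(1) g related_mono[OF lam.prems(2) j] by simp
  qed
  ultimately have "vrel b (TLolli A B) k ?f (Lam A (sub (up_sub s) m))"
    unfolding vrel.simps by blast
  then show ?case
    using crel_value unfolding sub.simps by blast
next
  case (app \<Phi> \<Gamma> \<Sigma> d m A B e n)
  then have r: "related b k \<rho> s (\<Phi> @ \<Gamma>)" "related b k \<rho> s (\<Phi> @ \<Sigma>)" by simp_all
  note split = ctx_split_related[OF app(1) r] and pts = related_points[OF r(1)] related_points[OF r(2)]
  have d: "den d \<in> hom \<C> (ctxC (\<Phi> @ \<Gamma>)) (tyC (TLolli A B))" and e: "den e \<in> hom \<C> (ctxC (\<Phi> @ \<Sigma>)) (tyC A)"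
    using den_hom[OF app(3)] den_hom[OF app(4)] app by blast+
  let ?e = "den e \<bullet> env \<rho> (\<Phi> @ \<Sigma>)"
  \<comment> \<open>\<open>app\<close> as a single map on the tensor, so that the same
    \<open>?h\<close> serves the bind of the function and that of the argument.\<close>
  let ?h = "evl M (tyV A) (tyC B) \<bullet> mlt L (tyV (TLolli A B)) (tyV A) \<bullet> (idC (tyC (TLolli A B)) \<otimes> invC (isoL A))"
  have h: "?h \<in> hom \<C> (tyC (TLolli A B) \<boxtimes> tyC A) (tyC B)"
    by simp
  have h_pt: "?h \<bullet> pt \<C> f g = app A B f g"
    if "f \<in> hom \<C> (unit \<C>) (tyC (TLolli A B))" "g \<in> hom \<C> (unit \<C>) (tyC A)" for f g
    using that by (simp add: app_def)
  have "den (DApp \<Phi> \<Gamma> \<Sigma> A B d e) \<bullet> env \<rho> (\<Phi> @ \<Gamma> @ \<Sigma>) = ?h \<bullet> pt \<C> (den d \<bullet> env \<rho> (\<Phi> @ \<Gamma>)) ?e"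
    using app r d e split pts by simp
  moreover have "crel b B k (?h \<bullet> pt \<C> (den d \<bullet> env \<rho> (\<Phi> @ \<Gamma>)) ?e) (runs (sub s (App m n)))"
    unfolding sub.simps runs_App
  proof (rule crel_bind_left[OF _ _ h])
    show "crel b (TLolli A B) k (den d \<bullet> env \<rho> (\<Phi> @ \<Gamma>)) (runs (sub s m))"
      using app.IH(1) app.prems(1) r by blast
    show "?e \<in> hom \<C> (unit \<C>) (tyC A)"
      using e pts by simp
    fix j g u assume j: "j \<le> k" and g: "vrel b (TLolli A B) j g u"
    show "crel b B j (?h \<bullet> pt \<C> g ?e)
        (bind (runs (sub s n)) (\<lambda>v l w. \<exists>A m'. u = Lam A m' \<and> evals_in l (sub1 m' v) w))"
    proof (rule crel_bind_right[OF _ _ h])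
      show "crel b A j ?e (runs (sub s n))"
        using app.IH(2)[OF _ related_mono[OF r(2) j]] app.prems(1) by blast
      show "g \<in> hom \<C> (unit \<C>) (tyC (TLolli A B))"
        using vrel_hom[OF g] .
      fix i g' v assume i: "i \<le> j" and v: "vrel b A i g' v"
      show "crel b B i (?h \<bullet> pt \<C> g g') (\<lambda>l w. \<exists>A m'. u = Lam A m' \<and> evals_in l (sub1 m' v) w)"
        unfolding h_pt[OF vrel_hom[OF g] vrel_hom[OF v]] using g i v by auto
    qed
  qed
  ultimately show ?case by (simp only:)
next
  case (fixpoint \<Phi> d A m)
  note \<Phi> = fixpoint(1)
  have d: "den d \<in> hom \<C> (ctxC (\<Phi> @ [(0, TBang A)])) (tyC A)"
    using den_hom[OF fixpoint(2)] fixpoint by simp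
  have p: "Fenv \<rho> \<Phi>" "points \<rho> \<Phi>"
    using related_Fenv \<Phi> fixpoint.prems by auto
  have "crel b A k (rec_fold \<Phi> A (den d) \<bullet> rec_unfold \<Phi> \<bullet> env \<rho> \<Phi>) (runs (Rec A (sub (up_sub s) m)))"
  proof (rule crel_Rec[OF \<Phi> d p])
    fix j g
    assume j: "j \<le> k" and g: "\<And>i. i \<le> j \<Longrightarrow> crel b A i g (runs (Rec A (sub (up_sub s) m)))"
    let ?R = "Lift (Rec A (sub (up_sub s) m))"
    \<comment> \<open>The premise provided by \<open>crel_Rec\<close> relates the recursive term at
      every index up to \<open>j\<close>, which is what the clause for \<open>TBang\<close> asks of
      the recursion variable.\<close>
    have v: "vrel b (TBang A) j (promote g) ?R"
      unfolding vrel.simps using g by blast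
    have "rec_body \<Phi> A (den d) \<rho> g = den d \<bullet> env (case_nat (promote g) \<rho>) (shift \<Phi> @ [(0, TBang A)])"
      unfolding rec_body_def using inv_ext_env[OF p(2) vrel_hom[OF v]] by simp
    then show "crel b A j (rec_body \<Phi> A (den d) \<rho> g) (runs (sub1 (sub (up_sub s) m) ?R))"
      using fixpoint.IH[of j "case_nat (promote g) \<rho>" "case_nat ?R s"] fixpoint.prems(1) v
        related_mono[OF fixpoint.prems(2) j] by simp
  qed
  then show ?case
    using \<Phi> d p by simp
next
  case (exch d \<Gamma> x A y B \<Sigma> m C)
  have d: "den d \<in> hom \<C> (ctxC (\<Gamma> @ [(x, A), (y, B)] @ \<Sigma>)) (tyC C)"
    using den_hom[OF exch(1)] exch by blast
  have r: "related b k \<rho> s (\<Gamma> @ [(x, A), (y, B)] @ \<Sigma>)"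
    using exch.prems by simp
  have "den (DExch \<Gamma> A B \<Sigma> d) \<bullet> env \<rho> (\<Gamma> @ [(y, B), (x, A)] @ \<Sigma>) = den d \<bullet> env \<rho> (\<Gamma> @ [(x, A), (y, B)] @ \<Sigma>)"
    using exchange_env[OF related_points[OF r]] exchange_hom[of \<Gamma> A B \<Sigma> y x] d
      related_points[OF exch.prems(2)] by simp
  then show ?case
    using exch.IH[OF _ r] exch.prems(1) by simp
qed

text \<open>In the empty context the environment is the identity, so the relation speaks about the
  denotation itself, for each value of the flag.\<close>

theorem adequacy:
  assumes d: "derives c d [] p TI" "c = Affine \<Longrightarrow> terminal \<V> (unit \<V>)"
  shows "den d \<noteq> bot_unit M \<longleftrightarrow> terminates p"
proof -
  have "den d \<bullet> env \<rho> [] = den d" for \<rho>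
    using den_hom[OF d] by simp
  then have *: "crel b TI k (den d) (runs p)" for b k
    using fundamental[OF d, of b k _ Var] by (simp add: related_def)
  have ide: "idC (unit \<C>) \<noteq> bot_unit M"
    using adequate by (simp add: computationally_adequate_def)
  show ?thesis
  proof
    assume "den d \<noteq> bot_unit M"
    then have "idC (unit \<C>) \<bullet> den d \<noteq> bot_unit M"
      using den_hom[OF d] by simp
    moreover have "idC (unit \<C>) \<in> hom \<C> (tyC TI) (unit \<C>)"
      by simp
    \<comment> \<open>The unit type needs just the identity as observation; a related value at
      \<open>TI\<close> is \<open>Star\<close>.\<close>
    ultimately obtain l v g where "evals_in l p v" "vrel False TI 0 g v"
      using *[of False 0] unfolding computes_def if_False by blast
    then have "p \<Down> Star"
      unfolding evals_iff_evals_in by auto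
    then show "terminates p"
      unfolding terminates_def using is_value.intros by blast
  next
    assume "terminates p"
    then obtain l v where "evals_in l p v"
      unfolding terminates_def evals_iff_evals_in by blast
    \<comment> \<open>The index has to be at least the cost of the evaluation, and \<open>l\<close>
      is that cost. Relatedness at \<open>TI\<close> then makes \<open>den d\<close> the identity,
      which differs from \<bottom> by assumption on the model.\<close>
    then have "vrel True TI (l - l) (den d) v"
      using *[of True l] unfolding computes_def if_True by blast
    then show "den d \<noteq> bot_unit M"
      using ide by simp
  qed
qed

end

theorem mainTheorem3:
  fixes M :: "('ob, 'ab, 'ov, 'av, 'oc, 'ac) ordered_lnl_model"
  shows "(lambda_l_model M \<longrightarrow> computationally_adequate M \<longrightarrow>
           (\<forall>p d. derives Linear d [] p TI \<longrightarrow>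
              (lnl_data.den M d \<noteq> bot_unit M \<longleftrightarrow> terminates p))) \<and>
         (lambda_a_model M \<longrightarrow> computationally_adequate M \<longrightarrow>
           (\<forall>p d. derives Affine d [] p TI \<longrightarrow>
              (lnl_data.den M d \<noteq> bot_unit M \<longleftrightarrow> terminates p)))"
proof (intro conjI impI allI)
  assume "lambda_l_model M" "computationally_adequate M"
  then interpret adequate_lnl_model M
    unfolding adequate_lnl_model_def adequate_lnl_model_axioms_def by (rule conjI)
  show "den d \<noteq> bot_unit M \<longleftrightarrow> terminates p" if "derives Linear d [] p TI" for p d
    using adequacy[OF that] by simp
next
  assume M: "lambda_a_model M" and "computationally_adequate M"
  \<comment> \<open>An affine model is in particular a \<open>lambda_l_model\<close>; its terminal
    unit later discharges the premise for \<open>c = Affine\<close>.\<close>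
  then interpret adequate_lnl_model M
    unfolding adequate_lnl_model_def adequate_lnl_model_axioms_def lambda_a_model_def by blast
  show "den d \<noteq> bot_unit M \<longleftrightarrow> terminates p" if "derives Affine d [] p TI" for p d
    using adequacy[OF that] lambda_a_model.unit_terminal[OF M] by simp
qed

end
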